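(* Let $(R,m)$ be a noetherian local domain containing $\mathbb{Q}$ which is excellent (or, more generally, Nagata). Then $R^+$ is $m$-adically ideal separated as an $R$-module; that is, for every ideal $I$ of $R$ one has $\bigcap_{n\ge 1} m^n\,(R^+\otimes_R I)=0$.
   Context: For an integral domain $R$, the absolute integral closure $R^+$ is the integral closure of $R$ in an algebraic closure of its fraction field. For an ideal $J$ of a ring $R$, an $R$-module $M$ is $J$-adically separated if $\bigcap_{n\ge 1}J^nM=0$. If $R$ is noetherian, $M$ is $J$-adically ideal(wise) separated if $M\otimes_R I$ is $J$-adically separated for every ideal $I$ of $R$. All rings are commutative with identity. *)

theory Defs
  imports "HOL-Algebra.Algebra" "HOL-Algebra.Algebraic_Closure_Type"
begin

section \<open>Rings\<close>

definition local_ring :: "('a, 'r) ring_scheme \<Rightarrow> 'a set \<Rightarrow> bool" where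
  "local_ring R m \<longleftrightarrow> cring R \<and> maximalideal m R \<and> (\<forall>n. maximalideal n R \<longrightarrow> n = m)"

definition contains_rationals :: "('a, 'r) ring_scheme \<Rightarrow> bool" where
  "contains_rationals R \<longleftrightarrow>
     (\<exists>h \<in> ring_hom (ring_of_type_algebra :: rat ring) R. inj h)"


section \<open>Modules\<close>

text \<open>The record of modules extends the one of rings; a module uses only \<^const>\<open>carrier\<close>,
  \<^const>\<open>ring.zero\<close>, \<^const>\<open>add\<close> and \<^const>\<open>module.smult\<close>, and the fields \<^const>\<open>monoid.mult\<close> and
  \<^const>\<open>one\<close> play no role.\<close>

definition module_span :: "('a, 'r) ring_scheme \<Rightarrow> ('a, 'b, 'm) module_scheme \<Rightarrow> 'b set \<Rightarrow> 'b set" where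
  "module_span R M S = \<Inter> {N. submodule N R M \<and> S \<subseteq> N}"

definition finite_module :: "('a, 'r) ring_scheme \<Rightarrow> ('a, 'b, 'm) module_scheme \<Rightarrow> bool" where
  "finite_module R M \<longleftrightarrow>
     (\<exists>S. finite S \<and> S \<subseteq> carrier M \<and> module_span R M S = carrier M)"

definition ideal_smult :: "('a, 'r) ring_scheme \<Rightarrow> 'a set \<Rightarrow> ('a, 'b, 'm) module_scheme \<Rightarrow> 'b set" where
  "ideal_smult R J M = module_span R M {a \<odot>\<^bsub>M\<^esub> x | a x. a \<in> J \<and> x \<in> carrier M}"

definition ideal_module :: "('a, 'r) ring_scheme \<Rightarrow> 'a set \<Rightarrow> ('a, 'a) module" where
  "ideal_module R I =
     \<lparr>carrier = I, monoid.mult = monoid.mult R, one = one R, ring.zero = \<zero>\<^bsub>R\<^esub>, add = add R,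
      module.smult = monoid.mult R\<rparr>"

text \<open>The tensor product is the free abelian group on the pairs \<open>(x, y)\<close> modulo the subgroup
  generated by the relations below, with the scalar action induced by
  \<open>a (x, y) = (a x, y)\<close>. Its elements are cosets, and its zero is the subgroup of relations.\<close>

definition tensor_relations ::
  "('a, 'r) ring_scheme \<Rightarrow> ('a, 'b, 'm) module_scheme \<Rightarrow> ('a, 'c, 'n) module_scheme
     \<Rightarrow> ('b \<times> 'c \<Rightarrow>\<^sub>0 int) set" where
  "tensor_relations R M N =
     {frag_of (x \<oplus>\<^bsub>M\<^esub> x', y) - frag_of (x, y) - frag_of (x', y) | x x' y.
        x \<in> carrier M \<and> x' \<in> carrier M \<and> y \<in> carrier N} \<union>
     {frag_of (x, y \<oplus>\<^bsub>N\<^esub> y') - frag_of (x, y) - frag_of (x, y') | x y y'.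
        x \<in> carrier M \<and> y \<in> carrier N \<and> y' \<in> carrier N} \<union>
     {frag_of (a \<odot>\<^bsub>M\<^esub> x, y) - frag_of (x, a \<odot>\<^bsub>N\<^esub> y) | a x y.
        a \<in> carrier R \<and> x \<in> carrier M \<and> y \<in> carrier N}"

definition tensor_product ::
  "('a, 'r) ring_scheme \<Rightarrow> ('a, 'b, 'm) module_scheme \<Rightarrow> ('a, 'c, 'n) module_scheme
     \<Rightarrow> ('a, ('b \<times> 'c \<Rightarrow>\<^sub>0 int) set) module" where
  "tensor_product R M N =
     (let F = free_Abelian_group (carrier M \<times> carrier N);
          K = generate F (tensor_relations R M N)
      in \<lparr>carrier = rcosets\<^bsub>F\<^esub> K, monoid.mult = undefined, one = undefined,
          ring.zero = K, add = set_mult F,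
          module.smult = (\<lambda>a C. \<Union>c\<in>C. K #>\<^bsub>F\<^esub> frag_extend (\<lambda>(x, y). frag_of (a \<odot>\<^bsub>M\<^esub> x, y)) c)\<rparr>)"


section \<open>Adic separation\<close>

text \<open>Powers of an ideal are taken in the multiplicative monoid of ideals, whose unit is the
  whole ring.\<close>

definition adically_separated ::
  "('a, 'r) ring_scheme \<Rightarrow> 'a set \<Rightarrow> ('a, 'b, 'm) module_scheme \<Rightarrow> bool" where
  "adically_separated R J M \<longleftrightarrow>
     (\<Inter>n\<in>{1::nat..}. ideal_smult R (J [^]\<^bsub>ideals_set R\<^esub> n) M) = {\<zero>\<^bsub>M\<^esub>}"

definition adically_ideal_separated ::
  "('a, 'r) ring_scheme \<Rightarrow> 'a set \<Rightarrow> ('a, 'b, 'm) module_scheme \<Rightarrow> bool" where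
  "adically_ideal_separated R J M \<longleftrightarrow>
     (\<forall>I. ideal I R \<longrightarrow> adically_separated R J (tensor_product R M (ideal_module R I)))"


section \<open>Integral closure\<close>

definition integral_closure :: "('b, 'l) ring_scheme \<Rightarrow> 'b set \<Rightarrow> 'b set" where
  "integral_closure L S =
     {x \<in> carrier L. \<exists>p \<in> carrier (S[X]\<^bsub>L\<^esub>). p \<noteq> [] \<and> Polynomials.lead_coeff p = \<one>\<^bsub>L\<^esub>
        \<and> ring.eval L p x = \<zero>\<^bsub>L\<^esub>}"

definition integral_closure_module ::
  "('a, 'r) ring_scheme \<Rightarrow> ('b, 'l) ring_scheme \<Rightarrow> ('a \<Rightarrow> 'b) \<Rightarrow> ('a, 'b) module" where
  "integral_closure_module R L \<phi> =
     \<lparr>carrier = integral_closure L (\<phi> ` carrier R), monoid.mult = monoid.mult L, one = one L,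
      ring.zero = \<zero>\<^bsub>L\<^esub>, add = add L, module.smult = (\<lambda>a x. \<phi> a \<otimes>\<^bsub>L\<^esub> x)\<rparr>"

text \<open>For a domain \<open>R\<close> embedded by \<open>\<phi>\<close> into a field \<open>L\<close>, the subfield of \<open>L\<close> generated by the
  image of \<open>R\<close> is the fraction field of \<open>R\<close>.\<close>

definition fraction_subfield ::
  "('a, 'r) ring_scheme \<Rightarrow> ('b, 'l) ring_scheme \<Rightarrow> ('a \<Rightarrow> 'b) \<Rightarrow> 'b set" where
  "fraction_subfield R L \<phi> = generate_field L (\<phi> ` carrier R)"

definition algebraic_closure_of_fractions ::
  "('a, 'r) ring_scheme \<Rightarrow> ('b, 'l) ring_scheme \<Rightarrow> ('a \<Rightarrow> 'b) \<Rightarrow> bool" where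
  "algebraic_closure_of_fractions R L \<phi> \<longleftrightarrow>
     \<phi> \<in> ring_hom R L \<and> inj_on \<phi> (carrier R) \<and> algebraic_closure L (fraction_subfield R L \<phi>)"


section \<open>Nagata rings\<close>

text \<open>A domain \<open>A\<close> is N-2 if its integral closure in every finite extension \<open>L\<close> of its fraction
  field is a finite \<open>A\<close>-module. Letting \<open>L\<close> range over the fields whose elements have the same
  type as those of \<open>A\<close> is no restriction: if \<open>A\<close> is infinite, then \<open>L\<close> has the cardinality of
  \<open>A\<close>, so it has an isomorphic copy on a subset of that type; if \<open>A\<close> is finite, then it is a
  field and every \<open>L\<close> satisfies the condition.\<close>

definition N2_domain :: "('a, 'r) ring_scheme \<Rightarrow> bool" where
  "N2_domain A \<longleftrightarrow> domain A \<and>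
     (\<forall>(L :: 'a ring) \<phi>. field L \<and> \<phi> \<in> ring_hom A L \<and> inj_on \<phi> (carrier A) \<and>
        ring.finite_dimension L (fraction_subfield A L \<phi>) (carrier L) \<longrightarrow>
        finite_module A (integral_closure_module A L \<phi>))"

definition nagata_ring :: "('a, 'r) ring_scheme \<Rightarrow> bool" where
  "nagata_ring R \<longleftrightarrow> cring R \<and> noetherian_ring R \<and>
     (\<forall>P. primeideal P R \<longrightarrow> N2_domain (R Quot P))"

end

theory Submission
  imports Defs
begin

text \<open>
  Let \<open>T\<close> be the absolute integral closure of \<open>R\<close> and \<open>I\<close> an ideal. An element \<open>z\<close> of
  \<open>T \<otimes> I\<close> involves finitely many elements of \<open>T\<close>, which lie in a finite extension \<open>E\<close> of the
  fraction field, so \<open>z\<close> comes from \<open>S \<otimes> I\<close> for \<open>S = T \<inter> E\<close>, the integral closure of \<open>R\<close> in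
  \<open>E\<close>. As \<open>R\<close> is Nagata, \<open>S\<close> is a finite module (\<open>N2_integral_closure_finite\<close>), hence so is
  \<open>S \<otimes> I\<close>, and Krull's intersection theorem (\<open>krull_intersection\<close>) says that \<open>S \<otimes> I\<close> is
  separated.

  To pass from \<open>S\<close> to \<open>T\<close>, use an \<open>R\<close>-linear retraction \<open>\<rho>\<close> of \<open>T\<close> onto \<open>S\<close>. It induces a map
  from \<open>T \<otimes> I\<close> to \<open>S \<otimes> I\<close> which carries \<open>m\<^sup>n(T \<otimes> I)\<close> into \<open>m\<^sup>n(S \<otimes> I)\<close> and sends \<open>z\<close> back to
  the element of \<open>S \<otimes> I\<close> that it came from. If \<open>z\<close> lies in all \<open>m\<^sup>n(T \<otimes> I)\<close>, that element is
  zero, and so is \<open>z\<close> (\<open>adically_separated_of_retracts\<close>).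

  The retraction exists because \<open>R\<close> contains the rationals. For \<open>\<alpha>\<close> algebraic over a field \<open>F\<close>,
  let \<open>\<rho>\<close> send \<open>g(\<alpha>)\<close> to the mean of the \<open>g(b)\<close> over the roots \<open>b\<close> of the minimal polynomial
  of \<open>\<alpha>\<close>. This normalised trace from \<open>F(\<alpha>)\<close> to \<open>F\<close> is \<open>F\<close>-linear and the identity on \<open>F\<close>; it
  takes values in \<open>F\<close> because the power sums of the roots do (\<open>sum_eval_roots_mem\<close>); and it
  preserves integrality because \<open>g(b)\<close> satisfies every equation that \<open>g(\<alpha>)\<close> satisfies over \<open>R\<close>
  (\<open>simple_extension_retraction\<close>). Zorn's lemma continues these traces to the whole
  algebraic closure (\<open>exists_retraction\<close>).
\<close>

section \<open>Submodules and the ascending chain condition\<close>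

context module
begin

text \<open>
  Negation is multiplication by the scalar \<open>-1\<close>.
\<close>

lemma submodule_criterion:
  assumes "H \<subseteq> carrier M" "\<zero>\<^bsub>M\<^esub> \<in> H"
    and "\<And>a b. a \<in> H \<Longrightarrow> b \<in> H \<Longrightarrow> a \<oplus>\<^bsub>M\<^esub> b \<in> H"
    and sm: "\<And>a x. a \<in> carrier R \<Longrightarrow> x \<in> H \<Longrightarrow> a \<odot>\<^bsub>M\<^esub> x \<in> H"
  shows "submodule H R M"
proof (rule submoduleI)
  show "\<ominus>\<^bsub>M\<^esub> a \<in> H" if "a \<in> H" for a
    using sm[of "\<ominus> \<one>" a] that assms(1) by (auto simp: smult_l_minus subset_iff)
qed (use assms in auto)

lemma submodule_Inter:
  assumes "\<And>N. N \<in> \<N> \<Longrightarrow> submodule N R M" "\<N> \<noteq> {}"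
  shows "submodule (\<Inter>\<N>) R M"
proof (rule submodule_criterion)
  show "\<Inter>\<N> \<subseteq> carrier M" using assms submoduleE(1) by blast
  show "\<zero>\<^bsub>M\<^esub> \<in> \<Inter>\<N>"
    using assms(1) subgroup.one_closed[OF submodule.axioms(1)] by fastforce
  show "a \<oplus>\<^bsub>M\<^esub> b \<in> \<Inter>\<N>" if "a \<in> \<Inter>\<N>" "b \<in> \<Inter>\<N>" for a b
    using that submoduleE(5)[OF assms(1)] by blast
  show "a \<odot>\<^bsub>M\<^esub> b \<in> \<Inter>\<N>" if "a \<in> carrier R" "b \<in> \<Inter>\<N>" for a b
    using that submoduleE(4)[OF assms(1)] by blast
qed

lemma submodule_zero: "submodule N R M \<Longrightarrow> \<zero>\<^bsub>M\<^esub> \<in> N"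
  using subgroup.one_closed[OF submodule.axioms(1)] by fastforce

lemma submodule_minus:
  assumes "submodule N R M" "a \<in> N" "b \<in> N"
  shows "a \<ominus>\<^bsub>M\<^esub> b \<in> N"
  using submoduleE(5)[OF assms(1) assms(2) submoduleE(3)[OF assms(1) assms(3)]]
  by (simp add: a_minus_def)

lemma submodule_span:
  assumes "S \<subseteq> carrier M"
  shows "submodule (module_span R M S) R M"
  unfolding module_span_def
  by (rule submodule_Inter) (use assms carrier_is_submodule in auto)

lemma span_superset: "S \<subseteq> module_span R M S"
  unfolding module_span_def by blast

lemma span_least: "submodule N R M \<Longrightarrow> S \<subseteq> N \<Longrightarrow> module_span R M S \<subseteq> N"
  unfolding module_span_def by blast

lemma span_in_carrier: "S \<subseteq> carrier M \<Longrightarrow> module_span R M S \<subseteq> carrier M"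
  by (simp add: carrier_is_submodule span_least)

lemma submodule_single_zero: "submodule {\<zero>\<^bsub>M\<^esub>} R M"
  by (rule submodule_criterion) (auto simp: smult_r_null)

lemma submodule_sum:
  assumes A: "submodule A R M" and B: "submodule B R M"
  shows "submodule {a \<oplus>\<^bsub>M\<^esub> b | a b. a \<in> A \<and> b \<in> B} R M" (is "submodule ?S R M")
proof (rule submodule_criterion)
  note A' = submoduleE[OF A] and B' = submoduleE[OF B]
  have c: "\<And>x. x \<in> A \<Longrightarrow> x \<in> carrier M" "\<And>x. x \<in> B \<Longrightarrow> x \<in> carrier M"
    using A'(1) B'(1) by auto
  show "?S \<subseteq> carrier M" using c by auto
  show "\<zero>\<^bsub>M\<^esub> \<in> ?S"
    using submodule_zero[OF A] submodule_zero[OF B] M.l_zero[OF M.zero_closed, symmetric]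
    by blast
  show "x \<oplus>\<^bsub>M\<^esub> y \<in> ?S"
    if xy: "x \<in> ?S" "y \<in> ?S" for x y
  proof -
    from xy obtain a b a' b' where ab: "x = a \<oplus>\<^bsub>M\<^esub> b" "a \<in> A" "b \<in> B"
       "y = a' \<oplus>\<^bsub>M\<^esub> b'" "a' \<in> A" "b' \<in> B" by blast
    then have "x \<oplus>\<^bsub>M\<^esub> y = (a \<oplus>\<^bsub>M\<^esub> a') \<oplus>\<^bsub>M\<^esub> (b \<oplus>\<^bsub>M\<^esub> b')"
      using c by (simp add: M.a_ac)
    with ab A'(5) B'(5) show ?thesis by blast
  qed
  show "r \<odot>\<^bsub>M\<^esub> x \<in> ?S"
    if r: "r \<in> carrier R" and x: "x \<in> ?S" for r x
  proof -
    from x obtain a b where ab: "x = a \<oplus>\<^bsub>M\<^esub> b" "a \<in> A" "b \<in> B" by blast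
    then have "r \<odot>\<^bsub>M\<^esub> x = r \<odot>\<^bsub>M\<^esub> a \<oplus>\<^bsub>M\<^esub> r \<odot>\<^bsub>M\<^esub> b" using c r by (simp add: smult_r_distr)
    with ab r A'(4) B'(4) show ?thesis by blast
  qed
qed

lemma submodule_ideal_multiples:
  assumes u: "u \<in> carrier M" and J: "ideal J R"
  shows "submodule {a \<odot>\<^bsub>M\<^esub> u | a. a \<in> J} R M" (is "submodule ?S R M")
proof -
  interpret J: ideal J R by fact
  show ?thesis
  proof (rule submodule_criterion)
    show "?S \<subseteq> carrier M" using u by auto
    show "\<zero>\<^bsub>M\<^esub> \<in> ?S"
      using J.zero_closed u by (force intro!: exI[of _ \<zero>] simp: smult_l_null)
    show "x \<oplus>\<^bsub>M\<^esub> y \<in> ?S"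
      if xy: "x \<in> ?S" "y \<in> ?S" for x y
    proof -
      from xy obtain a b where ab: "x = a \<odot>\<^bsub>M\<^esub> u" "a \<in> J" "y = b \<odot>\<^bsub>M\<^esub> u" "b \<in> J" by blast
      then have "x \<oplus>\<^bsub>M\<^esub> y = (a \<oplus> b) \<odot>\<^bsub>M\<^esub> u" using u by (simp add: smult_l_distr)
      with ab show ?thesis by (blast intro: J.a_closed)
    qed
    show "r \<odot>\<^bsub>M\<^esub> x \<in> ?S"
      if r: "r \<in> carrier R" and x: "x \<in> ?S" for r x
    proof -
      from x obtain a where a: "x = a \<odot>\<^bsub>M\<^esub> u" "a \<in> J" by blast
      then have "r \<odot>\<^bsub>M\<^esub> x = (r \<otimes> a) \<odot>\<^bsub>M\<^esub> u" using u r by (simp add: smult_assoc1)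
      with a r show ?thesis by (blast intro: J.I_l_closed)
    qed
  qed
qed

lemma span_insert_subset:
  assumes u: "u \<in> carrier M" and S: "S \<subseteq> carrier M"
  shows "module_span R M (insert u S)
    \<subseteq> {a \<odot>\<^bsub>M\<^esub> u \<oplus>\<^bsub>M\<^esub> y | a y. a \<in> carrier R \<and> y \<in> module_span R M S}"
proof -
  let ?A = "{a \<odot>\<^bsub>M\<^esub> u | a. a \<in> carrier R}" and ?B = "module_span R M S"
  have A: "submodule ?A R M" using submodule_ideal_multiples[OF u oneideal] .
  have B: "submodule ?B R M" using submodule_span[OF S] .
  have eq: "{a \<odot>\<^bsub>M\<^esub> u \<oplus>\<^bsub>M\<^esub> y | a y. a \<in> carrier R \<and> y \<in> module_span R M S} =
     {a \<oplus>\<^bsub>M\<^esub> b | a b. a \<in> ?A \<and> b \<in> ?B}" by blast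
  have uA: "u \<in> ?A" using u smult_one[OF u] by (force intro!: exI[of _ \<one>])
  have "insert u S \<subseteq> {a \<oplus>\<^bsub>M\<^esub> b | a b. a \<in> ?A \<and> b \<in> ?B}"
  proof
    fix x assume "x \<in> insert u S"
    then consider "x = u" | "x \<in> S" by blast
    then show "x \<in> {a \<oplus>\<^bsub>M\<^esub> b | a b. a \<in> ?A \<and> b \<in> ?B}"
    proof cases
      case 1
      then have "x = u \<oplus>\<^bsub>M\<^esub> \<zero>\<^bsub>M\<^esub>" using u by simp
      then show ?thesis using uA submodule_zero[OF B] by blast
    next
      case 2
      then have "x = \<zero>\<^bsub>M\<^esub> \<oplus>\<^bsub>M\<^esub> x" using S by auto
      then show ?thesis using 2 span_superset submodule_zero[OF A] by blast
    qed
  qed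
  then show ?thesis unfolding eq using span_least[OF submodule_sum[OF A B]] by blast
qed

text \<open>
  With \<open>span_insert_subset\<close>, these ideals of coefficients of \<open>u\<close> reduce a chain condition for
  the submodules of \<open>R u + P\<close> to one for ideals of \<open>R\<close> and one for submodules of \<open>P\<close>.
\<close>

lemma colon_ideal:
  assumes N: "submodule N R M" and P: "submodule P R M" and u: "u \<in> carrier M"
  shows "ideal {a \<in> carrier R. \<exists>y\<in>P. a \<odot>\<^bsub>M\<^esub> u \<oplus>\<^bsub>M\<^esub> y \<in> N} R" (is "ideal ?I R")
proof -
  note N' = submoduleE[OF N] and P' = submoduleE[OF P]
  have c: "\<And>x. x \<in> P \<Longrightarrow> x \<in> carrier M" using P' by auto
  show ?thesis
  proof (rule idealI[OF R.ring_axioms])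
    show "subgroup ?I (add_monoid R)"
    proof (rule R.add.subgroupI)
      show "?I \<noteq> {}" using submodule_zero[OF N] submodule_zero[OF P] u
        by (auto intro!: exI[of _ \<zero>] bexI[of _ "\<zero>\<^bsub>M\<^esub>"] simp: smult_l_null)
      fix a assume "a \<in> ?I"
      then obtain y where a: "a \<in> carrier R" "y \<in> P" "a \<odot>\<^bsub>M\<^esub> u \<oplus>\<^bsub>M\<^esub> y \<in> N" by blast
      have "(\<ominus> a) \<odot>\<^bsub>M\<^esub> u \<oplus>\<^bsub>M\<^esub> (\<ominus>\<^bsub>M\<^esub> y) = \<ominus>\<^bsub>M\<^esub> (a \<odot>\<^bsub>M\<^esub> u \<oplus>\<^bsub>M\<^esub> y)"
        using a u c by (simp add: smult_l_minus M.minus_add)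
      then show "\<ominus> a \<in> ?I" using a N'(3) P'(3)
        by (auto intro!: bexI[of _ "\<ominus>\<^bsub>M\<^esub> y"])
      fix b assume "b \<in> ?I"
      then obtain z where b: "b \<in> carrier R" "z \<in> P" "b \<odot>\<^bsub>M\<^esub> u \<oplus>\<^bsub>M\<^esub> z \<in> N" by blast
      have "(a \<oplus> b) \<odot>\<^bsub>M\<^esub> u \<oplus>\<^bsub>M\<^esub> (y \<oplus>\<^bsub>M\<^esub> z) = (a \<odot>\<^bsub>M\<^esub> u \<oplus>\<^bsub>M\<^esub> y) \<oplus>\<^bsub>M\<^esub> (b \<odot>\<^bsub>M\<^esub> u \<oplus>\<^bsub>M\<^esub> z)"
        using a b u c by (simp add: smult_l_distr M.a_ac)
      then show "a \<oplus> b \<in> ?I" using a b N'(5) P'(5)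
        by (auto intro!: bexI[of _ "y \<oplus>\<^bsub>M\<^esub> z"])
    qed auto
    have *: "r \<otimes> a \<in> ?I" if ra: "a \<in> ?I" "r \<in> carrier R" for a r
    proof -
      obtain y where a: "a \<in> carrier R" "y \<in> P" "a \<odot>\<^bsub>M\<^esub> u \<oplus>\<^bsub>M\<^esub> y \<in> N" using ra(1) by blast
      have "(r \<otimes> a) \<odot>\<^bsub>M\<^esub> u \<oplus>\<^bsub>M\<^esub> r \<odot>\<^bsub>M\<^esub> y = r \<odot>\<^bsub>M\<^esub> (a \<odot>\<^bsub>M\<^esub> u \<oplus>\<^bsub>M\<^esub> y)"
        using a u c that by (simp add: smult_assoc1 smult_r_distr)
      then show ?thesis using a that N'(4) P'(4)
        by (auto intro!: bexI[of _ "r \<odot>\<^bsub>M\<^esub> y"])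
    qed
    show "x \<otimes> a \<in> ?I" if "a \<in> ?I" "x \<in> carrier R" for a x
      using *[OF that] .
    show "a \<otimes> x \<in> ?I" if "a \<in> ?I" "x \<in> carrier R" for a x
      using *[OF that] that R.m_comm[of a x] by simp
  qed
qed

lemma submodule_inter:
  assumes "submodule A R M" "submodule B R M" shows "submodule (A \<inter> B) R M"
  using submodule_Inter[of "{A, B}"] assms by auto

end

lemma (in noetherian_ring) ideal_sequence_stabilises:
  assumes I: "\<And>n::nat. ideal (I n) R" and inc: "\<And>n. I n \<subseteq> I (Suc n)"
  shows "\<exists>n. \<forall>k\<ge>n. I k = I n"
proof -
  have mono: "I i \<subseteq> I j" if "i \<le> j" for i j
    using lift_Suc_mono_le[of I, OF inc that] .
  have "subset.chain {I. ideal I R} (range I)"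
    unfolding subset_chain_def using I mono by (auto, meson nat_le_linear subsetD)
  then have "\<Union>(range I) \<in> range I" using ideal_chain_is_trivial by blast
  then obtain n where "\<Union>(range I) = I n" by blast
  then show ?thesis using mono by blast
qed

text \<open>
  Induction on the number of generators. If \<open>N \<subseteq> N'\<close> are submodules of \<open>R u + P\<close> with the same
  intersection with \<open>P\<close> and the same ideal of coefficients of \<open>u\<close> modulo \<open>P\<close>, then \<open>N = N'\<close>:
  subtract from an element of \<open>N'\<close> an element of \<open>N\<close> with the same coefficient.
\<close>

lemma (in module) submodule_sequence_stabilises:
  assumes noeth: "noetherian_ring R" and S: "finite S" "S \<subseteq> carrier M"
    and N: "\<And>n::nat. submodule (N n) R M" "\<And>n. N n \<subseteq> N (Suc n)"
      "\<And>n. N n \<subseteq> module_span R M S"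
  shows "\<exists>n. \<forall>k\<ge>n. N k = N n"
  using S N
proof (induction S arbitrary: N)
  case empty
  have "N n = {\<zero>\<^bsub>M\<^esub>}" for n
    using empty(4)[of n] span_least[OF submodule_single_zero, of "{}"]
      submodule_zero[OF empty(2)[of n]] by blast
  then show ?case by simp
next
  case (insert u S)
  interpret noetherian_ring R by fact
  let ?P = "module_span R M S"
  have u: "u \<in> carrier M" and S: "S \<subseteq> carrier M" using insert by auto
  have P: "submodule ?P R M" using submodule_span[OF S] .
  note Psub = submoduleE[OF P]
  define I where "I n = {a \<in> carrier R. \<exists>y\<in>?P. a \<odot>\<^bsub>M\<^esub> u \<oplus>\<^bsub>M\<^esub> y \<in> N n}" for n
  have mono: "N i \<subseteq> N j" if "i \<le> j" for i j
    using lift_Suc_mono_le[of N, OF insert.prems(3) that] .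
  have "ideal (I n) R" for n
    unfolding I_def by (rule colon_ideal[OF insert.prems(2) P u])
  moreover have "I n \<subseteq> I (Suc n)" for n using insert.prems(3) unfolding I_def by blast
  ultimately obtain n1 where n1: "\<And>k. k \<ge> n1 \<Longrightarrow> I k = I n1"
    using ideal_sequence_stabilises[of I] by blast
  have "\<exists>n. \<forall>k\<ge>n. N k \<inter> ?P = N n \<inter> ?P"
    by (rule insert.IH) (use S insert.prems submodule_inter[OF _ P] in auto)
  then obtain n2 where n2: "\<And>k. k \<ge> n2 \<Longrightarrow> N k \<inter> ?P = N n2 \<inter> ?P" by blast
  let ?n = "max n1 n2"
  have "N k \<subseteq> N ?n" if k: "k \<ge> ?n" for k
  proof
    fix x assume x: "x \<in> N k"
    then obtain a y where ay: "a \<in> carrier R" "y \<in> ?P" "x = a \<odot>\<^bsub>M\<^esub> u \<oplus>\<^bsub>M\<^esub> y"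
      using span_insert_subset[OF u S] insert.prems(4) by blast
    with x have "a \<in> I k" unfolding I_def by blast
    then have "a \<in> I ?n" using n1[of k] n1[of ?n] k by simp
    then obtain z where z: "z \<in> ?P" "a \<odot>\<^bsub>M\<^esub> u \<oplus>\<^bsub>M\<^esub> z \<in> N ?n" unfolding I_def by blast
    let ?w = "a \<odot>\<^bsub>M\<^esub> u \<oplus>\<^bsub>M\<^esub> z"
    have w: "?w \<in> N k" using mono[OF k] z by blast
    have yz: "y \<in> carrier M" "z \<in> carrier M" using ay z Psub(1) by auto
    have "x \<ominus>\<^bsub>M\<^esub> ?w = y \<ominus>\<^bsub>M\<^esub> z"
    proof -
      have au: "a \<odot>\<^bsub>M\<^esub> u \<in> carrier M" using ay u by simp
      have "x \<ominus>\<^bsub>M\<^esub> ?w = (a \<odot>\<^bsub>M\<^esub> u \<oplus>\<^bsub>M\<^esub> y) \<oplus>\<^bsub>M\<^esub> (\<ominus>\<^bsub>M\<^esub> (a \<odot>\<^bsub>M\<^esub> u) \<oplus>\<^bsub>M\<^esub> \<ominus>\<^bsub>M\<^esub> z)"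
        using au yz ay(3) by (simp add: a_minus_def M.minus_add)
      also have "\<dots> = (a \<odot>\<^bsub>M\<^esub> u \<oplus>\<^bsub>M\<^esub> \<ominus>\<^bsub>M\<^esub> (a \<odot>\<^bsub>M\<^esub> u)) \<oplus>\<^bsub>M\<^esub> (y \<oplus>\<^bsub>M\<^esub> \<ominus>\<^bsub>M\<^esub> z)"
        using au yz by (simp only: M.a_ac M.a_closed M.a_inv_closed)
      also have "\<dots> = y \<ominus>\<^bsub>M\<^esub> z"
        using au yz by (simp add: M.r_neg a_minus_def)
      finally show ?thesis .
    qed
    then have "y \<ominus>\<^bsub>M\<^esub> z \<in> N k \<inter> ?P"
      using submodule_minus[OF insert.prems(2) x w] submodule_minus[OF P ay(2) z(1)] by simp
    then have "y \<ominus>\<^bsub>M\<^esub> z \<in> N ?n" using n2[of k] n2[of ?n] k by auto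
    then have "?w \<oplus>\<^bsub>M\<^esub> (y \<ominus>\<^bsub>M\<^esub> z) \<in> N ?n"
      using submoduleE(5)[OF insert.prems(2)] z by blast
    moreover have "?w \<oplus>\<^bsub>M\<^esub> (y \<ominus>\<^bsub>M\<^esub> z) = x"
    proof -
      have au: "a \<odot>\<^bsub>M\<^esub> u \<in> carrier M" using ay u by simp
      have "?w \<oplus>\<^bsub>M\<^esub> (y \<ominus>\<^bsub>M\<^esub> z) = (a \<odot>\<^bsub>M\<^esub> u \<oplus>\<^bsub>M\<^esub> y) \<oplus>\<^bsub>M\<^esub> (z \<oplus>\<^bsub>M\<^esub> \<ominus>\<^bsub>M\<^esub> z)"
        using au yz unfolding a_minus_def by (simp only: M.a_ac M.a_closed M.a_inv_closed)
      then show ?thesis using ay au yz by (simp add: M.r_neg)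
    qed
    ultimately show "x \<in> N ?n" by simp
  qed
  then show ?case using mono by (meson subset_antisym)
qed

section \<open>Krull's intersection theorem\<close>

text \<open>
  The union of a chain of proper ideals belongs to the chain, by noetherianity, so Zorn's
  lemma applies.
\<close>

lemma (in noetherian_ring) exists_maximalideal:
  assumes J: "ideal J R" "J \<noteq> carrier R"
  shows "\<exists>n. maximalideal n R \<and> J \<subseteq> n"
proof -
  let ?A = "{I. ideal I R \<and> J \<subseteq> I \<and> I \<noteq> carrier R}"
  have "\<exists>N\<in>?A. \<forall>Z\<in>?A. N \<subseteq> Z \<longrightarrow> Z = N"
  proof (rule subset_Zorn_nonempty)
    show "?A \<noteq> {}" using J by blast
    fix C assume C: "C \<noteq> {}" "subset.chain ?A C"
    then have "subset.chain {I. ideal I R} C" unfolding subset_chain_def by blast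
    then have "\<Union>C \<in> C" using ideal_chain_is_trivial C(1) by blast
    then show "\<Union>C \<in> ?A" using C(2) unfolding subset_chain_def by blast
  qed
  then obtain N where NA: "N \<in> ?A" and max: "\<forall>Z\<in>?A. N \<subseteq> Z \<longrightarrow> Z = N" ..
  then have N: "ideal N R" "J \<subseteq> N" "N \<noteq> carrier R" by auto
  have "maximalideal N R"
  proof (rule maximalidealI[OF N(1)])
    show "carrier R \<noteq> N" using N(3) by blast
    fix Z assume Z: "ideal Z R" "N \<subseteq> Z" "Z \<subseteq> carrier R"
    show "Z = N \<or> Z = carrier R" using bspec[OF max, of Z] Z N(2) by blast
  qed
  then show ?thesis using N(2) by blast
qed

text \<open>
  Otherwise \<open>1 - a\<close> lies in a maximal ideal, which is \<open>m\<close>, and then \<open>1 \<in> m\<close>.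
\<close>

lemma local_ring_one_minus_Units:
  fixes R (structure)
  assumes noeth: "noetherian_ring R" and loc: "local_ring R m" and a: "a \<in> m"
  shows "\<one> \<ominus> a \<in> Units R"
proof (rule ccontr)
  interpret noetherian_ring R by fact
  interpret cring R using loc unfolding local_ring_def by blast
  interpret m: maximalideal m R using loc unfolding local_ring_def by blast
  assume nu: "\<one> \<ominus> a \<notin> Units R"
  have ac: "a \<in> carrier R" using a m.a_subset by blast
  have u: "\<one> \<ominus> a \<in> carrier R" using ac by simp
  have "PIdl (\<one> \<ominus> a) \<noteq> carrier R" using ideal_eq_carrier_iff[OF u] nu by blast
  then obtain n where n: "maximalideal n R" "PIdl (\<one> \<ominus> a) \<subseteq> n"
    using exists_maximalideal[OF cgenideal_ideal[OF u]] by blast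
  have "n = m" using loc n(1) unfolding local_ring_def by blast
  then have "\<one> \<ominus> a \<in> m" using n(2) cgenideal_self[OF u] by blast
  then have "(\<one> \<ominus> a) \<oplus> a \<in> m" using a by (rule m.a_closed)
  moreover have "(\<one> \<ominus> a) \<oplus> a = \<one>" using ac by (simp add: a_minus_def a_assoc l_neg)
  ultimately have "m = carrier R" using m.one_imp_carrier by simp
  then show False using m.I_notcarr by simp
qed

context cring
begin

lemma ideals_set_pow_Suc: "I [^]\<^bsub>ideals_set R\<^esub> Suc n = (I [^]\<^bsub>ideals_set R\<^esub> n) \<cdot> I"
proof -
  interpret ID: comm_monoid "ideals_set R" by (rule ideals_set_is_comm_monoid)
  show ?thesis by (simp add: ideals_set_def)
qed

lemma ideals_set_pow_0: "I [^]\<^bsub>ideals_set R\<^esub> (0::nat) = carrier R"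
proof -
  interpret ID: comm_monoid "ideals_set R" by (rule ideals_set_is_comm_monoid)
  show ?thesis by (simp add: ideals_set_def)
qed

lemma ideal_pow_ideal: "ideal I R \<Longrightarrow> ideal (I [^]\<^bsub>ideals_set R\<^esub> (n::nat)) R"
  by (induction n)
     (simp_all only: ideals_set_pow_0 ideals_set_pow_Suc oneideal ideal_prod_is_ideal)

lemma ideal_prod_subset:
  assumes A: "ideal A R" and "\<And>i j. i \<in> I \<Longrightarrow> j \<in> J \<Longrightarrow> i \<otimes> j \<in> A"
  shows "I \<cdot> J \<subseteq> A"
proof
  interpret A: ideal A R by fact
  fix x assume "x \<in> I \<cdot> J"
  then show "x \<in> A" by (induction rule: ideal_prod.induct) (auto simp: assms(2))
qed

lemma ideal_pow_mono:
  assumes "I \<subseteq> J" "ideal I R" "ideal J R"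
  shows "I [^]\<^bsub>ideals_set R\<^esub> (n::nat) \<subseteq> J [^]\<^bsub>ideals_set R\<^esub> n"
proof (induction n)
  case (Suc n)
  show ?case unfolding ideals_set_pow_Suc
    by (rule ideal_prod_subset)
       (use Suc assms in \<open>auto intro!: ideal_prod.prod ideal_prod_is_ideal ideal_pow_ideal\<close>)
qed (simp only: ideals_set_pow_0 subset_refl)

lemma ideal_colon:
  assumes A: "ideal A R" and J: "J \<subseteq> carrier R"
  shows "ideal {r \<in> carrier R. \<forall>j\<in>J. r \<otimes> j \<in> A} R"
proof -
  interpret A: ideal A R by fact
  show ?thesis
  proof (rule idealI[OF ring_axioms])
    show "subgroup {r \<in> carrier R. \<forall>j\<in>J. r \<otimes> j \<in> A} (add_monoid R)"
      by (rule add.subgroupI) (use J in \<open>auto intro!: exI[of _ \<zero>] simp: l_distr l_minus subset_iff\<close>)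
    fix a x assume a: "a \<in> {r \<in> carrier R. \<forall>j\<in>J. r \<otimes> j \<in> A}" "x \<in> carrier R"
    then show "x \<otimes> a \<in> {r \<in> carrier R. \<forall>j\<in>J. r \<otimes> j \<in> A}"
      using J by (simp add: m_assoc subset_iff A.I_l_closed)
    then show "a \<otimes> x \<in> {r \<in> carrier R. \<forall>j\<in>J. r \<otimes> j \<in> A}" using a m_comm[of a x] by simp
  qed
qed

text \<open>
  Expanding a product of \<open>p + q\<close> sums \<open>i + j\<close>, each term has at least \<open>p\<close> factors in \<open>I\<close> or at
  least \<open>q\<close> in \<open>J\<close>. The induction avoids the expansion: it splits off one factor and uses the
  statement for the colon ideals \<open>(A : I)\<close> and \<open>(A : J)\<close> in place of \<open>A\<close>.
\<close>

lemma ideal_pow_sum_subset: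
  assumes I: "ideal I R" and J: "ideal J R"
  shows "ideal A R \<Longrightarrow> I [^]\<^bsub>ideals_set R\<^esub> (p::nat) \<subseteq> A \<Longrightarrow> J [^]\<^bsub>ideals_set R\<^esub> (q::nat) \<subseteq> A
    \<Longrightarrow> (I <+>\<^bsub>R\<^esub> J) [^]\<^bsub>ideals_set R\<^esub> (p + q) \<subseteq> A"
proof (induction "p + q" arbitrary: p q A rule: less_induct)
  case less
  let ?S = "I <+>\<^bsub>R\<^esub> J"
  have S: "ideal ?S R" using add_ideals[OF I J] .
  have Ic: "I \<subseteq> carrier R" and Jc: "J \<subseteq> carrier R"
    using I J by (auto dest: ideal.Icarr)
  interpret A: ideal A R by (rule less.prems(1))
  show ?case
  proof (cases "p = 0 \<or> q = 0")
    case True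
    then have "carrier R \<subseteq> A" using less.prems(2,3) by (metis ideals_set_pow_0)
    then show ?thesis using ideal_pow_ideal[OF S, of "p + q"] by (auto dest: ideal.Icarr)
  next
    case False
    then obtain p' q' where p: "p = Suc p'" and q: "q = Suc q'" by (metis not0_implies_Suc)
    let ?B = "{r \<in> carrier R. \<forall>j\<in>I. r \<otimes> j \<in> A}" and ?C = "{r \<in> carrier R. \<forall>j\<in>J. r \<otimes> j \<in> A}"
    have pw: "I [^]\<^bsub>ideals_set R\<^esub> n \<subseteq> carrier R" "J [^]\<^bsub>ideals_set R\<^esub> n \<subseteq> carrier R" for n :: nat
      using ideal_pow_ideal I J by (auto dest: ideal.Icarr)
    have "I [^]\<^bsub>ideals_set R\<^esub> p' \<subseteq> ?B"
      using less.prems(2) pw(1)[of p'] unfolding p ideals_set_pow_Suc by (auto intro: ideal_prod.prod)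
    moreover have "J [^]\<^bsub>ideals_set R\<^esub> q \<subseteq> ?B"
      using less.prems(3) pw(2)[of q] Ic by (auto intro!: A.I_r_closed)
    ultimately have 1: "?S [^]\<^bsub>ideals_set R\<^esub> (p' + q) \<subseteq> ?B"
      using less.hyps[of p' q ?B] ideal_colon[OF less.prems(1) Ic] p by simp
    have "J [^]\<^bsub>ideals_set R\<^esub> q' \<subseteq> ?C"
      using less.prems(3) pw(2)[of q'] unfolding q ideals_set_pow_Suc by (auto intro: ideal_prod.prod)
    moreover have "I [^]\<^bsub>ideals_set R\<^esub> p \<subseteq> ?C"
      using less.prems(2) pw(1)[of p] Jc by (auto intro!: A.I_r_closed)
    ultimately have 2: "?S [^]\<^bsub>ideals_set R\<^esub> (p + q') \<subseteq> ?C"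
      using less.hyps[of p q' ?C] ideal_colon[OF less.prems(1) Jc] q by simp
    have "p + q = Suc (p' + q)" "p' + q = p + q'" using p q by auto
    then have "?S [^]\<^bsub>ideals_set R\<^esub> (p + q) = (?S [^]\<^bsub>ideals_set R\<^esub> (p' + q)) \<cdot> ?S"
      by (simp only: ideals_set_pow_Suc)
    also have "\<dots> \<subseteq> A"
    proof (rule ideal_prod_subset[OF less.prems(1)])
      fix x s assume x: "x \<in> ?S [^]\<^bsub>ideals_set R\<^esub> (p' + q)" and s: "s \<in> ?S"
      from s obtain i j where ij: "i \<in> I" "j \<in> J" "s = i \<oplus> j"
        unfolding set_add_def' by blast
      have xB: "x \<in> ?B" using 1 x by blast
      have xC: "x \<in> ?C" using 2 x unfolding \<open>p' + q = p + q'\<close> by blast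
      have "x \<otimes> s = x \<otimes> i \<oplus> x \<otimes> j" using ij xB Ic Jc by (simp add: r_distr subset_iff)
      then show "x \<otimes> s \<in> A" using xB xC ij by simp
    qed
    finally show ?thesis .
  qed
qed

lemma principal_ideal_pow_subset:
  assumes A: "ideal A R" and a: "a \<in> carrier R" and k: "a [^] (k::nat) \<in> A"
  shows "(PIdl a) [^]\<^bsub>ideals_set R\<^esub> k \<subseteq> A"
proof -
  interpret A: ideal A R by fact
  have "(PIdl a) [^]\<^bsub>ideals_set R\<^esub> n \<subseteq> PIdl (a [^] n)" for n :: nat
  proof (induction n)
    case 0
    show ?case unfolding ideals_set_pow_0
      using ideal_eq_carrier_iff[OF one_closed] by simp
  next
    case (Suc n)
    show ?case unfolding ideals_set_pow_Suc
    proof (rule ideal_prod_subset)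
      show "ideal (PIdl (a [^] Suc n)) R" using a cgenideal_ideal by simp
      fix i j assume ij: "i \<in> PIdl a [^]\<^bsub>ideals_set R\<^esub> n" "j \<in> PIdl a"
      from ij(1) Suc have "i \<in> PIdl (a [^] n)" by blast
      then obtain r where r: "r \<in> carrier R" "i = r \<otimes> a [^] n" unfolding cgenideal_def by blast
      from ij(2) obtain s where s: "s \<in> carrier R" "j = s \<otimes> a" unfolding cgenideal_def by blast
      have "i \<otimes> j = (r \<otimes> s) \<otimes> a [^] Suc n" using r s a by (simp add: m_ac)
      then show "i \<otimes> j \<in> PIdl (a [^] Suc n)" using r s unfolding cgenideal_def by blast
    qed
  qed
  moreover have "PIdl (a [^] k) \<subseteq> A"
    by (rule cgenideal_minimal[OF A k])
  ultimately show ?thesis by blast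
qed

text \<open>
  The exponents that work for the finitely many generators add up to one that works for the
  ideal, by \<open>ideal_pow_sum_subset\<close>.
\<close>

lemma fg_ideal_pow_subset:
  assumes A: "ideal A R"
  shows "finite F \<Longrightarrow> F \<subseteq> carrier R \<Longrightarrow> \<forall>a\<in>F. \<exists>k::nat. a [^] k \<in> A
    \<Longrightarrow> \<exists>n::nat. (Idl F) [^]\<^bsub>ideals_set R\<^esub> n \<subseteq> A"
proof (induction F rule: finite_induct)
  case empty
  interpret A: ideal A R by fact
  have "Idl {} \<subseteq> {\<zero>}" by (rule genideal_minimal[OF zeroideal]) simp
  then have 1: "Idl {} \<subseteq> A" using A.zero_closed by blast
  have "(Idl {}) [^]\<^bsub>ideals_set R\<^esub> Suc 0 \<subseteq> A"
    unfolding ideals_set_pow_Suc ideals_set_pow_0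
    by (rule ideal_prod_subset[OF A]) (use 1 in \<open>auto intro!: A.I_l_closed\<close>)
  then show ?case by blast
next
  case (insert a F)
  then obtain n k :: nat where n: "(Idl F) [^]\<^bsub>ideals_set R\<^esub> n \<subseteq> A" and k: "a [^] k \<in> A" by auto
  have a: "a \<in> carrier R" and F: "F \<subseteq> carrier R" using insert by auto
  have iF: "ideal (Idl F) R" and ia: "ideal (PIdl a) R"
    using genideal_ideal[OF F] cgenideal_ideal[OF a] by auto
  have iS: "ideal (PIdl a <+>\<^bsub>R\<^esub> Idl F) R" by (rule add_ideals[OF ia iF])
  have "Idl (insert a F) \<subseteq> PIdl a <+>\<^bsub>R\<^esub> Idl F"
  proof (rule genideal_minimal[OF iS])
    have "x \<in> PIdl a <+>\<^bsub>R\<^esub> Idl F" if "x \<in> PIdl a" for x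
    proof -
      have "x = x \<oplus> \<zero>" "\<zero> \<in> Idl F"
        using that ia iF by (auto dest: ideal.Icarr simp: additive_subgroup.zero_closed ideal.axioms(1))
      then show ?thesis using that unfolding set_add_def' by blast
    qed
    moreover have "x \<in> PIdl a <+>\<^bsub>R\<^esub> Idl F" if "x \<in> Idl F" for x
    proof -
      have "x = \<zero> \<oplus> x" "\<zero> \<in> PIdl a"
        using that ia iF by (auto dest: ideal.Icarr simp: additive_subgroup.zero_closed ideal.axioms(1))
      then show ?thesis using that unfolding set_add_def' by blast
    qed
    ultimately show "insert a F \<subseteq> PIdl a <+>\<^bsub>R\<^esub> Idl F"
      using cgenideal_self[OF a] genideal_self[OF F] by blast
  qed
  then have "(Idl (insert a F)) [^]\<^bsub>ideals_set R\<^esub> (k + n) \<subseteq> (PIdl a <+>\<^bsub>R\<^esub> Idl F) [^]\<^bsub>ideals_set R\<^esub> (k + n)"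
    by (rule ideal_pow_mono) (use insert genideal_ideal iS in auto)
  also have "\<dots> \<subseteq> A"
    by (rule ideal_pow_sum_subset[OF ia iF A principal_ideal_pow_subset[OF A a k] n])
  finally show ?case by blast
qed

end

context module
begin

lemma submodule_Union_chain:
  assumes "C \<noteq> {}" "\<And>N. N \<in> C \<Longrightarrow> submodule N R M"
    and ch: "\<And>Z Y. Z \<in> C \<Longrightarrow> Y \<in> C \<Longrightarrow> Z \<subseteq> Y \<or> Y \<subseteq> Z"
  shows "submodule (\<Union>C) R M"
proof (rule submodule_criterion)
  show "\<Union>C \<subseteq> carrier M" using assms(2) submoduleE(1) by blast
  show "\<zero>\<^bsub>M\<^esub> \<in> \<Union>C" using assms(1,2) submodule_zero by blast
  show "r \<odot>\<^bsub>M\<^esub> a \<in> \<Union>C" if "r \<in> carrier R" "a \<in> \<Union>C" for r a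
    using that submoduleE(4)[OF assms(2)] by blast
  show "a \<oplus>\<^bsub>M\<^esub> b \<in> \<Union>C" if ab: "a \<in> \<Union>C" "b \<in> \<Union>C" for a b
  proof -
    from ab obtain Z Y where XY: "Z \<in> C" "Y \<in> C" "a \<in> Z" "b \<in> Y" by blast
    then obtain W where "W \<in> C" "a \<in> W" "b \<in> W" using ch[OF XY(1,2)] by blast
    then show ?thesis using submoduleE(5)[OF assms(2)] by blast
  qed
qed

lemma submodule_vimage_smult:
  assumes a: "a \<in> carrier R" and Q: "submodule Q R M"
  shows "submodule {y \<in> carrier M. a \<odot>\<^bsub>M\<^esub> y \<in> Q} R M" (is "submodule ?S R M")
proof (rule submodule_criterion)
  note Q' = submoduleE[OF Q]
  show "\<zero>\<^bsub>M\<^esub> \<in> ?S" using a submodule_zero[OF Q] by (simp add: smult_r_null)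
  show "y \<oplus>\<^bsub>M\<^esub> z \<in> ?S"
    if "y \<in> ?S" "z \<in> ?S" for y z
    using that a Q'(5) by (simp add: smult_r_distr)
  show "r \<odot>\<^bsub>M\<^esub> y \<in> ?S"
    if r: "r \<in> carrier R" and y: "y \<in> ?S" for r y
  proof -
    have "a \<odot>\<^bsub>M\<^esub> (r \<odot>\<^bsub>M\<^esub> y) = r \<odot>\<^bsub>M\<^esub> (a \<odot>\<^bsub>M\<^esub> y)"
      using r y a smult_assoc1[of a r y] smult_assoc1[of r a y] R.m_comm[of a r] by auto
    then show ?thesis using r y Q'(4) by auto
  qed
qed auto

lemma submodule_image_smult:
  assumes a: "a \<in> carrier R"
  shows "submodule {a \<odot>\<^bsub>M\<^esub> y | y. y \<in> carrier M} R M" (is "submodule ?S R M")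
proof (rule submodule_criterion)
  show "?S \<subseteq> carrier M" using a by auto
  show "\<zero>\<^bsub>M\<^esub> \<in> ?S" using smult_r_null[OF a, symmetric] by blast
  show "x \<oplus>\<^bsub>M\<^esub> z \<in> ?S" if xz: "x \<in> ?S" "z \<in> ?S" for x z
  proof -
    from xz obtain y y' where y: "x = a \<odot>\<^bsub>M\<^esub> y" "z = a \<odot>\<^bsub>M\<^esub> y'" "y \<in> carrier M" "y' \<in> carrier M" by blast
    then have "x \<oplus>\<^bsub>M\<^esub> z = a \<odot>\<^bsub>M\<^esub> (y \<oplus>\<^bsub>M\<^esub> y')" using a by (simp add: smult_r_distr)
    then show ?thesis using y by blast
  qed
  show "r \<odot>\<^bsub>M\<^esub> x \<in> ?S" if r: "r \<in> carrier R" and x: "x \<in> ?S" for r x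
  proof -
    from x obtain y where y: "x = a \<odot>\<^bsub>M\<^esub> y" "y \<in> carrier M" by blast
    then have "r \<odot>\<^bsub>M\<^esub> x = a \<odot>\<^bsub>M\<^esub> (r \<odot>\<^bsub>M\<^esub> y)"
      using r a smult_assoc1[of a r y] smult_assoc1[of r a y] R.m_comm[of a r] by auto
    then show ?thesis using y r by blast
  qed
qed

lemma ann_quotient_ideal:
  assumes Q: "submodule Q R M"
  shows "ideal {a \<in> carrier R. \<forall>y\<in>carrier M. a \<odot>\<^bsub>M\<^esub> y \<in> Q} R" (is "ideal ?A R")
proof -
  note Q' = submoduleE[OF Q]
  show ?thesis
  proof (rule idealI[OF R.ring_axioms])
    show "subgroup ?A (add_monoid R)"
    proof (rule R.add.subgroupI)
      show "?A \<noteq> {}" using submodule_zero[OF Q] by (auto intro!: exI[of _ \<zero>] simp: smult_l_null)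
      show "\<ominus> a \<in> ?A" if "a \<in> ?A" for a using that Q'(3) by (auto simp: smult_l_minus)
      show "a \<oplus> b \<in> ?A" if "a \<in> ?A" "b \<in> ?A" for a b
        using that Q'(5) by (auto simp: smult_l_distr)
    qed auto
    show "x \<otimes> a \<in> ?A" if "a \<in> ?A" "x \<in> carrier R" for a x
      using that Q'(4) by (auto simp: smult_assoc1)
    then show "a \<otimes> x \<in> ?A" if "a \<in> ?A" "x \<in> carrier R" for a x
      using that R.m_comm[of a x] by auto
  qed
qed

text \<open>
  Let \<open>x\<close> lie in the intersection, and let \<open>Q\<close> be maximal among the submodules that meet \<open>R x\<close> in
  \<open>m x\<close>. For \<open>a \<in> m\<close> the submodules \<open>{y. a\<^sup>k y \<in> Q}\<close> stabilise from some \<open>k\<close> on, and then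
  \<open>Q + a\<^sup>k M\<close> still meets \<open>R x\<close> in \<open>m x\<close>; by maximality \<open>a\<^sup>k M \<subseteq> Q\<close>. As \<open>m\<close> is finitely
  generated, \<open>m\<^sup>n M \<subseteq> Q\<close> for some \<open>n\<close>, so \<open>x \<in> Q \<inter> R x = m x\<close>. Hence \<open>x = a x\<close> with \<open>a \<in> m\<close>,
  and \<open>x = 0\<close> because \<open>1 - a\<close> is a unit.
\<close>

theorem krull_intersection:
  assumes noeth: "noetherian_ring R" and loc: "local_ring R m" and fg: "finite_module R M"
  shows "(\<Inter>n\<in>{1::nat..}. ideal_smult R (m [^]\<^bsub>ideals_set R\<^esub> n) M) = {\<zero>\<^bsub>M\<^esub>}"
proof -
  interpret noetherian_ring R by fact
  interpret m: maximalideal m R using loc unfolding local_ring_def by blast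
  have mi: "ideal m R" by (rule m.is_ideal)
  from fg obtain S where S: "finite S" "S \<subseteq> carrier M" "module_span R M S = carrier M"
    unfolding finite_module_def by blast
  have gen_sub: "{a \<odot>\<^bsub>M\<^esub> x |a x. a \<in> J \<and> x \<in> carrier M} \<subseteq> carrier M" if "ideal J R" for J
    using that by (auto dest: ideal.Icarr)
  have sub: "submodule (ideal_smult R J M) R M" if "ideal J R" for J
    unfolding ideal_smult_def by (rule submodule_span[OF gen_sub[OF that]])
  have main: "x = \<zero>\<^bsub>M\<^esub>" if x: "\<And>n::nat. n \<ge> 1 \<Longrightarrow> x \<in> ideal_smult R (m [^]\<^bsub>ideals_set R\<^esub> n) M" for x
  proof -
    have "x \<in> ideal_smult R (m [^]\<^bsub>ideals_set R\<^esub> (1::nat)) M" by (rule x) simp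
    then have xc: "x \<in> carrier M"
      using submoduleE(1)[OF sub[OF ideal_pow_ideal[OF mi]]] by blast
    define Rx where "Rx = {a \<odot>\<^bsub>M\<^esub> x | a. a \<in> carrier R}"
    define mx where "mx = {a \<odot>\<^bsub>M\<^esub> x | a. a \<in> m}"
    have Rx: "submodule Rx R M" unfolding Rx_def by (rule submodule_ideal_multiples[OF xc oneideal])
    have mx: "submodule mx R M" unfolding mx_def by (rule submodule_ideal_multiples[OF xc mi])
    have mxRx: "mx \<subseteq> Rx" unfolding mx_def Rx_def by auto
    let ?Q = "{Q. submodule Q R M \<and> Q \<inter> Rx = mx}"
    have "\<exists>N\<in>?Q. \<forall>Z\<in>?Q. N \<subseteq> Z \<longrightarrow> Z = N"
    proof (rule subset_Zorn_nonempty)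
      show "?Q \<noteq> {}" using mx mxRx by blast
      fix C assume C: "C \<noteq> {}" "subset.chain ?Q C"
      then have "submodule (\<Union>C) R M"
        by (intro submodule_Union_chain) (auto simp: subset_chain_def)
      moreover have "\<Union>C \<inter> Rx = mx" using C unfolding subset_chain_def by blast
      ultimately show "\<Union>C \<in> ?Q" by blast
    qed
    then obtain Q where QA: "Q \<in> ?Q" and mx': "\<forall>Z\<in>?Q. Q \<subseteq> Z \<longrightarrow> Z = Q" ..
    from QA have Q: "submodule Q R M" "Q \<inter> Rx = mx" by auto
    have max: "Z = Q" if "submodule Z R M" "Z \<inter> Rx = mx" "Q \<subseteq> Z" for Z
      using bspec[OF mx', of Z] that by simp
    note Q' = submoduleE[OF Q(1)]
    define A where "A = {a \<in> carrier R. \<forall>y\<in>carrier M. a \<odot>\<^bsub>M\<^esub> y \<in> Q}"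
    have A: "ideal A R" unfolding A_def by (rule ann_quotient_ideal[OF Q(1)])
    \<comment> \<open>Every element of \<open>m\<close> has a power that multiplies \<open>M\<close> into \<open>Q\<close>.\<close>
    have pow: "\<exists>k::nat. a [^] k \<in> A" if a: "a \<in> m" for a
    proof -
      have ac: "a \<in> carrier R" using a by simp
      define N where "N k = {y \<in> carrier M. a [^] k \<odot>\<^bsub>M\<^esub> y \<in> Q}" for k :: nat
      have Suc: "a [^] Suc k \<odot>\<^bsub>M\<^esub> y = a \<odot>\<^bsub>M\<^esub> (a [^] k \<odot>\<^bsub>M\<^esub> y)" if "y \<in> carrier M" for k :: nat and y
      proof -
        have "a [^] Suc k = a \<otimes> a [^] k" using ac m_comm[of a "a [^] k"] by simp
        then show ?thesis using that ac smult_assoc1[of a "a [^] k" y] by simp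
      qed
      have "submodule (N n) R M" for n
        unfolding N_def by (rule submodule_vimage_smult[OF _ Q(1)]) (use ac in simp)
      moreover have "N n \<subseteq> N (Suc n)" for n
        unfolding N_def using Suc Q'(4)[OF ac] by auto
      moreover have "N n \<subseteq> module_span R M S" for n unfolding S(3) N_def by blast
      ultimately have "\<exists>n. \<forall>k\<ge>n. N k = N n"
        by (rule submodule_sequence_stabilises[OF noeth S(1,2)])
      then obtain k where k': "\<forall>j\<ge>k. N j = N k" by blast
      have k: "N (Suc k) = N k" by (rule k'[rule_format]) simp
      let ?I = "{a [^] k \<odot>\<^bsub>M\<^esub> y | y. y \<in> carrier M}"
      have akc: "a [^] k \<in> carrier R" using ac by simp
      have I: "submodule ?I R M" by (rule submodule_image_smult[OF akc])
      let ?X = "{u \<oplus>\<^bsub>M\<^esub> q | u q. u \<in> ?I \<and> q \<in> Q}"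
      have Z: "submodule ?X R M" by (rule submodule_sum[OF I Q(1)])
      have QX: "Q \<subseteq> ?X"
      proof
        fix q assume q: "q \<in> Q"
        then have "q = \<zero>\<^bsub>M\<^esub> \<oplus>\<^bsub>M\<^esub> q" using Q'(1) by auto
        then show "q \<in> ?X" using q submodule_zero[OF I] by blast
      qed
      have "?X \<inter> Rx \<subseteq> mx"
      proof
        fix z assume zX: "z \<in> ?X \<inter> Rx"
        then have zRx: "z \<in> Rx" by blast
        from zX obtain y q where z1: "z = a [^] k \<odot>\<^bsub>M\<^esub> y \<oplus>\<^bsub>M\<^esub> q" "y \<in> carrier M" "q \<in> Q"
          by blast
        from zRx obtain b where z2: "z = b \<odot>\<^bsub>M\<^esub> x" "b \<in> carrier R" unfolding Rx_def by blast
        note z = z1 z2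
        have qc: "q \<in> carrier M" using z(3) Q'(1) by blast
        have zc: "z \<in> carrier M" using z2 xc by simp
        have "a \<odot>\<^bsub>M\<^esub> z = (a \<otimes> b) \<odot>\<^bsub>M\<^esub> x" using z ac xc by (simp add: smult_assoc1)
        moreover have "a \<otimes> b \<in> m" using a z(5) by (simp add: m.I_r_closed)
        ultimately have "a \<odot>\<^bsub>M\<^esub> z \<in> mx" unfolding mx_def by blast
        then have az: "a \<odot>\<^bsub>M\<^esub> z \<in> Q" using Q(2) by blast
        have yc: "a [^] Suc k \<odot>\<^bsub>M\<^esub> y \<in> carrier M" using ac z(2) by simp
        have eq: "a \<odot>\<^bsub>M\<^esub> z = a [^] Suc k \<odot>\<^bsub>M\<^esub> y \<oplus>\<^bsub>M\<^esub> a \<odot>\<^bsub>M\<^esub> q"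
          unfolding Suc[OF z(2)] z(1) using ac akc z(2) qc by (simp add: smult_r_distr)
        have "a [^] Suc k \<odot>\<^bsub>M\<^esub> y = a \<odot>\<^bsub>M\<^esub> z \<ominus>\<^bsub>M\<^esub> a \<odot>\<^bsub>M\<^esub> q"
          unfolding eq using yc ac qc by (simp add: a_minus_def M.a_assoc M.r_neg)
        also have "\<dots> \<in> Q" using submodule_minus[OF Q(1) az Q'(4)[OF ac z(3)]] .
        finally have "y \<in> N (Suc k)" unfolding N_def using z(2) by simp
        then have "a [^] k \<odot>\<^bsub>M\<^esub> y \<in> Q" unfolding k unfolding N_def by simp
        then have "z \<in> Q" using z(1,3) Q'(5) by simp
        then show "z \<in> mx" using Q(2) zRx by blast
      qed
      moreover have "mx \<subseteq> ?X \<inter> Rx" using QX Q(2) mxRx by blast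
      ultimately have XQ: "?X = Q" using max[OF Z _ QX] by blast
      have "a [^] k \<odot>\<^bsub>M\<^esub> y \<in> Q" if y: "y \<in> carrier M" for y
      proof -
        have "a [^] k \<odot>\<^bsub>M\<^esub> y = a [^] k \<odot>\<^bsub>M\<^esub> y \<oplus>\<^bsub>M\<^esub> \<zero>\<^bsub>M\<^esub>" using akc y by simp
        moreover have "a [^] k \<odot>\<^bsub>M\<^esub> y \<in> ?I" using y by blast
        ultimately have "a [^] k \<odot>\<^bsub>M\<^esub> y \<in> ?X"
          using submodule_zero[OF Q(1)] by blast
        then show ?thesis unfolding XQ .
      qed
      then show ?thesis unfolding A_def using akc by blast
    qed
    obtain F where F: "F \<subseteq> carrier R" "finite F" "m = Idl F" using finetely_gen[OF mi] by blast
    have "F \<subseteq> m" using genideal_self[OF F(1)] F(3) by blast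
    then obtain n :: nat where n: "m [^]\<^bsub>ideals_set R\<^esub> n \<subseteq> A"
      using fg_ideal_pow_subset[OF A F(2,1)] pow F(3) by blast
    have "m [^]\<^bsub>ideals_set R\<^esub> Suc n \<subseteq> m [^]\<^bsub>ideals_set R\<^esub> n"
      unfolding ideals_set_pow_Suc using ideal_prod_inter[OF ideal_pow_ideal[OF mi] mi] by blast
    with n have n': "m [^]\<^bsub>ideals_set R\<^esub> Suc n \<subseteq> A" by blast
    have "ideal_smult R (m [^]\<^bsub>ideals_set R\<^esub> Suc n) M \<subseteq> Q"
      unfolding ideal_smult_def by (rule span_least[OF Q(1)]) (use n' in \<open>auto simp: A_def\<close>)
    then have "x \<in> Q" using x[of "Suc n"] by auto
    moreover have "x \<in> Rx" unfolding Rx_def using smult_one[OF xc, symmetric] by blast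
    ultimately obtain a where a: "a \<in> m" "x = a \<odot>\<^bsub>M\<^esub> x" using Q(2) unfolding mx_def by blast
    have ac: "a \<in> carrier R" using a by simp
    have U: "\<one> \<ominus> a \<in> Units R" by (rule local_ring_one_minus_Units[OF noeth loc a(1)])
    have "(\<one> \<ominus> a) \<odot>\<^bsub>M\<^esub> x = x \<oplus>\<^bsub>M\<^esub> \<ominus>\<^bsub>M\<^esub> (a \<odot>\<^bsub>M\<^esub> x)"
      using ac xc by (simp add: a_minus_def smult_l_distr smult_l_minus)
    also have "\<dots> = \<zero>\<^bsub>M\<^esub>" using a(2) xc by (metis M.r_neg)
    finally have 0: "(\<one> \<ominus> a) \<odot>\<^bsub>M\<^esub> x = \<zero>\<^bsub>M\<^esub>" .
    have "x = (inv (\<one> \<ominus> a) \<otimes> (\<one> \<ominus> a)) \<odot>\<^bsub>M\<^esub> x" using U xc by simp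
    also have "\<dots> = inv (\<one> \<ominus> a) \<odot>\<^bsub>M\<^esub> ((\<one> \<ominus> a) \<odot>\<^bsub>M\<^esub> x)"
      by (rule smult_assoc1) (use U xc ac in auto)
    also have "\<dots> = \<zero>\<^bsub>M\<^esub>" unfolding 0 using U by (simp add: smult_r_null)
    finally show ?thesis .
  qed
  show ?thesis
  proof (intro equalityI subsetI)
    fix x assume "x \<in> (\<Inter>n\<in>{1::nat..}. ideal_smult R (m [^]\<^bsub>ideals_set R\<^esub> n) M)"
    then have "x = \<zero>\<^bsub>M\<^esub>" by (intro main) auto
    then show "x \<in> {\<zero>\<^bsub>M\<^esub>}" by blast
  next
    fix x assume "x \<in> {\<zero>\<^bsub>M\<^esub>}"
    then show "x \<in> (\<Inter>n\<in>{1::nat..}. ideal_smult R (m [^]\<^bsub>ideals_set R\<^esub> n) M)"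
      using submodule_zero[OF sub[OF ideal_pow_ideal[OF mi]]] by auto
  qed
qed

end

section \<open>The tensor product as a module\<close>

lemma ideal_module_is_module:
  assumes "cring R" "ideal I R"
  shows "module R (ideal_module R I)"
proof -
  interpret cring R by fact
  interpret I: ideal I R by fact
  have I: "\<And>x. x \<in> I \<Longrightarrow> x \<in> carrier R" by (rule I.Icarr)
  show ?thesis
  proof (rule moduleI)
    show "abelian_group (ideal_module R I)"
    proof (rule abelian_groupI)
      show "\<exists>y\<in>carrier (ideal_module R I). y \<oplus>\<^bsub>ideal_module R I\<^esub> x = \<zero>\<^bsub>ideal_module R I\<^esub>"
        if "x \<in> carrier (ideal_module R I)" for x
        using that I by (auto simp: ideal_module_def intro!: bexI[of _ "\<ominus>\<^bsub>R\<^esub> x"] l_neg)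
    qed (auto simp: ideal_module_def I a_ac)
  qed (auto simp: ideal_module_def assms(1) I l_distr r_distr m_assoc I.I_l_closed)
qed

text \<open>
  Elements of the tensor product are handled through representatives: \<open>TR\<close> is the subgroup of
  relations, \<open>cls c\<close> the class of a formal sum \<open>c\<close>, and \<open>act a\<close> the action of a scalar on formal
  sums.
\<close>

locale tensor = M: module R M + N: module R N
  for R (structure) and M (structure) and N (structure)
begin

abbreviation FG where "FG \<equiv> free_Abelian_group (carrier M \<times> carrier N)"

definition TR where "TR = generate FG (tensor_relations R M N)"

definition cls where "cls c = TR #>\<^bsub>FG\<^esub> c"

definition act where "act a = frag_extend (\<lambda>(x, y). frag_of (a \<odot>\<^bsub>M\<^esub> x, y))"

abbreviation TP where "TP \<equiv> tensor_product R M N"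

lemma TP_simps:
  "carrier TP = rcosets\<^bsub>FG\<^esub> TR" "\<zero>\<^bsub>TP\<^esub> = TR" "add TP = set_mult FG"
  "a \<odot>\<^bsub>TP\<^esub> C = (\<Union>c\<in>C. cls (act a c))"
  unfolding tensor_product_def TR_def cls_def act_def Let_def by simp_all

sublocale F: comm_group FG by (rule abelian_free_Abelian_group)

lemma keys_diff_subset: "Poly_Mapping.keys a \<subseteq> B \<Longrightarrow> Poly_Mapping.keys b \<subseteq> B \<Longrightarrow> Poly_Mapping.keys (a - b) \<subseteq> B"
  using keys_diff[of a b] by blast

lemma relation_cases:
  assumes "r \<in> tensor_relations R M N"
  obtains (left) x x' y where "x \<in> carrier M" "x' \<in> carrier M" "y \<in> carrier N"
      "r = frag_of (x \<oplus>\<^bsub>M\<^esub> x', y) - frag_of (x, y) - frag_of (x', y)"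
    | (right) x y y' where "x \<in> carrier M" "y \<in> carrier N" "y' \<in> carrier N"
      "r = frag_of (x, y \<oplus>\<^bsub>N\<^esub> y') - frag_of (x, y) - frag_of (x, y')"
    | (scal) a x y where "a \<in> carrier R" "x \<in> carrier M" "y \<in> carrier N"
      "r = frag_of (a \<odot>\<^bsub>M\<^esub> x, y) - frag_of (x, a \<odot>\<^bsub>N\<^esub> y)"
  using assms unfolding tensor_relations_def
  by (elim UnE CollectE exE conjE) (rule that; assumption)+

lemma relations_in_FG: "tensor_relations R M N \<subseteq> carrier FG"
proof
  fix r assume "r \<in> tensor_relations R M N"
  then have "Poly_Mapping.keys r \<subseteq> carrier M \<times> carrier N"
    by (cases rule: relation_cases) (simp_all add: keys_diff_subset)
  then show "r \<in> carrier FG" by simp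
qed

lemma TR_subgroup: "subgroup TR FG"
  unfolding TR_def by (rule F.generate_is_subgroup[OF relations_in_FG])

lemma TR_normal: "normal TR FG"
  using TR_subgroup by (rule F.subgroup_imp_normal)

lemma TR_0: "0 \<in> TR" using subgroup.one_closed[OF TR_subgroup] by simp

lemma TR_add: "a \<in> TR \<Longrightarrow> b \<in> TR \<Longrightarrow> a + b \<in> TR"
  using subgroup.m_closed[OF TR_subgroup] by simp

lemma TR_keys: "a \<in> TR \<Longrightarrow> Poly_Mapping.keys a \<subseteq> carrier M \<times> carrier N"
  using subsetD[OF subgroup.subset[OF TR_subgroup], of a]
  by (simp only: carrier_free_Abelian_group_iff)

lemma TR_uminus: "a \<in> TR \<Longrightarrow> - a \<in> TR"
  using subgroup.m_inv_closed[OF TR_subgroup, of a] TR_keys[of a] by simp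

lemma TR_diff: "a \<in> TR \<Longrightarrow> b \<in> TR \<Longrightarrow> a - b \<in> TR"
  using TR_add[of a "- b"] TR_uminus by simp

lemma TR_rel: "r \<in> tensor_relations R M N \<Longrightarrow> r \<in> TR"
  unfolding TR_def by (rule generate.incl)

lemma cls_def': "cls c = {k + c | k. k \<in> TR}"
  unfolding cls_def r_coset_def by auto

lemma cls_eq_iff: "cls c = cls d \<longleftrightarrow> c - d \<in> TR"
proof
  assume "cls c = cls d"
  moreover have "c \<in> cls c" unfolding cls_def' using TR_0 by force
  ultimately show "c - d \<in> TR" unfolding cls_def' by auto
next
  assume cd: "c - d \<in> TR"
  show "cls c = cls d"
  proof (intro equalityI subsetI)
    fix x assume "x \<in> cls c"
    then obtain k where "x = k + c" "k \<in> TR" unfolding cls_def' by blast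
    then have "x = (k + (c - d)) + d" "k + (c - d) \<in> TR" using TR_add cd by auto
    then show "x \<in> cls d" unfolding cls_def' by blast
  next
    fix x assume "x \<in> cls d"
    then obtain k where "x = k + d" "k \<in> TR" unfolding cls_def' by blast
    then have "x = (k - (c - d)) + c" "k - (c - d) \<in> TR" using TR_diff cd by auto
    then show "x \<in> cls c" unfolding cls_def' by blast
  qed
qed

lemma cls_0: "cls 0 = TR" unfolding cls_def' by simp

lemma carrier_TP: "carrier TP = {cls c | c. Poly_Mapping.keys c \<subseteq> carrier M \<times> carrier N}"
  unfolding TP_simps RCOSETS_def cls_def by auto

lemma cls_add:
  assumes "Poly_Mapping.keys c \<subseteq> carrier M \<times> carrier N" "Poly_Mapping.keys d \<subseteq> carrier M \<times> carrier N"
  shows "cls c \<oplus>\<^bsub>TP\<^esub> cls d = cls (c + d)"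
  unfolding TP_simps cls_def using normal.rcos_sum[OF TR_normal, of c d] assms by simp

lemma act_keys:
  assumes "a \<in> carrier R" "Poly_Mapping.keys c \<subseteq> carrier M \<times> carrier N"
  shows "Poly_Mapping.keys (act a c) \<subseteq> carrier M \<times> carrier N"
proof -
  have "Poly_Mapping.keys (act a c) \<subseteq>
      (\<Union>x \<in> Poly_Mapping.keys c. Poly_Mapping.keys ((\<lambda>(x, y). frag_of (a \<odot>\<^bsub>M\<^esub> x, y)) x))"
    unfolding act_def by (rule keys_frag_extend)
  also have "\<dots> \<subseteq> carrier M \<times> carrier N" using assms by fastforce
  finally show ?thesis .
qed

lemma act_simps [simp]:
  "act a 0 = 0" "act a (c + d) = act a c + act a d" "act a (c - d) = act a c - act a d"
  "act a (- c) = - act a c" "act a (frag_of (x, y)) = frag_of (a \<odot>\<^bsub>M\<^esub> x, y)"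
  by (simp_all add: act_def frag_extend_add frag_extend_diff frag_extend_minus)

lemma rel_l: "x \<in> carrier M \<Longrightarrow> x' \<in> carrier M \<Longrightarrow> y \<in> carrier N \<Longrightarrow>
    frag_of (x \<oplus>\<^bsub>M\<^esub> x', y) - frag_of (x, y) - frag_of (x', y) \<in> TR"
  by (rule TR_rel) (unfold tensor_relations_def, blast)

lemma rel_r: "x \<in> carrier M \<Longrightarrow> y \<in> carrier N \<Longrightarrow> y' \<in> carrier N \<Longrightarrow>
    frag_of (x, y \<oplus>\<^bsub>N\<^esub> y') - frag_of (x, y) - frag_of (x, y') \<in> TR"
  by (rule TR_rel) (unfold tensor_relations_def, blast)

lemma rel_s: "a \<in> carrier R \<Longrightarrow> x \<in> carrier M \<Longrightarrow> y \<in> carrier N \<Longrightarrow>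
    frag_of (a \<odot>\<^bsub>M\<^esub> x, y) - frag_of (x, a \<odot>\<^bsub>N\<^esub> y) \<in> TR"
  by (rule TR_rel) (unfold tensor_relations_def, blast)

lemma TR_induct [consumes 1, case_names zero rel diff]:
  assumes c: "c \<in> TR" and 0: "P 0" and r: "\<And>r. r \<in> tensor_relations R M N \<Longrightarrow> P r"
    and d: "\<And>c d. c \<in> TR \<Longrightarrow> d \<in> TR \<Longrightarrow> P c \<Longrightarrow> P d \<Longrightarrow> P (c - d)"
  shows "P c"
  using c unfolding TR_def
proof (induction rule: generate.induct)
  case one
  show ?case using 0 by simp
next
  case (incl h)
  then show ?case by (rule r)
next
  case (inv h)
  then have "P (0 - h)" by (intro d TR_0 TR_rel 0 r)
  moreover have "Poly_Mapping.keys h \<subseteq> carrier M \<times> carrier N" using inv by (intro TR_keys TR_rel)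
  ultimately show ?case by simp
next
  case (eng h1 h2)
  then have h: "h1 \<in> TR" "h2 \<in> TR" unfolding TR_def by auto
  have m: "P (0 - h2)" by (rule d[OF TR_0 h(2) 0 eng.IH(2)])
  have "P (h1 - (0 - h2))" by (rule d[OF h(1) TR_diff[OF TR_0 h(2)] eng.IH(1) m])
  then show ?case by simp
qed

lemma act_TR:
  assumes a: "a \<in> carrier R" and c: "c \<in> TR"
  shows "act a c \<in> TR"
  using c
proof (induction rule: TR_induct)
  case (rel r)
  then show ?case
  proof (cases rule: relation_cases)
    case (left x x' y)
    then show ?thesis using rel_l[of "a \<odot>\<^bsub>M\<^esub> x" "a \<odot>\<^bsub>M\<^esub> x'" y] a by (simp add: M.smult_r_distr)
  next
    case (right x y y')
    then show ?thesis using rel_r[of "a \<odot>\<^bsub>M\<^esub> x" y y'] a by simp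
  next
    case (scal b x y)
    have "a \<odot>\<^bsub>M\<^esub> (b \<odot>\<^bsub>M\<^esub> x) = b \<odot>\<^bsub>M\<^esub> (a \<odot>\<^bsub>M\<^esub> x)"
      using scal a M.smult_assoc1[of a b x] M.smult_assoc1[of b a x] M.R.m_comm[of a b] by simp
    then show ?thesis using scal rel_s[of b "a \<odot>\<^bsub>M\<^esub> x" y] a by simp
  qed
qed (auto simp: TR_0 TR_diff)

lemma cls_smult:
  assumes a: "a \<in> carrier R"
  shows "a \<odot>\<^bsub>TP\<^esub> cls c = cls (act a c)"
proof -
  have "cls (act a d) = cls (act a c)" if "d \<in> cls c" for d
  proof -
    from that obtain k where k: "k \<in> TR" "d = k + c" unfolding cls_def' by blast
    then show ?thesis unfolding cls_eq_iff using act_TR[OF a k(1)] by simp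
  qed
  moreover have "c \<in> cls c" unfolding cls_def' using TR_0 by force
  ultimately show ?thesis unfolding TP_simps by blast
qed

lemma FG_induct [consumes 1, case_names zero one diff]:
  assumes "Poly_Mapping.keys c \<subseteq> carrier M \<times> carrier N" "P 0"
    "\<And>x y. x \<in> carrier M \<Longrightarrow> y \<in> carrier N \<Longrightarrow> P (frag_of (x, y))"
    "\<And>c d. P c \<Longrightarrow> P d \<Longrightarrow> P (c - d)"
  shows "P c"
  using assms(1) by (induction c rule: frag_induction) (auto intro: assms)

lemma act_l_distr:
  assumes "a \<in> carrier R" "b \<in> carrier R" "Poly_Mapping.keys c \<subseteq> carrier M \<times> carrier N"
  shows "act (a \<oplus> b) c - (act a c + act b c) \<in> TR"
  using assms(3)
proof (induction rule: FG_induct)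
  case (one x y)
  then show ?case using rel_l[of "a \<odot>\<^bsub>M\<^esub> x" "b \<odot>\<^bsub>M\<^esub> x" y] assms
    by (simp add: M.smult_l_distr algebra_simps)
next
  case (diff c d)
  then show ?case using TR_diff[OF diff] by (simp add: algebra_simps)
qed (simp add: TR_0)

lemma act_assoc:
  assumes "a \<in> carrier R" "b \<in> carrier R" "Poly_Mapping.keys c \<subseteq> carrier M \<times> carrier N"
  shows "act (a \<otimes> b) c = act a (act b c)"
  using assms(3) by (induction rule: FG_induct) (use assms in \<open>auto simp: M.smult_assoc1\<close>)

lemma act_one:
  assumes "Poly_Mapping.keys c \<subseteq> carrier M \<times> carrier N"
  shows "act \<one> c = c"
  using assms by (induction rule: FG_induct) auto

lemma keys_add_subset: "Poly_Mapping.keys a \<subseteq> B \<Longrightarrow> Poly_Mapping.keys b \<subseteq> B \<Longrightarrow> Poly_Mapping.keys (a + b) \<subseteq> B"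
  using keys_add[of a b] by blast

lemma tensor_product_is_module: "module R TP"
proof (rule moduleI)
  show "cring R" by (rule M.R.is_cring)
  show "abelian_group TP"
  proof (rule abelian_groupI)
    fix x y assume "x \<in> carrier TP" "y \<in> carrier TP"
    then obtain c d where cd: "x = cls c" "y = cls d" "Poly_Mapping.keys c \<subseteq> carrier M \<times> carrier N"
        "Poly_Mapping.keys d \<subseteq> carrier M \<times> carrier N" unfolding carrier_TP by blast
    then have "x \<oplus>\<^bsub>TP\<^esub> y = cls (c + d)" by (simp add: cls_add)
    then show "x \<oplus>\<^bsub>TP\<^esub> y \<in> carrier TP"
      using keys_add_subset[OF cd(3,4)] unfolding carrier_TP by blast
    show "x \<oplus>\<^bsub>TP\<^esub> y = y \<oplus>\<^bsub>TP\<^esub> x" using cd by (simp add: cls_add add.commute)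
  next
    show "\<zero>\<^bsub>TP\<^esub> \<in> carrier TP" unfolding carrier_TP TP_simps(2) cls_0[symmetric]
      by (auto intro!: exI[of _ 0])
  next
    fix x y z assume "x \<in> carrier TP" "y \<in> carrier TP" "z \<in> carrier TP"
    then show "x \<oplus>\<^bsub>TP\<^esub> y \<oplus>\<^bsub>TP\<^esub> z = x \<oplus>\<^bsub>TP\<^esub> (y \<oplus>\<^bsub>TP\<^esub> z)"
      unfolding carrier_TP by (auto simp: cls_add keys_add_subset add.assoc)
  next
    fix x assume "x \<in> carrier TP"
    then obtain c where c: "x = cls c" "Poly_Mapping.keys c \<subseteq> carrier M \<times> carrier N"
      unfolding carrier_TP by blast
    then show "\<zero>\<^bsub>TP\<^esub> \<oplus>\<^bsub>TP\<^esub> x = x"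
      using cls_add[of 0 c] unfolding TP_simps(2) cls_0[symmetric] by simp
    have "cls (- c) \<oplus>\<^bsub>TP\<^esub> x = \<zero>\<^bsub>TP\<^esub>"
      unfolding TP_simps(2) cls_0[symmetric] c(1) using c(2) cls_add[of "- c" c] by simp
    moreover have "cls (- c) \<in> carrier TP"
      unfolding carrier_TP using c(2) keys_minus[of c] by blast
    ultimately show "\<exists>y\<in>carrier TP. y \<oplus>\<^bsub>TP\<^esub> x = \<zero>\<^bsub>TP\<^esub>" by blast
  qed
next
  fix a x assume a: "a \<in> carrier R" and "x \<in> carrier TP"
  then obtain c where c: "x = cls c" "Poly_Mapping.keys c \<subseteq> carrier M \<times> carrier N"
    unfolding carrier_TP by blast
  then show "a \<odot>\<^bsub>TP\<^esub> x \<in> carrier TP"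
    using act_keys[OF a c(2)] cls_smult[OF a, of c] unfolding carrier_TP by blast
next
  fix a b x assume ab: "a \<in> carrier R" "b \<in> carrier R" and "x \<in> carrier TP"
  then obtain c where c: "x = cls c" "Poly_Mapping.keys c \<subseteq> carrier M \<times> carrier N"
    unfolding carrier_TP by blast
  show "(a \<oplus> b) \<odot>\<^bsub>TP\<^esub> x = a \<odot>\<^bsub>TP\<^esub> x \<oplus>\<^bsub>TP\<^esub> b \<odot>\<^bsub>TP\<^esub> x"
    using ab c by (simp add: cls_smult cls_add act_keys cls_eq_iff act_l_distr)
  show "(a \<otimes> b) \<odot>\<^bsub>TP\<^esub> x = a \<odot>\<^bsub>TP\<^esub> (b \<odot>\<^bsub>TP\<^esub> x)"
    using ab c by (simp add: cls_smult act_assoc)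
next
  fix a x y assume "a \<in> carrier R" "x \<in> carrier TP" "y \<in> carrier TP"
  then show "a \<odot>\<^bsub>TP\<^esub> (x \<oplus>\<^bsub>TP\<^esub> y) = a \<odot>\<^bsub>TP\<^esub> x \<oplus>\<^bsub>TP\<^esub> a \<odot>\<^bsub>TP\<^esub> y"
    unfolding carrier_TP by (auto simp: cls_smult cls_add act_keys)
next
  fix x assume "x \<in> carrier TP"
  then show "\<one> \<odot>\<^bsub>TP\<^esub> x = x" unfolding carrier_TP by (auto simp: cls_smult act_one)
qed

lemma cls_frag_l_add:
  assumes "x \<in> carrier M" "x' \<in> carrier M" "y \<in> carrier N"
  shows "cls (frag_of (x \<oplus>\<^bsub>M\<^esub> x', y)) = cls (frag_of (x, y)) \<oplus>\<^bsub>TP\<^esub> cls (frag_of (x', y))"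
  using assms rel_l[OF assms] by (simp add: cls_add cls_eq_iff algebra_simps)

lemma cls_frag_r_add:
  assumes "x \<in> carrier M" "y \<in> carrier N" "y' \<in> carrier N"
  shows "cls (frag_of (x, y \<oplus>\<^bsub>N\<^esub> y')) = cls (frag_of (x, y)) \<oplus>\<^bsub>TP\<^esub> cls (frag_of (x, y'))"
  using assms rel_r[OF assms] by (simp add: cls_add cls_eq_iff algebra_simps)

lemma cls_frag_l_smult:
  assumes "a \<in> carrier R"
  shows "cls (frag_of (a \<odot>\<^bsub>M\<^esub> x, y)) = a \<odot>\<^bsub>TP\<^esub> cls (frag_of (x, y))"
  using assms by (simp add: cls_smult)

lemma cls_frag_r_smult:
  assumes "a \<in> carrier R" "x \<in> carrier M" "y \<in> carrier N"
  shows "cls (frag_of (x, a \<odot>\<^bsub>N\<^esub> y)) = a \<odot>\<^bsub>TP\<^esub> cls (frag_of (x, y))"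
  using assms rel_s[OF assms] TR_uminus[OF rel_s[OF assms]] by (simp add: cls_smult cls_eq_iff)


text \<open>
  This and its mirror image spread membership in \<open>Q\<close> from pure tensors of generators to all
  pure tensors.
\<close>

lemma submodule_left:
  assumes Q: "submodule Q R TP" and y: "y \<in> carrier N"
  shows "submodule {x \<in> carrier M. cls (frag_of (x, y)) \<in> Q} R M" (is "submodule ?S R M")
proof -
  interpret T: module R TP by (rule tensor_product_is_module)
  note Q' = T.submoduleE[OF Q]
  have sm: "r \<odot>\<^bsub>M\<^esub> a \<in> ?S"
    if "r \<in> carrier R" "a \<in> ?S" for r a
    using that Q'(4) by (auto simp: cls_frag_l_smult)
  show ?thesis
  proof (rule M.submodule_criterion)
    have "cls (frag_of (\<zero> \<odot>\<^bsub>M\<^esub> \<zero>\<^bsub>M\<^esub>, y)) = \<zero> \<odot>\<^bsub>TP\<^esub> cls (frag_of (\<zero>\<^bsub>M\<^esub>, y))"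
      by (rule cls_frag_l_smult) simp
    moreover have "cls (frag_of (\<zero>\<^bsub>M\<^esub>, y)) \<in> carrier TP" unfolding carrier_TP using y by auto
    ultimately have "cls (frag_of (\<zero>\<^bsub>M\<^esub>, y)) = \<zero>\<^bsub>TP\<^esub>" by (simp add: M.smult_l_null T.smult_l_null)
    then show "\<zero>\<^bsub>M\<^esub> \<in> ?S"
      using T.submodule_zero[OF Q] by simp
    show "a \<oplus>\<^bsub>M\<^esub> b \<in> ?S"
      if "a \<in> ?S" "b \<in> ?S" for a b
      using that y Q'(5) by (auto simp: cls_frag_l_add)
  qed (use sm in auto)
qed

lemma submodule_right:
  assumes Q: "submodule Q R TP" and x: "x \<in> carrier M"
  shows "submodule {y \<in> carrier N. cls (frag_of (x, y)) \<in> Q} R N" (is "submodule ?S R N")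
proof -
  interpret T: module R TP by (rule tensor_product_is_module)
  note Q' = T.submoduleE[OF Q]
  have sm: "r \<odot>\<^bsub>N\<^esub> a \<in> ?S"
    if "r \<in> carrier R" "a \<in> ?S" for r a
    using that x Q'(4) by (auto simp: cls_frag_r_smult)
  show ?thesis
  proof (rule N.submodule_criterion)
    have "cls (frag_of (x, \<zero> \<odot>\<^bsub>N\<^esub> \<zero>\<^bsub>N\<^esub>)) = \<zero> \<odot>\<^bsub>TP\<^esub> cls (frag_of (x, \<zero>\<^bsub>N\<^esub>))"
      by (rule cls_frag_r_smult) (use x in auto)
    moreover have "cls (frag_of (x, \<zero>\<^bsub>N\<^esub>)) \<in> carrier TP" unfolding carrier_TP using x by auto
    ultimately have "cls (frag_of (x, \<zero>\<^bsub>N\<^esub>)) = \<zero>\<^bsub>TP\<^esub>" by (simp add: N.smult_l_null T.smult_l_null)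
    then show "\<zero>\<^bsub>N\<^esub> \<in> ?S"
      using T.submodule_zero[OF Q] by simp
    show "a \<oplus>\<^bsub>N\<^esub> b \<in> ?S"
      if "a \<in> ?S" "b \<in> ?S" for a b
      using that x Q'(5) by (auto simp: cls_frag_r_add)
  qed (use sm in auto)
qed

text \<open>
  The classes of pairs of generators generate: \<open>submodule_left\<close> frees the first component and
  \<open>submodule_right\<close> then the second.
\<close>

lemma finite_tensor_product:
  assumes M: "finite_module R M" and N: "finite_module R N"
  shows "finite_module R TP"
proof -
  interpret T: module R TP by (rule tensor_product_is_module)
  from M obtain S where S: "finite S" "S \<subseteq> carrier M" "module_span R M S = carrier M"
    unfolding finite_module_def by blast
  from N obtain U where U: "finite U" "U \<subseteq> carrier N" "module_span R N U = carrier N"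
    unfolding finite_module_def by blast
  let ?G = "(\<lambda>p. cls (frag_of p)) ` (S \<times> U)"
  have G: "?G \<subseteq> carrier TP" unfolding carrier_TP using S(2) U(2) by force
  define Q where "Q = module_span R TP ?G"
  have Q: "submodule Q R TP" unfolding Q_def by (rule T.submodule_span[OF G])
  note Q' = T.submoduleE[OF Q]
  have GQ: "?G \<subseteq> Q" unfolding Q_def by (rule T.span_superset)
  have 1: "cls (frag_of (x, y)) \<in> Q" if "x \<in> carrier M" "y \<in> U" for x y
  proof -
    have "carrier M \<subseteq> {x \<in> carrier M. cls (frag_of (x, y)) \<in> Q}"
      unfolding S(3)[symmetric]
      by (rule M.span_least[OF submodule_left[OF Q, unfolded S(3)[symmetric]]]) 
         (use that U GQ S M.span_superset in auto)
    then show ?thesis using that by blast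
  qed
  have 2: "cls (frag_of (x, y)) \<in> Q" if x: "x \<in> carrier M" and y: "y \<in> carrier N" for x y
  proof -
    have "module_span R N U \<subseteq> {y \<in> carrier N. cls (frag_of (x, y)) \<in> Q}"
      by (rule N.span_least[OF submodule_right[OF Q x]]) (use 1 x U in auto)
    then show ?thesis using y unfolding U(3) by blast
  qed
  have "cls c \<in> Q" if "Poly_Mapping.keys c \<subseteq> carrier M \<times> carrier N" for c
  proof -
    have "Poly_Mapping.keys c \<subseteq> carrier M \<times> carrier N \<and> cls c \<in> Q"
      using that
    proof (induction rule: FG_induct)
      case zero
      then show ?case using T.submodule_zero[OF Q] by (simp add: cls_0 TP_simps)
    next
      case (one x y)
      then show ?case using 2 by simp
    next
      case (diff c d)
      then have k: "Poly_Mapping.keys (c - d) \<subseteq> carrier M \<times> carrier N" by (simp add: keys_diff_subset)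
      let ?u = "cls (c - d)" and ?v = "cls d"
      have car: "?u \<in> carrier TP" "?v \<in> carrier TP" unfolding carrier_TP using k diff by blast+
      have "?u \<oplus>\<^bsub>TP\<^esub> ?v = cls c" using cls_add[OF k, of d] diff by simp
      then have "?u = cls c \<ominus>\<^bsub>TP\<^esub> ?v"
        using car by (metis T.M.add.inv_solve_right' T.M.a_closed a_minus_def)
      then have "?u \<in> Q" using T.submodule_minus[OF Q] diff by simp
      then show ?case using k by blast
    qed
    then show ?thesis by blast
  qed
  then have "carrier TP \<subseteq> Q" unfolding carrier_TP by blast
  with Q'(1) have "Q = carrier TP" by (rule subset_antisym)
  moreover have "finite ?G" using S(1) U(1) by simp
  ultimately show ?thesis unfolding finite_module_def Q_def using G by (intro exI conjI)
qed

end

section \<open>Separation of tensor products through retractions\<close>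

text \<open>
  An \<open>R\<close>-linear map \<open>f\<close> of \<open>M\<close> into a submodule \<open>S\<close> acts on formal sums through the first
  component. It carries relations to relations, which yields the induced map from \<open>M \<otimes> N\<close> to
  \<open>S \<otimes> N\<close>.
\<close>

locale tensor_retraction = tensor R M N + S: submodule S R M
  for R (structure) and M (structure) and N (structure) and S +
  fixes f
  assumes f_closed: "x \<in> carrier M \<Longrightarrow> f x \<in> S"
    and f_add: "x \<in> carrier M \<Longrightarrow> y \<in> carrier M \<Longrightarrow> f (x \<oplus>\<^bsub>M\<^esub> y) = f x \<oplus>\<^bsub>M\<^esub> f y"
    and f_smult: "a \<in> carrier R \<Longrightarrow> x \<in> carrier M \<Longrightarrow> f (a \<odot>\<^bsub>M\<^esub> x) = a \<odot>\<^bsub>M\<^esub> f x"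
begin

abbreviation MS where "MS \<equiv> M\<lparr>carrier := S\<rparr>"

sublocale T': tensor R MS N
proof -
  have "module R MS" by (rule S.submodule_is_module[OF M.module_axioms])
  then show "tensor R MS N" unfolding tensor_def using N.module_axioms by blast
qed

abbreviation TP' where "TP' \<equiv> tensor_product R MS N"

sublocale TM: module R TP by (rule tensor_product_is_module)
sublocale TM': module R TP' by (rule T'.tensor_product_is_module)

definition fmap where "fmap = frag_extend (\<lambda>(x, y). frag_of (f x, y))"

lemma fmap_simps [simp]:
  "fmap 0 = 0" "fmap (c + d) = fmap c + fmap d" "fmap (c - d) = fmap c - fmap d"
  "fmap (- c) = - fmap c" "fmap (frag_of (x, y)) = frag_of (f x, y)"
  by (simp_all add: fmap_def frag_extend_add frag_extend_diff frag_extend_minus)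

lemma fmap_keys:
  assumes "Poly_Mapping.keys c \<subseteq> carrier M \<times> carrier N"
  shows "Poly_Mapping.keys (fmap c) \<subseteq> S \<times> carrier N"
proof -
  have "Poly_Mapping.keys (fmap c) \<subseteq>
      (\<Union>x \<in> Poly_Mapping.keys c. Poly_Mapping.keys ((\<lambda>(x, y). frag_of (f x, y)) x))"
    unfolding fmap_def by (rule keys_frag_extend)
  also have "\<dots> \<subseteq> S \<times> carrier N"
  proof (rule UN_least)
    fix p assume "p \<in> Poly_Mapping.keys c"
    then have "p \<in> carrier M \<times> carrier N" using assms by blast
    then show "Poly_Mapping.keys ((\<lambda>(x, y). frag_of (f x, y)) p) \<subseteq> S \<times> carrier N"
      by (cases p) (simp add: f_closed)
  qed
  finally show ?thesis .
qed

lemma fmap_TR: "c \<in> TR \<Longrightarrow> fmap c \<in> T'.TR"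
proof (induction rule: TR_induct)
  case (rel r)
  then show ?case
  proof (cases rule: relation_cases)
    case (left x x' y)
    then show ?thesis using T'.rel_l[of "f x" "f x'" y] by (simp add: f_add f_closed)
  next
    case (right x y y')
    then show ?thesis using T'.rel_r[of "f x" y y'] by (simp add: f_closed)
  next
    case (scal b x y)
    then show ?thesis using T'.rel_s[of b "f x" y] by (simp add: f_smult f_closed)
  qed
qed (auto simp: T'.TR_0 T'.TR_diff)

text \<open>
  This is what makes the inclusion of \<open>S\<close> into \<open>M\<close> induce a map of tensor products.
\<close>

lemma TR'_subset: "c \<in> T'.TR \<Longrightarrow> c \<in> TR"
proof (induction rule: T'.TR_induct)
  case (rel r)
  then show ?case
  proof (cases rule: T'.relation_cases)
    case (left x x' y)
    then show ?thesis using rel_l[of "x" "x'" y] S.subset by auto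
  next
    case (right x y y')
    then show ?thesis using rel_r[of "x" y y'] S.subset by auto
  next
    case (scal b x y)
    then show ?thesis using rel_s[of b "x" y] S.subset by auto
  qed
qed (auto simp: TR_0 TR_diff)

lemma fmap_act:
  assumes a: "a \<in> carrier R" and c: "Poly_Mapping.keys c \<subseteq> carrier M \<times> carrier N"
  shows "fmap (act a c) = T'.act a (fmap c)"
  using c by (induction rule: FG_induct) (auto simp: f_smult a)

lemma fmap_cls_eq: "cls c = cls d \<Longrightarrow> T'.cls (fmap c) = T'.cls (fmap d)"
  unfolding cls_eq_iff T'.cls_eq_iff using fmap_TR by fastforce

text \<open>
  The preimage of \<open>J (S \<otimes> N)\<close> under the induced linear map is a submodule containing the
  generators of \<open>J (M \<otimes> N)\<close>.
\<close>

lemma fmap_ideal_smult: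
  assumes J: "J \<subseteq> carrier R" and c: "cls c \<in> ideal_smult R J TP"
  shows "T'.cls (fmap c) \<in> ideal_smult R J TP'"
proof -
  define Q' where "Q' = ideal_smult R J TP'"
  have "{a \<odot>\<^bsub>TP'\<^esub> x |a x. a \<in> J \<and> x \<in> carrier TP'} \<subseteq> carrier TP'"
    using J TM'.smult_closed by blast
  then have Q': "submodule Q' R TP'" unfolding Q'_def ideal_smult_def
    by (rule TM'.submodule_span)
  note Q'E = TM'.submoduleE[OF Q']
  let ?K = "carrier M \<times> carrier N"
  \<comment> \<open>The preimage of \<open>Q'\<close> under the induced map.\<close>
  define Q where "Q = {cls c | c. Poly_Mapping.keys c \<subseteq> ?K \<and> T'.cls (fmap c) \<in> Q'}"
  have QI: "cls c \<in> Q" if "Poly_Mapping.keys c \<subseteq> ?K" "T'.cls (fmap c) \<in> Q'" for c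
    unfolding Q_def using that by blast
  have fk: "Poly_Mapping.keys (fmap c) \<subseteq> carrier MS \<times> carrier N" if "Poly_Mapping.keys c \<subseteq> ?K" for c
    using fmap_keys[OF that] by simp
  have sm: "r \<odot>\<^bsub>TP\<^esub> x \<in> Q" if r: "r \<in> carrier R" and x: "x \<in> Q" for r x
  proof -
    from x obtain c where c: "x = cls c" "Poly_Mapping.keys c \<subseteq> ?K" "T'.cls (fmap c) \<in> Q'"
      unfolding Q_def by blast
    have "T'.cls (fmap (act r c)) = r \<odot>\<^bsub>TP'\<^esub> T'.cls (fmap c)"
      using r c by (simp add: fmap_act T'.cls_smult)
    then have "T'.cls (fmap (act r c)) \<in> Q'" using Q'E(4)[OF r c(3)] by simp
    then show ?thesis unfolding c(1) cls_smult[OF r] by (rule QI[OF act_keys[OF r c(2)]])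
  qed
  have Q: "submodule Q R TP"
  proof (rule TM.submodule_criterion)
    show "Q \<subseteq> carrier TP" unfolding Q_def carrier_TP by blast
    show "\<zero>\<^bsub>TP\<^esub> \<in> Q" using QI[of 0] TM'.submodule_zero[OF Q']
      by (simp add: cls_0 T'.cls_0 TP_simps T'.TP_simps)
    show "a \<oplus>\<^bsub>TP\<^esub> b \<in> Q" if ab: "a \<in> Q" "b \<in> Q" for a b
    proof -
      from ab obtain c d where c: "a = cls c" "Poly_Mapping.keys c \<subseteq> ?K" "T'.cls (fmap c) \<in> Q'"
        and d: "b = cls d" "Poly_Mapping.keys d \<subseteq> ?K" "T'.cls (fmap d) \<in> Q'"
        unfolding Q_def by blast
      have "T'.cls (fmap (c + d)) = T'.cls (fmap c) \<oplus>\<^bsub>TP'\<^esub> T'.cls (fmap d)"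
        using fk[OF c(2)] fk[OF d(2)] by (simp add: T'.cls_add)
      then have "T'.cls (fmap (c + d)) \<in> Q'" using Q'E(5)[OF c(3) d(3)] by simp
      then show ?thesis unfolding c(1) d(1) cls_add[OF c(2) d(2)]
        by (rule QI[OF keys_add_subset[OF c(2) d(2)]])
    qed
  qed (rule sm)
  have "{a \<odot>\<^bsub>TP\<^esub> x |a x. a \<in> J \<and> x \<in> carrier TP} \<subseteq> Q"
  proof
    fix z assume "z \<in> {a \<odot>\<^bsub>TP\<^esub> x |a x. a \<in> J \<and> x \<in> carrier TP}"
    then obtain a c where a: "a \<in> J" and c: "z = a \<odot>\<^bsub>TP\<^esub> cls c" "Poly_Mapping.keys c \<subseteq> ?K"
      unfolding carrier_TP by blast
    have aR: "a \<in> carrier R" using a J by blast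
    have car: "T'.cls (fmap c) \<in> carrier TP'" unfolding T'.carrier_TP using fk[OF c(2)] by blast
    have "T'.cls (fmap (act a c)) = a \<odot>\<^bsub>TP'\<^esub> T'.cls (fmap c)"
      using aR c by (simp add: fmap_act T'.cls_smult)
    also have "\<dots> \<in> Q'" unfolding Q'_def ideal_smult_def
      by (rule subsetD[OF TM'.span_superset]) (use a car in blast)
    finally show "z \<in> Q" unfolding c(1) cls_smult[OF aR] by (rule QI[OF act_keys[OF aR c(2)]])
  qed
  then have "ideal_smult R J TP \<subseteq> Q" unfolding ideal_smult_def by (rule TM.span_least[OF Q])
  with c obtain d where "cls c = cls d" "T'.cls (fmap d) \<in> Q'" unfolding Q_def by blast
  then show ?thesis using fmap_cls_eq unfolding Q'_def by metis
qed

text \<open>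
  As \<open>f\<close> fixes \<open>S\<close>, a formal sum supported on \<open>S\<close> is its own image, so its class in \<open>M \<otimes> N\<close>
  is determined by the class of its image in \<open>S \<otimes> N\<close>.
\<close>

lemma cls_zero_of_retract:
  assumes c: "Poly_Mapping.keys c \<subseteq> S \<times> carrier N" and fixd: "\<And>x. x \<in> S \<Longrightarrow> f x = x"
    and 0: "T'.cls (fmap c) = \<zero>\<^bsub>TP'\<^esub>"
  shows "cls c = \<zero>\<^bsub>TP\<^esub>"
proof -
  have "fmap c = c" using c
  proof (induction c rule: frag_induction)
    case (one p)
    then show ?case by (cases p) (auto simp: fixd)
  qed auto
  then have "T'.cls c = T'.cls 0" using 0 by (simp add: T'.TP_simps T'.cls_0)
  then have "c \<in> T'.TR" unfolding T'.cls_eq_iff by simp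
  then have "c \<in> TR" by (rule TR'_subset)
  then have "cls c = cls 0" unfolding cls_eq_iff by simp
  then show ?thesis by (simp add: TP_simps cls_0)
qed

end

text \<open>
  An element of \<open>M \<otimes> N\<close> has a representative supported on finitely many elements of \<open>M\<close>. The
  retraction onto a submodule \<open>S\<close> containing them takes it, if it lies in the intersection, to
  an element of the corresponding intersection for \<open>S \<otimes> N\<close>, which is zero.
\<close>

lemma (in tensor) adically_separated_of_retracts:
  assumes J: "\<And>n::nat. J [^]\<^bsub>ideals_set R\<^esub> n \<subseteq> carrier R"
    and retr: "\<And>B. finite B \<Longrightarrow> B \<subseteq> carrier M \<Longrightarrow> \<exists>S f. tensor_retraction R M N S f \<and> B \<subseteq> S
       \<and> (\<forall>x\<in>S. f x = x) \<and> adically_separated R J (tensor_product R (M\<lparr>carrier := S\<rparr>) N)"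
  shows "adically_separated R J TP"
proof -
  interpret T: module R TP by (rule tensor_product_is_module)
  have sub: "submodule (ideal_smult R (J [^]\<^bsub>ideals_set R\<^esub> (n::nat)) TP) R TP" for n
    unfolding ideal_smult_def by (rule T.submodule_span) (use J in blast)
  show ?thesis unfolding adically_separated_def
  proof (intro equalityI subsetI)
    fix x assume x: "x \<in> {\<zero>\<^bsub>TP\<^esub>}"
    show "x \<in> (\<Inter>n\<in>{1::nat..}. ideal_smult R (J [^]\<^bsub>ideals_set R\<^esub> n) TP)"
      using x T.submodule_zero[OF sub] by auto
  next
    fix x assume "x \<in> (\<Inter>n\<in>{1::nat..}. ideal_smult R (J [^]\<^bsub>ideals_set R\<^esub> n) TP)"
    then have x: "x \<in> ideal_smult R (J [^]\<^bsub>ideals_set R\<^esub> n) TP" if "n \<ge> 1" for n :: nat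
      using that by blast
    have "x \<in> carrier TP" using x[of 1] T.submoduleE(1)[OF sub[of 1]] by blast
    then obtain c where c: "x = cls c" "Poly_Mapping.keys c \<subseteq> carrier M \<times> carrier N"
      unfolding carrier_TP by blast
    have "finite (fst ` Poly_Mapping.keys c)" "fst ` Poly_Mapping.keys c \<subseteq> carrier M"
      using c(2) by auto
    from retr[OF this] obtain S f where Sf: "tensor_retraction R M N S f"
        "fst ` Poly_Mapping.keys c \<subseteq> S" "\<forall>x\<in>S. f x = x"
        "adically_separated R J (tensor_product R (M\<lparr>carrier := S\<rparr>) N)" by blast
    interpret tr: tensor_retraction R M N S f by (rule Sf(1))
    have cS: "Poly_Mapping.keys c \<subseteq> S \<times> carrier N"
      using Sf(2) c(2) by (auto simp: image_subset_iff subset_iff)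
    have "tr.T'.cls (tr.fmap c) \<in> ideal_smult R (J [^]\<^bsub>ideals_set R\<^esub> n) tr.TP'" if "n \<ge> 1" for n :: nat
      by (rule tr.fmap_ideal_smult[OF J]) (use x[OF that] c(1) in simp)
    then have "tr.T'.cls (tr.fmap c) \<in> {\<zero>\<^bsub>tr.TP'\<^esub>}"
      using Sf(4) unfolding adically_separated_def by auto
    then have "tr.T'.cls (tr.fmap c) = \<zero>\<^bsub>tr.TP'\<^esub>" by simp
    from tr.cls_zero_of_retract[OF cS _ this] have "cls c = \<zero>\<^bsub>TP\<^esub>" using Sf(3) by blast
    then show "x \<in> {\<zero>\<^bsub>TP\<^esub>}" using c(1) by simp
  qed
qed

section \<open>Integral elements over a noetherian ring\<close>

text \<open>
  The whole field as a module over \<open>R\<close>, in which integral closures and subfields are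
  submodules.
\<close>

definition restrict_scalars :: "('b, 'l) ring_scheme \<Rightarrow> ('a \<Rightarrow> 'b) \<Rightarrow> ('a, 'b) module" where
  "restrict_scalars L \<phi> = \<lparr>carrier = carrier L, monoid.mult = monoid.mult L, one = one L,
     ring.zero = \<zero>\<^bsub>L\<^esub>, add = add L, module.smult = (\<lambda>a x. \<phi> a \<otimes>\<^bsub>L\<^esub> x)\<rparr>"

lemma restrict_scalars_simps [simp]:
  "carrier (restrict_scalars L \<phi>) = carrier L" "add (restrict_scalars L \<phi>) = add L"
  "\<zero>\<^bsub>restrict_scalars L \<phi>\<^esub> = \<zero>\<^bsub>L\<^esub>" "a \<odot>\<^bsub>restrict_scalars L \<phi>\<^esub> x = \<phi> a \<otimes>\<^bsub>L\<^esub> x"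
  by (simp_all add: restrict_scalars_def)

lemma restrict_scalars_module:
  assumes "cring R" "cring L" "\<phi> \<in> ring_hom R L"
  shows "module R (restrict_scalars L \<phi>)"
proof -
  interpret R: cring R by fact
  interpret L: cring L by fact
  note h = ring_hom_memE[OF assms(3)]
  show ?thesis
  proof (rule moduleI)
    show "abelian_group (restrict_scalars L \<phi>)"
    proof (rule abelian_groupI)
      show "\<exists>y\<in>carrier (restrict_scalars L \<phi>). y \<oplus>\<^bsub>restrict_scalars L \<phi>\<^esub> x = \<zero>\<^bsub>restrict_scalars L \<phi>\<^esub>"
        if "x \<in> carrier (restrict_scalars L \<phi>)" for x
        using that by (auto intro!: bexI[of _ "\<ominus>\<^bsub>L\<^esub> x"] L.l_neg)
    qed (auto simp: L.a_ac)
  qed (auto simp: assms(1) L.l_distr L.r_distr L.m_assoc h)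
qed

lemma integral_closure_module_eq:
  "integral_closure_module R L \<phi> =
    (restrict_scalars L \<phi>)\<lparr>carrier := integral_closure L (\<phi> ` carrier R)\<rparr>"
  by (simp add: integral_closure_module_def restrict_scalars_def)

locale noetherian_extension = field L for L (structure) +
  fixes R and \<phi>
  assumes R_cring: "cring R" and R_noeth: "noetherian_ring R" and \<phi>_hom: "\<phi> \<in> ring_hom R L"
begin

abbreviation RS where "RS \<equiv> restrict_scalars L \<phi>"
abbreviation A where "A \<equiv> \<phi> ` carrier R"
abbreviation T where "T \<equiv> integral_closure L A"

lemma phi_hom_ring: "ring_hom_ring R L \<phi>"
  using R_cring \<phi>_hom by (intro ring_hom_ringI2) (auto simp: cring_def ring_axioms)

lemma phi_simps [simp]:
  "a \<in> carrier R \<Longrightarrow> \<phi> a \<in> carrier L"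
  "a \<in> carrier R \<Longrightarrow> b \<in> carrier R \<Longrightarrow> \<phi> (a \<oplus>\<^bsub>R\<^esub> b) = \<phi> a \<oplus> \<phi> b"
  "a \<in> carrier R \<Longrightarrow> b \<in> carrier R \<Longrightarrow> \<phi> (a \<otimes>\<^bsub>R\<^esub> b) = \<phi> a \<otimes> \<phi> b"
  "\<phi> \<one>\<^bsub>R\<^esub> = \<one>"
  using ring_hom_memE[OF \<phi>_hom] by auto

lemma A_subring: "subring A L"
proof -
  interpret h: ring_hom_ring R L \<phi> by (rule phi_hom_ring)
  show ?thesis using h.img_is_subring[OF h.R.carrier_is_subring] .
qed

lemma A_carrier: "A \<subseteq> carrier L" by auto

lemma RS_module: "module R RS"
  using restrict_scalars_module[OF R_cring is_cring \<phi>_hom] .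

sublocale RS: module R RS by (rule RS_module)

abbreviation span where "span \<equiv> module_span R RS"

abbreviation powers where "powers x n \<equiv> {x [^] i | i::nat. i < n}"

lemma powers_carrier: "x \<in> carrier L \<Longrightarrow> powers x n \<subseteq> carrier RS" by auto

lemma RS_smult_mem: "submodule N R RS \<Longrightarrow> a \<in> A \<Longrightarrow> m \<in> N \<Longrightarrow> a \<otimes> m \<in> N"
  using RS.submoduleE(4)[of N] by auto

lemma eval_mem_span:
  assumes x: "x \<in> carrier L"
  shows "set q \<subseteq> A \<Longrightarrow> eval q x \<in> span (powers x (length q))"
proof (induction q)
  case Nil
  show ?case using RS.submodule_zero[OF RS.submodule_span[of "{}"]] by simp
next
  case (Cons a q)
  let ?N = "span (powers x (length (a # q)))"
  have N: "submodule ?N R RS" by (rule RS.submodule_span[OF powers_carrier[OF x]])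
  have "span (powers x (length q)) \<subseteq> ?N"
    by (rule RS.span_least[OF N]) (use RS.span_superset[of "powers x (length (a # q))"] in force)
  then have 1: "eval q x \<in> ?N" using Cons by auto
  have "x [^] length q \<in> ?N" using RS.span_superset[of "powers x (length (a # q))"] by force
  then have "a \<otimes> x [^] length q \<in> ?N" using RS_smult_mem[OF N] Cons.prems by simp
  then show ?case using RS.submoduleE(5)[OF N _ 1] by simp
qed

lemma span_powers_eval:
  assumes x: "x \<in> carrier L"
  shows "y \<in> span (powers x n) \<Longrightarrow> \<exists>q. set q \<subseteq> A \<and> length q = n \<and> y = eval q x"
proof (induction n arbitrary: y)
  case 0
  have "span (powers x 0) \<subseteq> {\<zero>}"
    using RS.span_least[OF RS.submodule_single_zero, of "{}"] by simp
  then show ?case using 0 by auto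
next
  case (Suc n)
  have eq: "powers x (Suc n) = insert (x [^] n) (powers x n)" by (auto simp: less_Suc_eq)
  have "x [^] n \<in> carrier RS" using x by simp
  from Suc.prems[unfolded eq] RS.span_insert_subset[OF this powers_carrier[OF x]]
  obtain a z where az: "a \<in> carrier R" "z \<in> span (powers x n)" "y = \<phi> a \<otimes> x [^] n \<oplus> z"
    by (simp, blast)
  from Suc.IH[OF az(2)] obtain q where q: "set q \<subseteq> A" "length q = n" "z = eval q x" by blast
  show ?case by (rule exI[of _ "\<phi> a # q"]) (use az q in auto)
qed

lemma eval_map_uminus:
  assumes "set q \<subseteq> carrier L" "x \<in> carrier L"
  shows "eval (map (\<lambda>a. \<ominus> a) q) x = \<ominus> eval q x"
  using assms(1) by (induction q) (use assms(2) in \<open>auto simp: l_minus minus_add eval_in_carrier\<close>)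

text \<open>
  In this form, a monic equation of degree \<open>n\<close> becomes a statement on submodules, to which the
  chain condition applies.
\<close>

lemma integral_iff:
  "x \<in> T \<longleftrightarrow> x \<in> carrier L \<and> (\<exists>n. x [^] n \<in> span (powers x n))"
proof (intro iffI conjI)
  assume "x \<in> T"
  then obtain p where x: "x \<in> carrier L" and p: "p \<in> carrier (A[X])" "p \<noteq> []"
      "hd p = \<one>" "eval p x = \<zero>" unfolding integral_closure_def by blast
  show "x \<in> carrier L" by (rule x)
  obtain q where q: "p = \<one> # q" using p(2,3) by (cases p) auto
  have qA: "set q \<subseteq> A" using p(1) unfolding q univ_poly_carrier[symmetric] polynomial_def by auto
  have qc: "eval q x \<in> carrier L" using qA x A_carrier by (intro eval_in_carrier) auto
  have N: "submodule (span (powers x (length q))) R RS"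
    by (rule RS.submodule_span[OF powers_carrier[OF x]])
  have "x [^] length q \<oplus> eval q x = \<zero>" using p(4) x unfolding q by simp
  then have "x [^] length q = \<ominus> eval q x" using qc x minus_equality[symmetric] by blast
  then have "x [^] length q = \<phi> (\<ominus>\<^bsub>R\<^esub> \<one>\<^bsub>R\<^esub>) \<otimes> eval q x"
  proof -
    interpret h: ring_hom_ring R L \<phi> by (rule phi_hom_ring)
    assume "x [^] length q = \<ominus> eval q x"
    then show ?thesis using qc by (simp add: l_minus)
  qed
  moreover have "\<phi> (\<ominus>\<^bsub>R\<^esub> \<one>\<^bsub>R\<^esub>) \<in> A"
    using R_cring by (simp add: cring.cring_simprules)
  ultimately have "x [^] length q \<in> span (powers x (length q))"
    using RS_smult_mem[OF N _ eval_mem_span[OF x qA]] by simp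
  then show "\<exists>n. x [^] n \<in> span (powers x n)" by blast
next
  assume "x \<in> carrier L \<and> (\<exists>n. x [^] n \<in> span (powers x n))"
  then obtain n where x: "x \<in> carrier L" and n: "x [^] n \<in> span (powers x n)" by blast
  from span_powers_eval[OF x n] obtain q where q: "set q \<subseteq> A" "length q = n" "x [^] n = eval q x"
    by blast
  let ?p = "\<one> # map (\<lambda>a. \<ominus> a) q"
  have "set (map (\<lambda>a. \<ominus> a) q) \<subseteq> A" using q(1) subringE(5)[OF A_subring] by auto
  then have "?p \<in> carrier (A[X])" unfolding univ_poly_carrier[symmetric] polynomial_def
    using subringE(3)[OF A_subring] by simp
  moreover have "eval q x \<in> carrier L" using x q(3) by (metis nat_pow_closed)
  then have "eval ?p x = \<zero>"
    using x q eval_map_uminus[of q x] A_carrier by (simp add: subset_trans[OF q(1)] r_neg)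
  ultimately show "x \<in> T" unfolding integral_closure_def using x by force
qed

text \<open>
  The spans of \<open>1, s, \<dots>, s\<^sup>n\<^sup>-\<^sup>1\<close> increase inside a finite module, so they stabilise and some
  \<open>s\<^sup>n\<close> is a combination of lower powers.
\<close>

lemma integral_of_stable:
  assumes G: "finite G" "G \<subseteq> carrier L" and one: "\<one> \<in> span G" and s: "s \<in> carrier L"
    and st: "\<And>y. y \<in> span G \<Longrightarrow> s \<otimes> y \<in> span G"
  shows "s \<in> T"
proof -
  have "s [^] n \<in> span G" for n :: nat
  proof (induction n)
    case (Suc n)
    then show ?case using st[OF Suc] s m_comm[of s "s [^] n"] by simp
  qed (use one in simp)
  then have sub: "powers s n \<subseteq> span G" for n by blast
  have G': "G \<subseteq> carrier RS" using G by simp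
  have "\<exists>n. \<forall>k\<ge>n. span (powers s k) = span (powers s n)"
  proof (rule RS.submodule_sequence_stabilises[OF R_noeth G(1) G'])
    show sm: "submodule (span (powers s n)) R RS" for n
      by (rule RS.submodule_span[OF powers_carrier[OF s]])
    show "span (powers s n) \<subseteq> span (powers s (Suc n))" for n
      by (rule RS.span_least[OF sm]) (use RS.span_superset[of "powers s (Suc n)"] in force)
    show "span (powers s n) \<subseteq> span G" for n
      by (rule RS.span_least[OF RS.submodule_span[OF G'] sub])
  qed
  then obtain n where n: "\<forall>k\<ge>n. span (powers s k) = span (powers s n)" by blast
  have "s [^] n \<in> span (powers s (Suc n))" using RS.span_superset[of "powers s (Suc n)"] by force
  also have "span (powers s (Suc n)) = span (powers s n)" by (rule n[rule_format]) simp
  finally show ?thesis unfolding integral_iff using s by blast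
qed

lemma submodule_vimage_mult:
  assumes N: "submodule N R RS" and x: "x \<in> carrier L"
  shows "submodule {y \<in> carrier L. x \<otimes> y \<in> N} R RS" (is "submodule ?S R RS")
proof (rule RS.submodule_criterion)
  note N' = RS.submoduleE[OF N]
  show "\<zero>\<^bsub>RS\<^esub> \<in> ?S" using RS.submodule_zero[OF N] x by simp
  show "y \<oplus>\<^bsub>RS\<^esub> z \<in> ?S"
    if "y \<in> ?S" "z \<in> ?S" for y z
    using that x N'(5)[of "x \<otimes> y" "x \<otimes> z"] by (simp add: r_distr)
  show "a \<odot>\<^bsub>RS\<^esub> y \<in> ?S"
    if "a \<in> carrier R" "y \<in> ?S" for a y
    using that x N'(4)[of a "x \<otimes> y"] m_lcomm[of x "\<phi> a" y] by simp
qed auto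

abbreviation biprod where "biprod x y p q \<equiv> {x [^] i \<otimes> y [^] j | (i::nat) (j::nat). i < p \<and> j < q}"

text \<open>
  Multiplication by \<open>x\<close> shifts the exponent \<open>i\<close>, and the power \<open>x\<^sup>p\<close> which arises from
  \<open>i = p - 1\<close> is replaced with lower ones.
\<close>

lemma biprod_stable:
  assumes x: "x \<in> carrier L" "x [^] p \<in> span (powers x p)" and y: "y \<in> carrier L"
    and z: "z \<in> span (biprod x y p q)"
  shows "x \<otimes> z \<in> span (biprod x y p q)"
proof -
  let ?G = "biprod x y p q"
  have G: "?G \<subseteq> carrier RS" using x y by auto
  have N: "submodule (span ?G) R RS" by (rule RS.submodule_span[OF G])
  have "span ?G \<subseteq> {z \<in> carrier L. x \<otimes> z \<in> span ?G}"
  proof (rule RS.span_least[OF submodule_vimage_mult[OF N x(1)]], rule subsetI)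
    fix g assume "g \<in> ?G"
    then obtain i j :: nat where ij: "i < p" "j < q" "g = x [^] i \<otimes> y [^] j" by blast
    have gc: "g \<in> carrier L" using ij x y by simp
    have xg: "x \<otimes> g = x [^] Suc i \<otimes> y [^] j" using ij x y by (simp add: m_ac)
    show "g \<in> {z \<in> carrier L. x \<otimes> z \<in> span ?G}"
    proof (cases "Suc i < p")
      case True
      then have "x \<otimes> g \<in> ?G" using xg ij by blast
      then show ?thesis using gc subsetD[OF RS.span_superset[of ?G]] by simp
    next
      case False
      then have p: "p = Suc i" using ij by simp
      have "span (powers x p) \<subseteq> {u \<in> carrier L. y [^] j \<otimes> u \<in> span ?G}"
      proof (rule RS.span_least[OF submodule_vimage_mult[OF N]], rule nat_pow_closed[OF y], rule subsetI)
        fix u assume "u \<in> powers x p"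
        then obtain k where k: "k < p" "u = x [^] k" by blast
        then have "y [^] j \<otimes> u = x [^] k \<otimes> y [^] j" using x y by (simp add: m_comm)
        then have "y [^] j \<otimes> u \<in> ?G" using k(1) ij(2) by blast
        then show "u \<in> {u \<in> carrier L. y [^] j \<otimes> u \<in> span ?G}"
          using k x subsetD[OF RS.span_superset[of ?G]] by simp
      qed
      then have "y [^] j \<otimes> x [^] p \<in> span ?G" using x(2) by blast
      moreover have "y [^] j \<otimes> x [^] p = x \<otimes> g" unfolding xg p using x y by (simp add: m_comm)
      ultimately show ?thesis using gc by simp
    qed
  qed
  then show ?thesis using z by blast
qed

text \<open>
  Both \<open>x + y\<close> and \<open>x y\<close> stabilise the finite module spanned by the \<open>x\<^sup>i y\<^sup>j\<close> with \<open>i < p\<close> and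
  \<open>j < q\<close>, where \<open>p\<close> and \<open>q\<close> are degrees of monic equations of \<open>x\<close> and \<open>y\<close>.
\<close>

lemma integral_add_mult:
  assumes x: "x \<in> T" and y: "y \<in> T"
  shows "x \<oplus> y \<in> T" "x \<otimes> y \<in> T"
proof -
  from x obtain p where p: "x \<in> carrier L" "x [^] p \<in> span (powers x p)" unfolding integral_iff by blast
  from y obtain q where q: "y \<in> carrier L" "y [^] q \<in> span (powers y q)" unfolding integral_iff by blast
  have pos: "n > 0" if "u \<in> carrier L" "u [^] n \<in> span (powers u n)" for u and n :: nat
  proof (rule ccontr)
    assume "\<not> n > 0"
    then have "\<one> \<in> span (powers u 0)" using that by simp
    also have "span (powers u 0) \<subseteq> {\<zero>}"
      using RS.span_least[OF RS.submodule_single_zero, of "{}"] by simp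
    finally show False by simp
  qed
  let ?G = "biprod x y p q"
  have "?G = (\<lambda>(i, j). x [^] i \<otimes> y [^] j) ` ({..<p} \<times> {..<q})" by auto
  then have fin: "finite ?G" by simp
  have G: "?G \<subseteq> carrier L" using p q by auto
  then have G': "?G \<subseteq> carrier RS" by simp
  have N: "submodule (span ?G) R RS" by (rule RS.submodule_span[OF G'])
  have sub: "span ?G \<subseteq> carrier L" using RS.span_in_carrier[OF G'] by simp
  have xs: "x \<otimes> z \<in> span ?G" if "z \<in> span ?G" for z
    using biprod_stable[OF p q(1) that] .
  have Gs: "biprod y x q p = ?G" using p(1) q(1)
    by (auto; metis (no_types, lifting) m_comm nat_pow_closed)
  have ys: "y \<otimes> z \<in> span ?G" if "z \<in> span ?G" for z
    using biprod_stable[OF q p(1), of z p] that unfolding Gs by blast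
  have "x [^] (0::nat) \<otimes> y [^] (0::nat) \<in> ?G" using pos[OF p] pos[OF q] by blast
  then have one: "\<one> \<in> span ?G" using RS.span_superset[of ?G] by auto
  show "x \<oplus> y \<in> T"
  proof (rule integral_of_stable[OF fin G one])
    fix z assume z: "z \<in> span ?G"
    then have "(x \<oplus> y) \<otimes> z = x \<otimes> z \<oplus> y \<otimes> z" using p q sub by (auto simp: l_distr)
    then show "(x \<oplus> y) \<otimes> z \<in> span ?G" using RS.submoduleE(5)[OF N xs[OF z] ys[OF z]] by simp
  qed (use p q in simp)
  show "x \<otimes> y \<in> T"
  proof (rule integral_of_stable[OF fin G one])
    fix z assume z: "z \<in> span ?G"
    then have "(x \<otimes> y) \<otimes> z = x \<otimes> (y \<otimes> z)" using p q sub by (auto simp: m_assoc)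
    then show "(x \<otimes> y) \<otimes> z \<in> span ?G" using xs[OF ys[OF z]] by simp
  qed (use p q in simp)
qed

lemma A_integral: "a \<in> A \<Longrightarrow> a \<in> T"
proof -
  assume a: "a \<in> A"
  then have ac: "a \<in> carrier L" using A_carrier by blast
  have "submodule (span (powers a 1)) R RS" by (rule RS.submodule_span[OF powers_carrier[OF ac]])
  moreover have "\<one> \<in> span (powers a 1)" using RS.span_superset[of "powers a 1"] by force
  ultimately have "a \<otimes> \<one> \<in> span (powers a 1)" using RS_smult_mem a by blast
  then have "a [^] (1::nat) \<in> span (powers a 1)" using ac by simp
  then show ?thesis unfolding integral_iff using ac by blast
qed

lemma T_carrier: "T \<subseteq> carrier L" unfolding integral_closure_def by blast

lemma T_subring: "subring T L"
proof (rule subringI[OF T_carrier])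
  show "\<one> \<in> T" by (rule A_integral[OF subringE(3)[OF A_subring]])
  have m1: "\<ominus> \<one> \<in> T" by (rule A_integral) (rule subringE(5)[OF A_subring subringE(3)[OF A_subring]])
  show "\<ominus> h \<in> T" if "h \<in> T" for h
  proof -
    have "\<ominus> h = \<ominus> \<one> \<otimes> h" using that T_carrier by (auto simp: l_minus)
    then show ?thesis using integral_add_mult(2)[OF m1 that] by simp
  qed
qed (use integral_add_mult in auto)

lemma submodule_of_subset:
  assumes "subring E L" "A \<subseteq> E"
  shows "submodule E R RS"
proof (rule RS.submodule_criterion)
  note E = subringE[OF assms(1)]
  show "E \<subseteq> carrier RS" "\<zero>\<^bsub>RS\<^esub> \<in> E" using E by auto
  show "\<And>a b. a \<in> E \<Longrightarrow> b \<in> E \<Longrightarrow> a \<oplus>\<^bsub>RS\<^esub> b \<in> E" using E(7) by simp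
  show "a \<odot>\<^bsub>RS\<^esub> x \<in> E" if "a \<in> carrier R" "x \<in> E" for a x using that E(6) assms(2) by auto
qed

text \<open>
  Since \<open>\<psi>\<close> fixes the coefficients of a monic equation of \<open>x\<close>, it maps it to the same equation
  for \<open>\<psi> x\<close>.
\<close>

lemma integral_hom:
  assumes E: "subring E L" "A \<subseteq> E" and \<psi>: "\<psi> \<in> ring_hom (L\<lparr>carrier := E\<rparr>) L"
    and fixA: "\<And>a. a \<in> A \<Longrightarrow> \<psi> a = a" and x: "x \<in> T" "x \<in> E"
  shows "\<psi> x \<in> T"
proof -
  interpret h: ring_hom_ring "L\<lparr>carrier := E\<rparr>" L \<psi>
    by (rule ring_hom_ringI2[OF subring_is_ring[OF E(1)] ring_axioms \<psi>])
  from x obtain p where p: "p \<in> carrier (A[X])" "p \<noteq> []"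
      "hd p = \<one>" "eval p x = \<zero>" unfolding integral_closure_def by blast
  have pA: "set p \<subseteq> A" using p(1) unfolding univ_poly_carrier[symmetric] polynomial_def by auto
  have "map \<psi> p = p" by (rule map_idI) (use pA fixA in auto)
  moreover have "eval (map \<psi> p) (\<psi> x) = \<psi> (h.R.eval p x)"
    by (rule h.eval_hom'[symmetric]) (use pA E x in auto)
  moreover have "h.R.eval p x = eval p x" using eval_consistent[OF E(1)] by simp
  moreover have "\<psi> \<zero> = \<zero>" using h.hom_zero by simp
  ultimately have "eval p (\<psi> x) = \<zero>" using p(4) by simp
  moreover have "\<psi> x \<in> carrier L" using h.hom_closed x(2) by simp
  ultimately show ?thesis unfolding integral_closure_def using p(1-3) by blast
qed

end

section \<open>Normalised traces and retractions\<close>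

text \<open>
  The coefficient of \<open>X\<^sup>n\<^sup>-\<^sup>k\<close> in the product of the \<open>X - b\<close> over the \<open>n\<close> entries \<open>b\<close> of the list.
  Counting from the leading term agrees with the order of coefficients in polynomials as
  lists.
\<close>

primrec (in ring) root_coeff :: "'a list \<Rightarrow> nat \<Rightarrow> 'a" where
  "root_coeff [] k = (if k = 0 then \<one> else \<zero>)"
| "root_coeff (b # bs) k = root_coeff bs k \<ominus> b \<otimes> (case k of 0 \<Rightarrow> \<zero> | Suc j \<Rightarrow> root_coeff bs j)"

text \<open>
  Summing over a list counts multiple roots with their multiplicities.
\<close>

definition (in ring) lsum :: "('c \<Rightarrow> 'a) \<Rightarrow> 'c list \<Rightarrow> 'a" where
  "lsum f bs = foldr (\<lambda>b s. f b \<oplus> s) bs \<zero>"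

text \<open>
  Synthetic division: if \<open>c\<close> lists the coefficients of \<open>f\<close> from the leading one on and \<open>b\<close> is a
  root of \<open>f\<close>, then \<open>synth c b\<close> lists those of \<open>f / (X - b)\<close>.
\<close>

primrec (in ring) synth :: "(nat \<Rightarrow> 'a) \<Rightarrow> 'a \<Rightarrow> nat \<Rightarrow> 'a" where
  "synth c b 0 = c 0"
| "synth c b (Suc k) = c (Suc k) \<oplus> b \<otimes> synth c b k"

context cring
begin

lemma lsum_simps [simp]: "lsum f [] = \<zero>" "lsum f (b # bs) = f b \<oplus> lsum f bs"
  by (simp_all add: lsum_def)

lemma lsum_closed: "(\<And>b. b \<in> set bs \<Longrightarrow> f b \<in> carrier R) \<Longrightarrow> lsum f bs \<in> carrier R"
  by (induction bs) auto

lemma lsum_mem: "subring K R \<Longrightarrow> (\<And>b. b \<in> set bs \<Longrightarrow> f b \<in> K) \<Longrightarrow> lsum f bs \<in> K"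
  by (induction bs) (auto simp: subringE)

lemma lsum_cong: "(\<And>b. b \<in> set bs \<Longrightarrow> f b = g b) \<Longrightarrow> lsum f bs = lsum g bs"
  by (induction bs) auto

lemma lsum_add:
  "(\<And>b. b \<in> set bs \<Longrightarrow> f b \<in> carrier R \<and> g b \<in> carrier R) \<Longrightarrow>
    lsum (\<lambda>b. f b \<oplus> g b) bs = lsum f bs \<oplus> lsum g bs"
  by (induction bs) (auto simp: lsum_closed a_ac)

lemma lsum_scale:
  "(\<And>b. b \<in> set bs \<Longrightarrow> f b \<in> carrier R) \<Longrightarrow> a \<in> carrier R \<Longrightarrow>
    lsum (\<lambda>b. a \<otimes> f b) bs = a \<otimes> lsum f bs"
  by (induction bs) (auto simp: lsum_closed r_distr)

lemma lsum_const: "a \<in> carrier R \<Longrightarrow> lsum (\<lambda>b. a) bs = [length bs] \<cdot> \<one> \<otimes> a"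
  by (induction bs) (auto simp: l_distr a_comm)

lemma lsum_diff_scale:
  assumes "\<And>b. b \<in> set bs \<Longrightarrow> f b \<in> carrier R" "\<And>b. b \<in> set bs \<Longrightarrow> g b \<in> carrier R" "a \<in> carrier R"
  shows "lsum (\<lambda>b. f b \<ominus> a \<otimes> g b) bs = lsum f bs \<ominus> a \<otimes> lsum g bs"
proof -
  have "lsum (\<lambda>b. f b \<ominus> a \<otimes> g b) bs = lsum (\<lambda>b. f b \<oplus> (\<ominus> a) \<otimes> g b) bs"
    by (rule lsum_cong) (use assms in \<open>simp add: a_minus_def l_minus\<close>)
  also have "\<dots> = lsum f bs \<oplus> (\<ominus> a) \<otimes> lsum g bs"
    using assms by (simp add: lsum_add lsum_scale)
  also have "\<dots> = lsum f bs \<ominus> a \<otimes> lsum g bs"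
    using assms by (simp add: a_minus_def l_minus lsum_closed)
  finally show ?thesis .
qed

lemma root_coeff_closed: "set bs \<subseteq> carrier R \<Longrightarrow> root_coeff bs k \<in> carrier R"
  by (induction bs arbitrary: k) (auto split: nat.split)

lemma root_coeff_0: "set bs \<subseteq> carrier R \<Longrightarrow> root_coeff bs 0 = \<one>"
  by (induction bs) (auto simp: a_minus_def)

lemma root_coeff_beyond: "set bs \<subseteq> carrier R \<Longrightarrow> length bs < k \<Longrightarrow> root_coeff bs k = \<zero>"
  by (induction bs arbitrary: k) (auto split: nat.split simp: a_minus_def)

lemma synth_closed: "(\<And>k. c k \<in> carrier R) \<Longrightarrow> b \<in> carrier R \<Longrightarrow> synth c b k \<in> carrier R"
  by (induction k) auto

text \<open>
  Multiplying \<open>f\<close> by \<open>X - a\<close> multiplies \<open>f / (X - b)\<close> by \<open>X - a\<close>.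
\<close>

lemma synth_add_root:
  assumes bs: "set bs \<subseteq> carrier R" and a: "a \<in> carrier R" and b: "b \<in> carrier R"
  shows "synth (root_coeff (a # bs)) b (Suc k)
    = synth (root_coeff bs) b (Suc k) \<ominus> a \<otimes> synth (root_coeff bs) b k"
proof (induction k)
  case 0
  have c: "root_coeff bs j \<in> carrier R" for j by (rule root_coeff_closed[OF bs])
  have "root_coeff bs (Suc 0) \<ominus> a \<otimes> root_coeff bs 0 \<oplus> b \<otimes> root_coeff bs 0
      = root_coeff bs (Suc 0) \<oplus> b \<otimes> root_coeff bs 0 \<ominus> a \<otimes> root_coeff bs 0"
    using c[of 0] c[of "Suc 0"] a b by algebra
  then show ?case using c a by (simp add: a_minus_def)
next
  case (Suc k)
  let ?c = "root_coeff bs" and ?s = "synth (root_coeff bs) b"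
  have c: "?c j \<in> carrier R" for j by (rule root_coeff_closed[OF bs])
  have s: "?s j \<in> carrier R" for j by (rule synth_closed[OF c b])
  have "?c (Suc (Suc k)) \<ominus> a \<otimes> ?c (Suc k) \<oplus> b \<otimes> (?s (Suc k) \<ominus> a \<otimes> ?s k)
    = ?c (Suc (Suc k)) \<oplus> b \<otimes> ?s (Suc k) \<ominus> a \<otimes> (?c (Suc k) \<oplus> b \<otimes> ?s k)"
    using c[of "Suc k"] c[of "Suc (Suc k)"] s[of k] s[of "Suc k"] a b by algebra
  then show ?case using Suc by simp
qed

text \<open>
  The quotient of \<open>(X - a) f\<close> by \<open>X - a\<close> is \<open>f\<close>.
\<close>

lemma synth_new_root:
  assumes bs: "set bs \<subseteq> carrier R" and a: "a \<in> carrier R"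
  shows "synth (root_coeff (a # bs)) a k = root_coeff bs k"
proof (induction k)
  case 0
  show ?case using a root_coeff_closed[OF bs, of 0] by (simp add: a_minus_def)
next
  case (Suc k)
  have c: "root_coeff bs j \<in> carrier R" for j by (rule root_coeff_closed[OF bs])
  have "root_coeff bs (Suc k) \<ominus> a \<otimes> root_coeff bs k \<oplus> a \<otimes> root_coeff bs k = root_coeff bs (Suc k)"
    using c[of k] c[of "Suc k"] a by algebra
  then show ?case using Suc by simp
qed

text \<open>
  The sum of the \<open>f / (X - b)\<close> over the roots \<open>b\<close> of \<open>f\<close> is the derivative of \<open>f\<close>, whose
  coefficient at position \<open>k\<close> is \<open>n - k\<close> times that of \<open>f\<close>, where \<open>n\<close> is the degree. The term
  with \<open>k\<close> stands on the left to avoid subtraction of natural numbers.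
\<close>

lemma synth_sum:
  "set bs \<subseteq> carrier R \<Longrightarrow>
    lsum (\<lambda>b. synth (root_coeff bs) b k) bs \<oplus> ([k] \<cdot> \<one>) \<otimes> root_coeff bs k
      = ([length bs] \<cdot> \<one>) \<otimes> root_coeff bs k"
proof (induction bs arbitrary: k)
  case Nil
  show ?case by (cases k) auto
next
  case (Cons a bs)
  then have a: "a \<in> carrier R" and bs: "set bs \<subseteq> carrier R" by auto
  let ?c = "root_coeff bs" and ?s = "synth (root_coeff bs)"
  have c: "?c j \<in> carrier R" for j by (rule root_coeff_closed[OF bs])
  have s: "?s b j \<in> carrier R" if "b \<in> set bs" for b j
    by (rule synth_closed[OF c]) (use that bs in blast)
  let ?E = "\<lambda>j. lsum (\<lambda>b. ?s b j) bs"
  have E: "?E j \<in> carrier R" for j by (rule lsum_closed) (rule s)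
  let ?d = "[length bs] \<cdot> \<one>"
  have d: "?d \<in> carrier R" by simp
  show ?case
  proof (cases k)
    case 0
    have "lsum (\<lambda>b. synth (root_coeff (a # bs)) b 0) bs = ?E 0"
      by (rule lsum_cong) (use c a in \<open>simp add: a_minus_def\<close>)
    moreover have "?E 0 = ?d \<otimes> ?c 0" using Cons.IH[OF bs, of 0] c E[of 0] by simp
    ultimately show ?thesis unfolding 0 using c a d synth_new_root[OF bs a, of 0]
      by (simp add: a_minus_def l_distr a_comm)
  next
    case (Suc j)
    let ?j = "[j] \<cdot> \<one>"
    have j: "?j \<in> carrier R" by simp
    have 1: "lsum (\<lambda>b. synth (root_coeff (a # bs)) b (Suc j)) bs = ?E (Suc j) \<ominus> a \<otimes> ?E j"
    proof -
      have "lsum (\<lambda>b. synth (root_coeff (a # bs)) b (Suc j)) bs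
          = lsum (\<lambda>b. ?s b (Suc j) \<ominus> a \<otimes> ?s b j) bs"
        by (rule lsum_cong) (rule synth_add_root[OF bs a], use bs in blast)
      also have "\<dots> = ?E (Suc j) \<ominus> a \<otimes> ?E j"
        by (rule lsum_diff_scale) (use s a in \<open>auto simp del: synth.simps\<close>)
      finally show ?thesis .
    qed
    have aux1: "(c1 \<oplus> (e1 \<ominus> u \<otimes> e0)) \<oplus> (v \<oplus> \<one>) \<otimes> (c1 \<ominus> u \<otimes> c0)
       = c1 \<oplus> (e1 \<oplus> (v \<oplus> \<one>) \<otimes> c1) \<ominus> u \<otimes> (e0 \<oplus> v \<otimes> c0) \<ominus> u \<otimes> c0"
      if "c0 \<in> carrier R" "c1 \<in> carrier R" "e0 \<in> carrier R" "e1 \<in> carrier R" "u \<in> carrier R" "v \<in> carrier R"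
      for c0 c1 e0 e1 u v using that by algebra
    have aux2: "c1 \<oplus> v \<otimes> c1 \<ominus> u \<otimes> (v \<otimes> c0) \<ominus> u \<otimes> c0 = (v \<oplus> \<one>) \<otimes> (c1 \<ominus> u \<otimes> c0)"
      if "c0 \<in> carrier R" "c1 \<in> carrier R" "u \<in> carrier R" "v \<in> carrier R"
      for c0 c1 u v using that by algebra
    have IH1: "?E (Suc j) \<oplus> (?j \<oplus> \<one>) \<otimes> ?c (Suc j) = ?d \<otimes> ?c (Suc j)"
      using Cons.IH[OF bs, of "Suc j"] by (simp add: a_comm)
    have IH0: "?E j \<oplus> ?j \<otimes> ?c j = ?d \<otimes> ?c j" using Cons.IH[OF bs, of j] .
    have "(?c (Suc j) \<oplus> (?E (Suc j) \<ominus> a \<otimes> ?E j)) \<oplus> (?j \<oplus> \<one>) \<otimes> (?c (Suc j) \<ominus> a \<otimes> ?c j)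
       = ?c (Suc j) \<oplus> (?E (Suc j) \<oplus> (?j \<oplus> \<one>) \<otimes> ?c (Suc j)) \<ominus> a \<otimes> (?E j \<oplus> ?j \<otimes> ?c j) \<ominus> a \<otimes> ?c j"
      by (rule aux1) (use c E a j in \<open>auto simp del: synth.simps\<close>)
    also have "\<dots> = ?c (Suc j) \<oplus> ?d \<otimes> ?c (Suc j) \<ominus> a \<otimes> (?d \<otimes> ?c j) \<ominus> a \<otimes> ?c j"
      unfolding IH1 IH0 ..
    also have "\<dots> = (?d \<oplus> \<one>) \<otimes> (?c (Suc j) \<ominus> a \<otimes> ?c j)"
      by (rule aux2) (use c a d in auto)
    finally show ?thesis unfolding Suc lsum_simps synth_new_root[OF bs a] 1
      by (simp add: a_comm)
  qed
qed

text \<open>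
  A form of Newton's identities in which the induction is on \<open>n\<close> alone. Since
  \<open>b \<cdot> synth c b k\<close> is \<open>synth c b (k + 1) - c (k + 1)\<close> and \<open>synth c b 0 = 1\<close>, the sums for
  \<open>n + 1\<close> are combinations of sums for \<open>n\<close>; those for \<open>n = 0\<close> are given by \<open>synth_sum\<close>.
\<close>

lemma synth_power_sum_mem:
  assumes K: "subring K R" and bs: "set bs \<subseteq> carrier R" and cK: "\<And>k. root_coeff bs k \<in> K"
  shows "lsum (\<lambda>b. b [^] (n::nat) \<otimes> synth (root_coeff bs) b k) bs \<in> K"
proof (induction n arbitrary: k)
  case 0
  let ?c = "root_coeff bs"
  have c: "?c j \<in> carrier R" for j by (rule root_coeff_closed[OF bs])
  have s: "synth ?c b j \<in> carrier R" if "b \<in> set bs" for b j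
    by (rule synth_closed[OF c]) (use that bs in blast)
  let ?E = "lsum (\<lambda>b. synth ?c b k) bs"
  have E: "?E \<in> carrier R" by (rule lsum_closed) (rule s)
  have nK: "[m] \<cdot> \<one> \<in> K" for m :: nat
    by (induction m) (use subringE[OF K] in auto)
  have nc: "[m] \<cdot> \<one> \<otimes> ?c k \<in> K" for m :: nat by (intro subringE(6)[OF K] nK cK)
  have "?E = ?E \<oplus> [k] \<cdot> \<one> \<otimes> ?c k \<oplus> \<ominus> ([k] \<cdot> \<one> \<otimes> ?c k)"
    using E c by (simp add: a_assoc r_neg)
  also have "\<dots> \<in> K" unfolding synth_sum[OF bs] by (intro subringE(5,7)[OF K] nc)
  finally have "?E \<in> K" .
  moreover have "lsum (\<lambda>b. b [^] (0::nat) \<otimes> synth ?c b k) bs = ?E"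
    by (rule lsum_cong) (use s in simp)
  ultimately show ?case by simp
next
  case (Suc n)
  let ?c = "root_coeff bs"
  have c: "?c j \<in> carrier R" for j by (rule root_coeff_closed[OF bs])
  have b: "b \<in> carrier R" if "b \<in> set bs" for b using that bs by blast
  have s: "synth ?c b j \<in> carrier R" if "b \<in> set bs" for b j
    by (rule synth_closed[OF c b[OF that]])
  have "lsum (\<lambda>b. b [^] Suc n \<otimes> synth ?c b k) bs
      = lsum (\<lambda>b. b [^] n \<otimes> synth ?c b (Suc k) \<ominus> ?c (Suc k) \<otimes> (b [^] n \<otimes> synth ?c b 0)) bs"
  proof (rule lsum_cong)
    fix x assume x: "x \<in> set bs"
    have "x [^] n \<in> carrier R" using b[OF x] by simp
    then have "x [^] n \<otimes> x \<otimes> synth ?c x k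
       = x [^] n \<otimes> (?c (Suc k) \<oplus> x \<otimes> synth ?c x k) \<ominus> ?c (Suc k) \<otimes> (x [^] n \<otimes> \<one>)"
      using b[OF x] s[OF x, of k] c[of "Suc k"] by algebra
    then show "x [^] Suc n \<otimes> synth ?c x k
       = x [^] n \<otimes> synth ?c x (Suc k) \<ominus> ?c (Suc k) \<otimes> (x [^] n \<otimes> synth ?c x 0)"
      using root_coeff_0[OF bs] by simp
  qed
  also have "\<dots> = lsum (\<lambda>b. b [^] n \<otimes> synth ?c b (Suc k)) bs
      \<ominus> ?c (Suc k) \<otimes> lsum (\<lambda>b. b [^] n \<otimes> synth ?c b 0) bs"
    by (rule lsum_diff_scale) (use s b c in \<open>auto simp del: synth.simps\<close>)
  also have "\<dots> \<in> K" unfolding a_minus_def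
    by (intro subringE(5-7)[OF K] Suc.IH cK)
  finally show ?case .
qed

text \<open>
  The case \<open>k = 0\<close> of \<open>synth_power_sum_mem\<close> places the power sums of the roots in \<open>K\<close>, and a
  sum of values of \<open>g\<close> is a combination of power sums.
\<close>

lemma sum_eval_roots_mem:
  assumes K: "subring K R" and bs: "set bs \<subseteq> carrier R" and cK: "\<And>k. root_coeff bs k \<in> K"
  shows "set g \<subseteq> K \<Longrightarrow> lsum (eval g) bs \<in> K"
proof (induction g)
  case Nil
  then show ?case by (intro lsum_mem[OF K]) (simp add: subringE(2)[OF K])
next
  case (Cons a g)
  have b: "b \<in> carrier R" if "b \<in> set bs" for b using that bs by blast
  have a: "a \<in> K" "a \<in> carrier R" and g: "set g \<subseteq> K" "set g \<subseteq> carrier R"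
    using Cons.prems subringE(1)[OF K] by auto
  have "lsum (eval (a # g)) bs
      = lsum (\<lambda>b. a \<otimes> (b [^] length g \<otimes> synth (root_coeff bs) b 0) \<oplus> eval g b) bs"
    by (rule lsum_cong) (use root_coeff_0[OF bs] b in simp)
  also have "\<dots> = a \<otimes> lsum (\<lambda>b. b [^] length g \<otimes> synth (root_coeff bs) b 0) bs \<oplus> lsum (eval g) bs"
    using a b g root_coeff_closed[OF bs] by (subst lsum_add) (auto simp: lsum_scale eval_in_carrier)
  also have "\<dots> \<in> K" by (intro subringE(6,7)[OF K] a Cons.IH[OF g(1)] synth_power_sum_mem[OF K bs cK])
  finally show ?case .
qed

end

context domain
begin

lemma poly_mult_monic_linear:
  assumes a: "a \<in> carrier R" and q: "set q \<subseteq> carrier R" "q \<noteq> []" "hd q = \<one>"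
  shows "poly_mult [\<one>, \<ominus> a] q = map2 (\<oplus>) (q @ [\<zero>]) (\<zero> # map (\<lambda>c. \<ominus> a \<otimes> c) q)"
proof -
  let ?m = "map (\<lambda>c. \<ominus> a \<otimes> c) q"
  have m: "set ?m \<subseteq> carrier R" using a q by auto
  have id: "map ((\<otimes>) \<one>) q = q" by (rule map_idI) (use q in auto)
  have "poly_mult [\<ominus> a] q = poly_add ?m []" by simp
  also have "\<dots> = normalize ?m" by (rule poly_add_zero'(1)[OF m])
  finally have 1: "poly_mult [\<ominus> a] q = normalize ?m" .
  have "poly_mult [\<one>, \<ominus> a] q = poly_add (q @ [\<zero>]) (normalize ?m)"
    using 1 id by simp
  also have "\<dots> = poly_add (q @ [\<zero>]) ?m"
    by (rule poly_add_normalize(2)[symmetric]) (use q m in auto)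
  also have "\<dots> = normalize (map2 (\<oplus>) (q @ [\<zero>]) (\<zero> # ?m))"
    by simp
  also have "\<dots> = map2 (\<oplus>) (q @ [\<zero>]) (\<zero> # ?m)"
  proof -
    obtain q' where "q = \<one> # q'" using q by (cases q) auto
    then show ?thesis by simp
  qed
  finally show ?thesis .
qed

lemma poly_mult_root_coeff:
  assumes a: "a \<in> carrier R" and bs: "set bs \<subseteq> carrier R"
  shows "poly_mult [\<one>, \<ominus> a] (map (root_coeff bs) [0..<Suc (length bs)])
    = map (root_coeff (a # bs)) [0..<Suc (length (a # bs))]"
proof -
  let ?c = "root_coeff bs" and ?q = "map (root_coeff bs) [0..<Suc (length bs)]"
  have c: "?c j \<in> carrier R" for j by (rule root_coeff_closed[OF bs])
  have "poly_mult [\<one>, \<ominus> a] ?q = map2 (\<oplus>) (?q @ [\<zero>]) (\<zero> # map (\<lambda>c. \<ominus> a \<otimes> c) ?q)"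
    by (rule poly_mult_monic_linear[OF a])
       (use c root_coeff_0[OF bs] in \<open>auto simp: hd_map simp del: upt_Suc\<close>)
  also have "\<dots> = map (root_coeff (a # bs)) [0..<Suc (length (a # bs))]"
  proof (rule nth_equalityI)
    fix i assume "i < length (map2 (\<oplus>) (?q @ [\<zero>]) (\<zero> # map (\<lambda>c. \<ominus> a \<otimes> c) ?q))"
    then have i: "i < Suc (Suc (length bs))" by (simp del: upt_Suc)
    have 1: "(?q @ [\<zero>]) ! i = ?c i"
      using i root_coeff_beyond[OF bs, of i]
      by (cases "i < Suc (length bs)") (simp_all add: nth_append less_Suc_eq del: upt_Suc)
    have 2: "(\<zero> # map (\<lambda>c. \<ominus> a \<otimes> c) ?q) ! i = \<ominus> (a \<otimes> (case i of 0 \<Rightarrow> \<zero> | Suc j \<Rightarrow> ?c j))"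
      using i a c by (cases i) (simp_all add: l_minus del: upt_Suc)
    show "map2 (\<oplus>) (?q @ [\<zero>]) (\<zero> # map (\<lambda>c. \<ominus> a \<otimes> c) ?q) ! i
        = map (root_coeff (a # bs)) [0..<Suc (length (a # bs))] ! i"
      using i 1 2 by (simp add: a_minus_def del: upt_Suc)
  qed (simp del: upt_Suc)
  finally show ?thesis .
qed

end

text \<open>
  The linear factors are split off one at a time, and \<open>poly_mult_root_coeff\<close> keeps track of the
  coefficients.
\<close>

lemma (in field) splitted_monic_roots:
  "p \<in> carrier (poly_ring R) \<Longrightarrow> p \<noteq> [] \<Longrightarrow> hd p = \<one> \<Longrightarrow> splitted p \<Longrightarrow>
    \<exists>bs. set bs \<subseteq> carrier R \<and> p = map (root_coeff bs) [0..<Suc (length bs)]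
      \<and> (\<forall>b\<in>set bs. eval p b = \<zero>)"
proof (induction "length p" arbitrary: p rule: less_induct)
  case less
  interpret UP: domain "poly_ring R" by (rule univ_poly_is_domain[OF carrier_is_subring])
  show ?case
  proof (cases "length p = 1")
    case True
    then have "p = [\<one>]" using less.prems by (cases p) auto
    then show ?thesis by (intro exI[of _ "[]"]) simp
  next
    case False
    then have "length p > 1" using less.prems(2) by (cases p) auto
    then have "roots p \<noteq> {#}" using less.prems(4) unfolding splitted_def by auto
    then obtain a where a: "a \<in> carrier R" "a \<in># roots p" "[\<one>, \<ominus> a] \<in> carrier (poly_ring R)"
        "[\<one>, \<ominus> a] pdivides p" using not_empty_rootsE[OF less.prems(1)] by metis
    then obtain q where q: "q \<in> carrier (poly_ring R)" "p = [\<one>, \<ominus> a] \<otimes>\<^bsub>poly_ring R\<^esub> q"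
      unfolding pdivides_def by (auto elim: dividesE)
    have q0: "q \<noteq> []" using q less.prems(2) a(3) UP.r_null unfolding univ_poly_zero by force
    have pq: "polynomial (carrier R) q" "polynomial (carrier R) [\<one>, \<ominus> a]"
      using q(1) a(3) unfolding univ_poly_carrier by auto
    have qc: "set q \<subseteq> carrier R" using pq(1) unfolding polynomial_def by auto
    have pm: "p = poly_mult [\<one>, \<ominus> a] q" using q(2) unfolding univ_poly_mult .
    have hq: "hd q = \<one>"
      using poly_mult_lead_coeff[OF carrier_is_subring pq(2,1)] q0 less.prems(3) pm qc
      by (cases q) auto
    have len: "length p = Suc (length q)"
      unfolding pm poly_mult_monic_linear[OF a(1) qc q0 hq] by simp
    have "roots p = add_mset a (roots q)"
      unfolding q(2) by (rule poly_mult_degree_one_monic_imp_same_roots[OF a(1) q(1) q0])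
    then have "splitted q" using less.prems(4) len q0 unfolding splitted_def by (cases q) auto
    then obtain bs where bs: "set bs \<subseteq> carrier R" "q = map (root_coeff bs) [0..<Suc (length bs)]"
      "\<forall>b\<in>set bs. eval q b = \<zero>" using less.hyps[of q] len q(1) q0 hq by auto
    have ev: "eval p b = (b \<ominus> a) \<otimes> eval q b" if "b \<in> carrier R" for b
      unfolding pm using eval_poly_mult[of "[\<one>, \<ominus> a]" q b] a(1) that qc by (simp add: a_minus_def)
    have "\<forall>b\<in>set (a # bs). eval p b = \<zero>"
      using ev a(1) bs qc by (auto simp: r_neg a_minus_def eval_in_carrier subset_iff)
    moreover have "p = map (root_coeff (a # bs)) [0..<Suc (length (a # bs))]"
      unfolding pm bs(2) by (rule poly_mult_root_coeff[OF a(1) bs(1)])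
    ultimately show ?thesis using a(1) bs(1) by (intro exI[of _ "a # bs"]) simp
  qed
qed


context noetherian_extension
begin

lemma subring_mem:
  assumes "subring E L"
  shows "x \<in> E \<Longrightarrow> y \<in> E \<Longrightarrow> x \<oplus> y \<in> E" "x \<in> E \<Longrightarrow> y \<in> E \<Longrightarrow> x \<otimes> y \<in> E" "\<zero> \<in> E" "\<one> \<in> E"
    "x \<in> E \<Longrightarrow> x \<in> carrier L"
  using subringE[OF assms] by auto

text \<open>
  A polynomial that vanishes at \<open>\<alpha>\<close> is a multiple of the minimal polynomial and hence vanishes
  at \<open>b\<close>, so \<open>g(b)\<close> depends only on \<open>g(\<alpha>)\<close>.
\<close>

lemma conjugate_hom:
  assumes K: "subfield K L" and \<alpha>: "\<alpha> \<in> carrier L" "(algebraic over K) \<alpha>"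
    and b: "b \<in> carrier L" "eval (Irr K \<alpha>) b = \<zero>"
  shows "\<exists>\<psi>. \<psi> \<in> ring_hom (L\<lparr>carrier := simple_extension K \<alpha>\<rparr>) L
     \<and> (\<forall>g\<in>carrier (K[X]). \<psi> (eval g \<alpha>) = eval g b)"
proof -
  note Kr = subfieldE(1)[OF K]
  interpret ea: ring_hom_ring "K[X]" L "\<lambda>p. eval p \<alpha>" by (rule eval_ring_hom[OF Kr \<alpha>(1)])
  interpret eb: ring_hom_ring "K[X]" L "\<lambda>p. eval p b" by (rule eval_ring_hom[OF Kr b(1)])
  let ?E = "simple_extension K \<alpha>"
  have E: "?E = (\<lambda>p. eval p \<alpha>) ` carrier (K[X])"
    by (rule simple_extension_as_eval_img[OF subringE(1)[OF Kr] \<alpha>(1)])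
  define \<psi> where "\<psi> x = eval (SOME g. g \<in> carrier (K[X]) \<and> eval g \<alpha> = x) b" for x
  have kill: "eval g b = \<zero>" if g: "g \<in> carrier (K[X])" "eval g \<alpha> = \<zero>" for g
  proof -
    have "Irr K \<alpha> pdivides g" by (rule Irr_minimal[OF K \<alpha> g])
    then show ?thesis
      using pdivides_imp_root_sharing[OF _ _ b(1) b(2)] IrrE(1)[OF K \<alpha>] carrier_polynomial_shell[OF Kr]
      by blast
  qed
  have well: "\<psi> (eval g \<alpha>) = eval g b" if g: "g \<in> carrier (K[X])" for g
  proof -
    let ?h = "SOME h. h \<in> carrier (K[X]) \<and> eval h \<alpha> = eval g \<alpha>"
    have h: "?h \<in> carrier (K[X]) \<and> eval ?h \<alpha> = eval g \<alpha>"
      by (rule someI[of "\<lambda>h. h \<in> carrier (K[X]) \<and> eval h \<alpha> = eval g \<alpha>" g]) (use g in simp)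
    have "eval (?h \<ominus>\<^bsub>K[X]\<^esub> g) \<alpha> = \<zero>" using h g by (simp add: a_minus_def r_neg)
    then have "eval (?h \<ominus>\<^bsub>K[X]\<^esub> g) b = \<zero>" using h g by (intro kill) auto
    then have "eval ?h b \<ominus> eval g b = \<zero>" using h g by (simp add: a_minus_def)
    then show ?thesis unfolding \<psi>_def using h g by simp
  qed
  have "\<psi> \<in> ring_hom (L\<lparr>carrier := ?E\<rparr>) L"
  proof (rule ring_hom_memI)
    fix x assume "x \<in> carrier (L\<lparr>carrier := ?E\<rparr>)"
    then obtain g where g: "g \<in> carrier (K[X])" "x = eval g \<alpha>" unfolding E by auto
    show "\<psi> x \<in> carrier L" unfolding g(2) well[OF g(1)] using g(1) by simp
    fix y assume "y \<in> carrier (L\<lparr>carrier := ?E\<rparr>)"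
    then obtain h where h: "h \<in> carrier (K[X])" "y = eval h \<alpha>" unfolding E by auto
    have "\<psi> (eval (g \<otimes>\<^bsub>K[X]\<^esub> h) \<alpha>) = eval (g \<otimes>\<^bsub>K[X]\<^esub> h) b" by (rule well) (use g h in simp)
    then show "\<psi> (x \<otimes>\<^bsub>L\<lparr>carrier := ?E\<rparr>\<^esub> y) = \<psi> x \<otimes> \<psi> y"
      using g h well[OF g(1)] well[OF h(1)] by simp
    have "\<psi> (eval (g \<oplus>\<^bsub>K[X]\<^esub> h) \<alpha>) = eval (g \<oplus>\<^bsub>K[X]\<^esub> h) b" by (rule well) (use g h in simp)
    then show "\<psi> (x \<oplus>\<^bsub>L\<lparr>carrier := ?E\<rparr>\<^esub> y) = \<psi> x \<oplus> \<psi> y"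
      using g h well[OF g(1)] well[OF h(1)] by simp
  next
    have "\<psi> (eval \<one>\<^bsub>K[X]\<^esub> \<alpha>) = eval \<one>\<^bsub>K[X]\<^esub> b" by (rule well) simp
    then show "\<psi> \<one>\<^bsub>L\<lparr>carrier := ?E\<rparr>\<^esub> = \<one>" by simp
  qed
  then show ?thesis using well by blast
qed

text \<open>
  The map \<open>\<rho>\<close> is the normalised trace from \<open>K(\<alpha>)\<close> to \<open>K\<close>. It is the mean of the conjugation
  homomorphisms \<open>\<psi> b\<close>, one for each root \<open>b\<close> of the minimal polynomial; each of them is \<open>K\<close>-linear
  and preserves integrality.
\<close>

lemma simple_extension_retraction:
  assumes K: "subfield K L" "A \<subseteq> K" and \<alpha>: "\<alpha> \<in> carrier L" "(algebraic over K) \<alpha>"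
    and split: "splitted (Irr K \<alpha>)"
    and Q: "\<And>d::nat. d > 0 \<Longrightarrow> \<exists>q\<in>A. [d] \<cdot> \<one> \<otimes> q = \<one>"
  shows "\<exists>\<rho>. (\<forall>x\<in>simple_extension K \<alpha>. \<rho> x \<in> K)
     \<and> (\<forall>x\<in>simple_extension K \<alpha>. \<forall>y\<in>simple_extension K \<alpha>. \<rho> (x \<oplus> y) = \<rho> x \<oplus> \<rho> y)
     \<and> (\<forall>c\<in>K. \<forall>x\<in>simple_extension K \<alpha>. \<rho> (c \<otimes> x) = c \<otimes> \<rho> x)
     \<and> (\<forall>c\<in>K. \<rho> c = c) \<and> (\<forall>x\<in>simple_extension K \<alpha> \<inter> T. \<rho> x \<in> T)"
proof -
  note Kr = subfieldE(1)[OF K(1)]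
  note Km = subring_mem[OF Kr]
  let ?E = "simple_extension K \<alpha>" and ?f = "Irr K \<alpha>"
  note Irr = IrrE[OF K(1) \<alpha>]
  have E: "?E = (\<lambda>p. eval p \<alpha>) ` carrier (K[X])"
    by (rule simple_extension_as_eval_img[OF subringE(1)[OF Kr] \<alpha>(1)])
  have Er: "subring ?E L" by (rule simple_extension_is_subring[OF Kr \<alpha>(1)])
  note Em = subring_mem[OF Er]
  have KE: "K \<subseteq> ?E" by (rule simple_extension_incl[OF subringE(1)[OF Kr] \<alpha>(1)])
  have fK: "set ?f \<subseteq> K" using Irr(1) unfolding univ_poly_carrier[symmetric] polynomial_def by auto
  have f0: "?f \<noteq> []" using pirreducibleE(1)[OF Kr Irr(1,2)] .
  have deg: "length ?f - 1 \<ge> 1" by (rule pirreducible_degree[OF K(1) Irr(1,2)])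
  obtain bs where bs: "set bs \<subseteq> carrier L" "?f = map (root_coeff bs) [0..<Suc (length bs)]"
    "\<forall>b\<in>set bs. eval ?f b = \<zero>"
    using splitted_monic_roots[OF carrier_polynomial_shell[OF Kr Irr(1)] f0 Irr(3) split] by blast
  have rc: "root_coeff bs k \<in> K" for k
  proof (cases "k < Suc (length bs)")
    case True
    then have "root_coeff bs k \<in> set ?f" unfolding bs(2) by (simp del: upt_Suc)
    then show ?thesis using fK by blast
  next
    case False
    then show ?thesis using root_coeff_beyond[OF bs(1), of k] Km(3) by simp
  qed
  have "length ?f = Suc (length bs)" unfolding bs(2) by simp
  then have "length bs > 0" using deg by (cases bs) auto
  then obtain q where q: "q \<in> A" "[length bs] \<cdot> \<one> \<otimes> q = \<one>" using Q by blast
  have qK: "q \<in> K" and qc: "q \<in> carrier L" using q K(2) Km(5) by auto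
  have "\<forall>b\<in>set bs. \<exists>\<psi>. \<psi> \<in> ring_hom (L\<lparr>carrier := ?E\<rparr>) L
     \<and> (\<forall>g\<in>carrier (K[X]). \<psi> (eval g \<alpha>) = eval g b)"
    using conjugate_hom[OF K(1) \<alpha>] bs(1,3) by blast
  then obtain \<psi> where \<psi>: "\<forall>b\<in>set bs. \<psi> b \<in> ring_hom (L\<lparr>carrier := ?E\<rparr>) L
     \<and> (\<forall>g\<in>carrier (K[X]). \<psi> b (eval g \<alpha>) = eval g b)" by (rule bchoice[THEN exE])
  have hom: "\<psi> b \<in> ring_hom (L\<lparr>carrier := ?E\<rparr>) L" if "b \<in> set bs" for b using \<psi> that by blast
  have ev: "\<psi> b (eval g \<alpha>) = eval g b" if "b \<in> set bs" "g \<in> carrier (K[X])" for b g using \<psi> that by blast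
  have pc: "\<psi> b x \<in> carrier L" if "b \<in> set bs" "x \<in> ?E" for b x
    using ring_hom_memE(1)[OF hom[OF that(1)]] that(2) by simp
  have pa: "\<psi> b (x \<oplus> y) = \<psi> b x \<oplus> \<psi> b y" if "b \<in> set bs" "x \<in> ?E" "y \<in> ?E" for b x y
    using ring_hom_memE(3)[OF hom[OF that(1)], of x y] that by simp
  have pm: "\<psi> b (x \<otimes> y) = \<psi> b x \<otimes> \<psi> b y" if "b \<in> set bs" "x \<in> ?E" "y \<in> ?E" for b x y
    using ring_hom_memE(2)[OF hom[OF that(1)], of x y] that by simp
  have pK: "\<psi> b c = c" if b: "b \<in> set bs" and c: "c \<in> K" for b c
  proof (cases "c = \<zero>")
    case True
    have "\<psi> b (eval [] \<alpha>) = eval [] b" by (rule ev[OF b]) blast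
    then show ?thesis using True by simp
  next
    case False
    have "[c] \<in> carrier (K[X])" using False c unfolding univ_poly_carrier[symmetric] polynomial_def by simp
    from ev[OF b this] show ?thesis using Km(5)[OF c] by simp
  qed
  \<comment> \<open>The factor \<open>q\<close> is the inverse of the number of roots.\<close>
  define \<rho> where "\<rho> x = q \<otimes> lsum (\<lambda>b. \<psi> b x) bs" for x
  have lc: "lsum (\<lambda>b. \<psi> b x) bs \<in> carrier L" if "x \<in> ?E" for x
    by (rule lsum_closed) (rule pc[OF _ that])
  show ?thesis
  proof (intro exI[of _ \<rho>] conjI ballI)
    fix x assume x: "x \<in> ?E"
    then obtain g where g: "g \<in> carrier (K[X])" "x = eval g \<alpha>" unfolding E by blast
    have "lsum (\<lambda>b. \<psi> b x) bs = lsum (eval g) bs" by (rule lsum_cong) (use g ev in simp)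
    moreover have "set g \<subseteq> K" using g(1) unfolding univ_poly_carrier[symmetric] polynomial_def by auto
    ultimately have "lsum (\<lambda>b. \<psi> b x) bs \<in> K" using sum_eval_roots_mem[OF Kr bs(1) rc] by simp
    then show "\<rho> x \<in> K" unfolding \<rho>_def using qK Km(2) by blast
  next
    fix x y assume xy: "x \<in> ?E" "y \<in> ?E"
    have "lsum (\<lambda>b. \<psi> b (x \<oplus> y)) bs = lsum (\<lambda>b. \<psi> b x \<oplus> \<psi> b y) bs"
      by (rule lsum_cong) (use pa xy in simp)
    also have "\<dots> = lsum (\<lambda>b. \<psi> b x) bs \<oplus> lsum (\<lambda>b. \<psi> b y) bs"
      by (rule lsum_add) (use pc xy in simp)
    finally show "\<rho> (x \<oplus> y) = \<rho> x \<oplus> \<rho> y"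
      unfolding \<rho>_def using qc lc xy by (simp add: r_distr)
  next
    fix c x assume c: "c \<in> K" and x: "x \<in> ?E"
    have cE: "c \<in> ?E" and cc: "c \<in> carrier L" using c KE Km(5) by auto
    have "lsum (\<lambda>b. \<psi> b (c \<otimes> x)) bs = lsum (\<lambda>b. c \<otimes> \<psi> b x) bs"
      by (rule lsum_cong) (use pm pK c cE x in simp)
    also have "\<dots> = c \<otimes> lsum (\<lambda>b. \<psi> b x) bs" by (rule lsum_scale) (use pc x cc in auto)
    finally show "\<rho> (c \<otimes> x) = c \<otimes> \<rho> x"
      unfolding \<rho>_def using qc lc[OF x] cc by (simp add: m_lcomm)
  next
    fix c assume c: "c \<in> K"
    have cc: "c \<in> carrier L" using c Km(5) by auto
    have "lsum (\<lambda>b. \<psi> b c) bs = lsum (\<lambda>b. c) bs" by (rule lsum_cong) (use pK c in simp)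
    then have "\<rho> c = q \<otimes> ([length bs] \<cdot> \<one> \<otimes> c)" unfolding \<rho>_def using lsum_const[OF cc, of bs] by simp
    also have "\<dots> = ([length bs] \<cdot> \<one> \<otimes> q) \<otimes> c" using qc cc by (simp add: m_ac)
    finally show "\<rho> c = c" unfolding q(2) using cc by simp
  next
    fix x assume x: "x \<in> ?E \<inter> T"
    have "\<psi> b x \<in> T" if b: "b \<in> set bs" for b
      by (rule integral_hom[OF Er _ hom[OF b]]) (use x K(2) KE pK[OF b] in auto)
    then have "lsum (\<lambda>b. \<psi> b x) bs \<in> T" by (intro lsum_mem[OF T_subring])
    then show "\<rho> x \<in> T" unfolding \<rho>_def using A_integral[OF q(1)] integral_add_mult(2) by blast
  qed
qed


text \<open>
  A partial retraction, defined on a subfield, is encoded as its graph, so that the union of a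
  chain of partial retractions is a union of sets.
\<close>

definition retraction_graph :: "'a set \<Rightarrow> ('a \<times> 'a) set \<Rightarrow> bool" where
  "retraction_graph K G \<longleftrightarrow> subfield (Domain G) L \<and> Range G \<subseteq> K
    \<and> (\<forall>x y z. (x, y) \<in> G \<and> (x, z) \<in> G \<longrightarrow> y = z)
    \<and> (\<forall>x y x' y'. (x, y) \<in> G \<and> (x', y') \<in> G \<longrightarrow> (x \<oplus> x', y \<oplus> y') \<in> G)
    \<and> (\<forall>c x y. c \<in> K \<and> (x, y) \<in> G \<longrightarrow> (c \<otimes> x, c \<otimes> y) \<in> G)
    \<and> (\<forall>c\<in>K. (c, c) \<in> G) \<and> (\<forall>x y. (x, y) \<in> G \<and> x \<in> T \<longrightarrow> y \<in> T)"

lemma retraction_graphD: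
  assumes "retraction_graph K G"
  shows "subfield (Domain G) L" "Range G \<subseteq> K"
    "\<And>x y z. (x, y) \<in> G \<Longrightarrow> (x, z) \<in> G \<Longrightarrow> y = z"
    "\<And>x y x' y'. (x, y) \<in> G \<Longrightarrow> (x', y') \<in> G \<Longrightarrow> (x \<oplus> x', y \<oplus> y') \<in> G"
    "\<And>c x y. c \<in> K \<Longrightarrow> (x, y) \<in> G \<Longrightarrow> (c \<otimes> x, c \<otimes> y) \<in> G"
    "\<And>c. c \<in> K \<Longrightarrow> (c, c) \<in> G"
    "\<And>x y. (x, y) \<in> G \<Longrightarrow> x \<in> T \<Longrightarrow> y \<in> T"
  using assms unfolding retraction_graph_def by (simp, simp, blast, blast, blast, blast, blast)

lemma subfield_Union_chain:
  assumes C: "C \<noteq> {}" "\<And>F. F \<in> C \<Longrightarrow> subfield F L"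
    and ch: "\<And>F F'. F \<in> C \<Longrightarrow> F' \<in> C \<Longrightarrow> F \<subseteq> F' \<or> F' \<subseteq> F"
  shows "subfield (\<Union>C) L"
proof -
  have sr: "subring F L" if "F \<in> C" for F using subfieldE(1)[OF C(2)[OF that]] .
  have common: "\<exists>F\<in>C. x \<in> F \<and> y \<in> F" if "x \<in> \<Union>C" "y \<in> \<Union>C" for x y
    using that ch by blast
  show ?thesis
  proof (rule subfieldI')
    show "subring (\<Union>C) L"
    proof (rule subringI)
      show "\<Union>C \<subseteq> carrier L" using sr subringE(1) by blast
      show "\<one> \<in> \<Union>C" using C(1) sr subringE(3) by blast
      show "\<ominus> h \<in> \<Union>C" if "h \<in> \<Union>C" for h using that subringE(5)[OF sr] by blast
      show "h1 \<otimes> h2 \<in> \<Union>C" if "h1 \<in> \<Union>C" "h2 \<in> \<Union>C" for h1 h2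
        using common[OF that] subringE(6)[OF sr] by blast
      show "h1 \<oplus> h2 \<in> \<Union>C" if "h1 \<in> \<Union>C" "h2 \<in> \<Union>C" for h1 h2
        using common[OF that] subringE(7)[OF sr] by blast
    qed
    fix k assume k: "k \<in> \<Union>C - {\<zero>}"
    then obtain F where F: "F \<in> C" "k \<in> F - {\<zero>}" by blast
    then show "inv k \<in> \<Union>C" using subfield_m_inv(1)[OF C(2)[OF F(1)] F(2)] by blast
  qed
qed

lemma retraction_graph_Union:
  assumes C: "C \<noteq> {}" "\<And>G. G \<in> C \<Longrightarrow> retraction_graph K G"
    and ch: "\<And>G G'. G \<in> C \<Longrightarrow> G' \<in> C \<Longrightarrow> G \<subseteq> G' \<or> G' \<subseteq> G"
  shows "retraction_graph K (\<Union>C)"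
proof -
  note D = retraction_graphD[OF C(2)]
  have common: "\<exists>G\<in>C. p \<in> G \<and> p' \<in> G" if "p \<in> \<Union>C" "p' \<in> \<Union>C" for p p'
    using that ch by blast
  have "subfield (\<Union>(Domain ` C)) L"
  proof (rule subfield_Union_chain)
    show "F \<subseteq> F' \<or> F' \<subseteq> F" if FF: "F \<in> Domain ` C" "F' \<in> Domain ` C" for F F'
    proof -
      from FF obtain G G' where G: "G \<in> C" "G' \<in> C" "F = Domain G" "F' = Domain G'" by blast
      then show ?thesis using ch[OF G(1,2)] Domain_mono by blast
    qed
  qed (use C(1) D(1) in auto)
  then have 1: "subfield (Domain (\<Union>C)) L" by (simp add: Domain_Union)
  show ?thesis unfolding retraction_graph_def
  proof (intro conjI allI impI ballI)
    show "Range (\<Union>C) \<subseteq> K" using D(2) by blast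
    fix x y z assume "(x, y) \<in> \<Union>C \<and> (x, z) \<in> \<Union>C"
    then show "y = z" using common[of "(x, y)" "(x, z)"] D(3) by blast
  next
    fix x y x' y' assume "(x, y) \<in> \<Union>C \<and> (x', y') \<in> \<Union>C"
    then show "(x \<oplus> x', y \<oplus> y') \<in> \<Union>C" using common[of "(x, y)" "(x', y')"] D(4) by blast
  next
    fix c x y assume "c \<in> K \<and> (x, y) \<in> \<Union>C"
    then show "(c \<otimes> x, c \<otimes> y) \<in> \<Union>C" using D(5) by blast
  next
    fix c assume "c \<in> K"
    then show "(c, c) \<in> \<Union>C" using C(1) D(6) by blast
  next
    fix x y assume "(x, y) \<in> \<Union>C \<and> x \<in> T"
    then show "y \<in> T" using D(7) by blast
  qed (rule 1)
qed

text \<open>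
  A maximal partial retraction is defined on all of \<open>L\<close>: if its domain \<open>F\<close> misses \<open>\<alpha>\<close>, it can be
  composed with the normalised trace from \<open>F(\<alpha>)\<close> to \<open>F\<close>.
\<close>

theorem exists_retraction:
  assumes K: "subfield K L" "A \<subseteq> K"
    and alg: "\<And>F \<alpha>. subfield F L \<Longrightarrow> K \<subseteq> F \<Longrightarrow> \<alpha> \<in> carrier L \<Longrightarrow> (algebraic over F) \<alpha> \<and> splitted (Irr F \<alpha>)"
    and Q: "\<And>d::nat. d > 0 \<Longrightarrow> \<exists>q\<in>A. [d] \<cdot> \<one> \<otimes> q = \<one>"
  shows "\<exists>\<rho>. (\<forall>x\<in>carrier L. \<rho> x \<in> K)
     \<and> (\<forall>x\<in>carrier L. \<forall>y\<in>carrier L. \<rho> (x \<oplus> y) = \<rho> x \<oplus> \<rho> y)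
     \<and> (\<forall>c\<in>K. \<forall>x\<in>carrier L. \<rho> (c \<otimes> x) = c \<otimes> \<rho> x)
     \<and> (\<forall>c\<in>K. \<rho> c = c) \<and> (\<forall>x\<in>T. \<rho> x \<in> T)"
proof -
  note Kr = subfieldE(1)[OF K(1)]
  note Km = subring_mem[OF Kr]
  have "\<exists>M\<in>Collect (retraction_graph K). \<forall>Z\<in>Collect (retraction_graph K). M \<subseteq> Z \<longrightarrow> Z = M"
  proof (rule subset_Zorn_nonempty)
    have "Domain (Id_on K) = K" by auto
    then have "retraction_graph K (Id_on K)"
      unfolding retraction_graph_def using K(1) Km by auto
    then show "Collect (retraction_graph K) \<noteq> {}" by blast
    fix C assume C: "C \<noteq> {}" "subset.chain (Collect (retraction_graph K)) C"
    have "retraction_graph K (\<Union>C)"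
      by (rule retraction_graph_Union) (use C in \<open>auto simp: subset_chain_def\<close>)
    then show "\<Union>C \<in> Collect (retraction_graph K)" by simp
  qed
  then obtain G where G0: "G \<in> Collect (retraction_graph K)"
    and max: "\<forall>Z\<in>Collect (retraction_graph K). G \<subseteq> Z \<longrightarrow> Z = G" ..
  from G0 have G: "retraction_graph K G" by simp
  note D = retraction_graphD[OF G]
  define F where "F = Domain G"
  have F: "subfield F L" using D(1) unfolding F_def .
  note Fr = subfieldE(1)[OF F]
  note Fm = subring_mem[OF Fr]
  have KF: "K \<subseteq> F" unfolding F_def using D(6) by blast
  define f where "f x = (THE y. (x, y) \<in> G)" for x
  have fI: "f x = y" if "(x, y) \<in> G" for x y unfolding f_def using that D(3) by (intro the_equality) blast+
  have fG: "(x, f x) \<in> G" if "x \<in> F" for x using that fI unfolding F_def by (metis DomainE)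
  have full: "F = carrier L"
  proof (rule ccontr)
    assume "F \<noteq> carrier L"
    then obtain \<alpha> where \<alpha>: "\<alpha> \<in> carrier L" "\<alpha> \<notin> F" using Fm(5) by blast
    from alg[OF F KF \<alpha>(1)] have al: "(algebraic over F) \<alpha>" and sp: "splitted (Irr F \<alpha>)" by auto
    let ?E = "simple_extension F \<alpha>"
    from simple_extension_retraction[OF F _ \<alpha>(1) al sp Q] K(2) KF
    obtain \<rho> where \<rho>: "\<forall>x\<in>?E. \<rho> x \<in> F" "\<forall>x\<in>?E. \<forall>y\<in>?E. \<rho> (x \<oplus> y) = \<rho> x \<oplus> \<rho> y"
      "\<forall>c\<in>F. \<forall>x\<in>?E. \<rho> (c \<otimes> x) = c \<otimes> \<rho> x" "\<forall>c\<in>F. \<rho> c = c" "\<forall>x\<in>?E \<inter> T. \<rho> x \<in> T"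
      by blast
    have Er: "subring ?E L" by (rule simple_extension_is_subring[OF Fr \<alpha>(1)])
    have FE: "F \<subseteq> ?E" by (rule simple_extension_incl[OF subringE(1)[OF Fr] \<alpha>(1)])
    have Ef: "subfield ?E L" using simple_extension_is_subfield[OF F \<alpha>(1)] al by blast
    \<comment> \<open>The graph of the composite of \<open>f\<close> with the normalised trace.\<close>
    define H where "H = {(x, f (\<rho> x)) | x. x \<in> ?E}"
    have Hm: "(x, y) \<in> H \<longleftrightarrow> x \<in> ?E \<and> y = f (\<rho> x)" for x y unfolding H_def by blast
    have fr: "(\<rho> x, f (\<rho> x)) \<in> G" if "x \<in> ?E" for x using \<rho>(1) that fG by blast
    have "retraction_graph K H" unfolding retraction_graph_def
    proof (intro conjI allI impI ballI)
      have "Domain H = ?E" unfolding H_def by blast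
      then show "subfield (Domain H) L" using Ef by simp
      show "Range H \<subseteq> K"
      proof
        fix y assume "y \<in> Range H"
        then obtain x where "x \<in> ?E" "y = f (\<rho> x)" unfolding H_def by blast
        then show "y \<in> K" using fr[of x] D(2) by blast
      qed
      show "y = z" if "(x, y) \<in> H \<and> (x, z) \<in> H" for x y z using that unfolding Hm by blast
    next
      fix x y x' y' assume "(x, y) \<in> H \<and> (x', y') \<in> H"
      then have x: "x \<in> ?E" "x' \<in> ?E" and y: "y = f (\<rho> x)" "y' = f (\<rho> x')" unfolding Hm by auto
      have "f (\<rho> (x \<oplus> x')) = y \<oplus> y'" unfolding y
        using fI[OF D(4)[OF fr[OF x(1)] fr[OF x(2)]]] \<rho>(2) x by simp
      then show "(x \<oplus> x', y \<oplus> y') \<in> H" unfolding Hm using subringE(7)[OF Er x] by simp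
    next
      fix c x y assume cx: "c \<in> K \<and> (x, y) \<in> H"
      then have c: "c \<in> K" "c \<in> F" "c \<in> ?E" and x: "x \<in> ?E" and y: "y = f (\<rho> x)"
        using KF FE unfolding Hm by auto
      have "f (\<rho> (c \<otimes> x)) = c \<otimes> y" unfolding y
        using fI[OF D(5)[OF c(1) fr[OF x]]] \<rho>(3) x c by simp
      then show "(c \<otimes> x, c \<otimes> y) \<in> H" unfolding Hm using subringE(6)[OF Er c(3) x] by simp
    next
      fix c assume c: "c \<in> K"
      then have "f (\<rho> c) = c" using fI[OF D(6)[OF c]] \<rho>(4) KF by auto
      then show "(c, c) \<in> H" unfolding Hm using c KF FE by auto
    next
      fix x y assume "(x, y) \<in> H \<and> x \<in> T"
      then have x: "x \<in> ?E" "x \<in> T" and y: "y = f (\<rho> x)" unfolding Hm by auto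
      then have "\<rho> x \<in> T" using \<rho>(5) by blast
      then show "y \<in> T" unfolding y using D(7)[OF fr[OF x(1)]] by blast
    qed
    moreover have "G \<subseteq> H"
    proof (rule subrelI)
      fix x y assume xy: "(x, y) \<in> G"
      then have x: "x \<in> F" unfolding F_def by blast
      then have "f (\<rho> x) = y" using fI[OF xy] \<rho>(4) by simp
      then show "(x, y) \<in> H" unfolding Hm using x FE by blast
    qed
    ultimately have "H = G" using max by blast
    moreover have "\<alpha> \<in> ?E" by (rule simple_extension_mem[OF Fr \<alpha>(1)])
    then have "(\<alpha>, f (\<rho> \<alpha>)) \<in> H" unfolding Hm by blast
    ultimately show False using \<alpha>(2) unfolding F_def by blast
  qed
  show ?thesis
  proof (intro exI[of _ f] conjI ballI)
    show "f x \<in> K" if "x \<in> carrier L" for x using fG[of x] that D(2) full by blast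
    show "f (x \<oplus> y) = f x \<oplus> f y" if "x \<in> carrier L" "y \<in> carrier L" for x y
      by (rule fI[OF D(4)[OF fG fG]]) (use that full in auto)
    show "f (c \<otimes> x) = c \<otimes> f x" if "c \<in> K" "x \<in> carrier L" for c x
      by (rule fI[OF D(5)[OF that(1) fG]]) (use that full in auto)
    show "f c = c" if "c \<in> K" for c by (rule fI[OF D(6)[OF that]])
    show "f x \<in> T" if "x \<in> T" for x
      by (rule D(7)[OF fG that]) (use that T_carrier full in auto)
  qed
qed

end

section \<open>Finiteness of the integral closure in a finite extension\<close>

lemma infinite_Times_lepoll: "infinite A \<Longrightarrow> A \<times> A \<lesssim> A"
  unfolding lepoll_def card_of_ordLeq
  by (rule ordIso_imp_ordLeq) (rule card_of_Times_same_infinite)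

lemma (in ring) quotient_zero:
  shows "carrier (R Quot {\<zero>}) = (\<lambda>a. {a}) ` carrier R"
    and "(\<lambda>a. {a}) \<in> ring_hom R (R Quot {\<zero>})"
proof -
  interpret Z: ideal "{\<zero>}" R by (rule zeroideal)
  have e: "{\<zero>} +> a = {a}" if "a \<in> carrier R" for a
    using that unfolding a_r_coset_def' by auto
  show "carrier (R Quot {\<zero>}) = (\<lambda>a. {a}) ` carrier R"
    unfolding FactRing_def A_RCOSETS_def' using e by auto
  show "(\<lambda>a. {a}) \<in> ring_hom R (R Quot {\<zero>})"
  proof (rule ring_hom_memI)
    note h = ring_hom_memE[OF Z.rcos_ring_hom]
    fix x assume x: "x \<in> carrier R"
    show "{x} \<in> carrier (R Quot {\<zero>})" using h(1)[OF x] e[OF x] by simp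
    fix y assume y: "y \<in> carrier R"
    show "{x \<otimes> y} = {x} \<otimes>\<^bsub>R Quot {\<zero>}\<^esub> {y}" using h(2)[OF x y] e x y by simp
    show "{x \<oplus> y} = {x} \<oplus>\<^bsub>R Quot {\<zero>}\<^esub> {y}" using h(3)[OF x y] e x y by simp
  next
    show "{\<one>} = \<one>\<^bsub>R Quot {\<zero>}\<^esub>" using ring_hom_memE(4)[OF Z.rcos_ring_hom] e by simp
  qed
qed

context noetherian_extension
begin

text \<open>
  The elements that have a denominator are closed under the field operations.
\<close>

lemma fraction_denominator:
  assumes dom: "domain R" and inj: "inj_on \<phi> (carrier R)"
  shows "x \<in> generate_field L A \<Longrightarrow> \<exists>b\<in>carrier R - {\<zero>\<^bsub>R\<^esub>}. \<phi> b \<otimes> x \<in> A"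
proof (induction rule: generate_field.induct)
  interpret D: domain R by (rule dom)
  case one
  show ?case by (rule bexI[of _ "\<one>\<^bsub>R\<^esub>"]) (use subringE(3)[OF A_subring] in simp_all)
next
  interpret D: domain R by (rule dom)
  case (incl h)
  then show ?case by (intro bexI[of _ "\<one>\<^bsub>R\<^esub>"]) auto
next
  case (a_inv h)
  have hc: "h \<in> carrier L" using generate_field_in_carrier[OF A_carrier a_inv(1)] .
  from a_inv obtain b where b: "b \<in> carrier R - {\<zero>\<^bsub>R\<^esub>}" "\<phi> b \<otimes> h \<in> A" by blast
  then have "\<phi> b \<otimes> \<ominus> h = \<ominus> (\<phi> b \<otimes> h)" using hc by (simp add: r_minus)
  then show ?case using b subringE(5)[OF A_subring b(2)] by (intro bexI[of _ b]) auto
next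
  interpret D: domain R by (rule dom)
  interpret h: ring_hom_ring R L \<phi> by (rule phi_hom_ring)
  case (m_inv h)
  have hc: "h \<in> carrier L" using generate_field_in_carrier[OF A_carrier m_inv(1)] .
  then have hu: "h \<in> Units L" using m_inv(2) field_Units by simp
  from m_inv obtain b a where b: "b \<in> carrier R - {\<zero>\<^bsub>R\<^esub>}" and a: "a \<in> carrier R" "\<phi> b \<otimes> h = \<phi> a" by blast
  have b0: "\<phi> b \<noteq> \<zero>" using b inj_onD[OF inj, of b "\<zero>\<^bsub>R\<^esub>"] by auto
  have "\<phi> a \<noteq> \<zero>" using a(2) b0 b m_inv(2) hc integral[of "\<phi> b" h] by auto
  then have "a \<in> carrier R - {\<zero>\<^bsub>R\<^esub>}" using a(1) by auto
  moreover have "\<phi> a \<otimes> inv h = \<phi> b" unfolding a(2)[symmetric] using b hu hc by (simp add: m_assoc)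
  ultimately show ?case using b by (intro bexI[of _ a]) auto
next
  interpret D: domain R by (rule dom)
  case (eng_add h k)
  have c: "h \<in> carrier L" "k \<in> carrier L"
    using generate_field_in_carrier[OF A_carrier] eng_add by auto
  from eng_add obtain a b where a: "a \<in> carrier R - {\<zero>\<^bsub>R\<^esub>}" "\<phi> a \<otimes> h \<in> A"
    and b: "b \<in> carrier R - {\<zero>\<^bsub>R\<^esub>}" "\<phi> b \<otimes> k \<in> A" by blast
  have "\<phi> (a \<otimes>\<^bsub>R\<^esub> b) \<otimes> (h \<oplus> k) = \<phi> b \<otimes> (\<phi> a \<otimes> h) \<oplus> \<phi> a \<otimes> (\<phi> b \<otimes> k)"
    using a(1) b(1) c by (simp add: r_distr m_ac)
  also have "\<dots> \<in> A" 
    by (rule subringE(7)[OF A_subring subringE(6)[OF A_subring _ a(2)] subringE(6)[OF A_subring _ b(2)]])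
       (use a b in auto)
  finally show ?case using a b D.integral[of a b] by (intro bexI[of _ "a \<otimes>\<^bsub>R\<^esub> b"]) auto
next
  interpret D: domain R by (rule dom)
  case (eng_mult h k)
  have c: "h \<in> carrier L" "k \<in> carrier L"
    using generate_field_in_carrier[OF A_carrier] eng_mult by auto
  from eng_mult obtain a b where a: "a \<in> carrier R - {\<zero>\<^bsub>R\<^esub>}" "\<phi> a \<otimes> h \<in> A"
    and b: "b \<in> carrier R - {\<zero>\<^bsub>R\<^esub>}" "\<phi> b \<otimes> k \<in> A" by blast
  have "\<phi> (a \<otimes>\<^bsub>R\<^esub> b) \<otimes> (h \<otimes> k) = (\<phi> a \<otimes> h) \<otimes> (\<phi> b \<otimes> k)"
    using a(1) b(1) c by (simp add: m_ac)
  also have "\<dots> \<in> A" by (rule subringE(6)[OF A_subring a(2) b(2)])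
  finally show ?case using a b D.integral[of a b] by (intro bexI[of _ "a \<otimes>\<^bsub>R\<^esub> b"]) auto
qed

text \<open>
  An element of the fraction field is determined by a denominator and the numerator belonging
  to it, and an element of \<open>E\<close> by finitely many elements of the fraction field; the infinite set
  \<open>carrier R\<close> absorbs finite products with itself.
\<close>

lemma finite_extension_lepoll:
  assumes dom: "domain R" and inj: "inj_on \<phi> (carrier R)" and inf: "infinite (carrier R)"
    and dim: "dimension n (generate_field L A) E"
  shows "E \<lesssim> carrier R"
proof -
  interpret D: domain R by (rule dom)
  interpret h: ring_hom_ring R L \<phi> by (rule phi_hom_ring)
  let ?K = "generate_field L A"
  have Kc: "?K \<subseteq> carrier L" by (rule generate_field_incl[OF A_carrier])
  have sq: "carrier R \<times> carrier R \<lesssim> carrier R" by (rule infinite_Times_lepoll[OF inf])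
  have "\<forall>x\<in>?K. \<exists>p. fst p \<in> carrier R - {\<zero>\<^bsub>R\<^esub>} \<and> snd p \<in> carrier R \<and> \<phi> (fst p) \<otimes> x = \<phi> (snd p)"
    using fraction_denominator[OF dom inj] by fastforce
  then obtain w where w: "\<forall>x\<in>?K. fst (w x) \<in> carrier R - {\<zero>\<^bsub>R\<^esub>} \<and> snd (w x) \<in> carrier R
     \<and> \<phi> (fst (w x)) \<otimes> x = \<phi> (snd (w x))" by (rule bchoice[THEN exE])
  have "inj_on w ?K"
  proof (rule inj_onI)
    fix x y assume x: "x \<in> ?K" and y: "y \<in> ?K" and e: "w x = w y"
    have wx: "fst (w x) \<in> carrier R - {\<zero>\<^bsub>R\<^esub>}" "\<phi> (fst (w x)) \<otimes> x = \<phi> (snd (w x))" using w x by auto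
    have wy: "\<phi> (fst (w x)) \<otimes> y = \<phi> (snd (w x))" using w y e by auto
    have "\<phi> (fst (w x)) \<noteq> \<zero>" using wx inj_onD[OF inj, of "fst (w x)" "\<zero>\<^bsub>R\<^esub>"] by auto
    then show "x = y" using wx wy x y Kc m_lcancel[of "\<phi> (fst (w x))" x y] by auto
  qed
  moreover have "w ` ?K \<subseteq> carrier R \<times> carrier R"
  proof (rule image_subsetI)
    fix x assume "x \<in> ?K"
    from bspec[OF w this] show "w x \<in> carrier R \<times> carrier R" by (simp add: mem_Times_iff)
  qed
  ultimately have "?K \<lesssim> carrier R \<times> carrier R" unfolding lepoll_def by blast
  then have K: "?K \<lesssim> carrier R" using sq by (rule lepoll_trans)
  show ?thesis using dim
  proof (induction n "?K" E rule: dimension.induct)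
    case (zero_dim)
    show ?case unfolding lepoll_def
      by (rule exI[of _ "\<lambda>x. \<zero>\<^bsub>R\<^esub>"]) auto
  next
    case (Suc_dim v E n)
    have "line_extension ?K v E = (\<lambda>(k, e). k \<otimes> v \<oplus> e) ` (?K \<times> E)"
      unfolding set_eq_iff line_extension_mem_iff image_iff by (simp add: Bex_def)
    then have "line_extension ?K v E \<lesssim> ?K \<times> E" using image_lepoll by metis
    also have "?K \<times> E \<lesssim> carrier R \<times> carrier R" by (rule times_lepoll_mono[OF K Suc_dim.hyps(4)])
    also note sq
    finally show ?case .
  qed
qed


text \<open>
  The hypothesis speaks of fields on the type of the elements of \<open>R Quot {0}\<close>, which are
  sets. An injection \<open>\<beta>\<close> of \<open>E\<close> into this type transports the field structure of \<open>E\<close> to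
  such a field \<open>L'\<close>. Under \<open>\<beta>\<close> the fraction fields, the integral closures
  and their submodules correspond, so a finite set of generators of the integral closure in
  \<open>L'\<close> comes from one for \<open>T \<inter> E\<close>.
\<close>

theorem N2_integral_closure_finite:
  assumes dom: "domain R" and inj: "inj_on \<phi> (carrier R)" and N2: "N2_domain (R Quot {\<zero>\<^bsub>R\<^esub>})"
    and inf: "infinite (carrier R)" and E: "subfield E L" "A \<subseteq> E"
    and dim: "finite_dimension (generate_field L A) E"
  shows "finite_module R (RS\<lparr>carrier := T \<inter> E\<rparr>)"
proof -
  interpret D: domain R by (rule dom)
  let ?K = "generate_field L A"
  have K: "subfield ?K L" by (rule generate_field_is_subfield[OF A_carrier])
  have KE: "?K \<subseteq> E" by (rule generate_field_min_subfield1[OF A_carrier E])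
  note Er = subfieldE(1)[OF E(1)]
  note Ec = subringE(1)[OF Er]
  from dim obtain n where n: "dimension n ?K E" by (rule finite_dimensionE')
  have "E \<lesssim> carrier R" by (rule finite_extension_lepoll[OF dom inj inf n])
  then obtain \<gamma> where \<gamma>: "inj_on \<gamma> E" "\<gamma> ` E \<subseteq> carrier R" unfolding lepoll_def by blast
  \<comment> \<open>Singletons turn elements of \<open>R\<close> into elements of the type of \<open>R Quot {0}\<close>.\<close>
  define \<beta> where "\<beta> x = {\<gamma> x}" for x
  have bi: "inj_on \<beta> E" using \<gamma> unfolding \<beta>_def inj_on_def by simp
  define LE where "LE = L\<lparr>carrier := E\<rparr>"
  define L' where "L' = image_ring \<beta> LE"
  have LEc: "carrier LE = E" unfolding LE_def by simp
  interpret LE: field LE unfolding LE_def using subfield_iff(2)[OF E(1)] .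
  have bi': "inj_on \<beta> (carrier LE)" using bi unfolding LEc .
  interpret L': field L' unfolding L'_def by (rule LE.inj_imp_image_ring_is_field[OF bi'])
  have bh: "\<beta> \<in> ring_hom LE L'"
    using inj_imp_image_ring_iso[OF bi'] unfolding L'_def ring_iso_def by blast
  interpret b: ring_hom_ring LE L' \<beta> by (rule ring_hom_ringI2[OF LE.ring_axioms L'.ring_axioms bh])
  have L'c: "carrier L' = \<beta> ` E" unfolding L'_def image_ring_carrier LEc ..
  have b_add: "\<beta> (x \<oplus> y) = \<beta> x \<oplus>\<^bsub>L'\<^esub> \<beta> y" if "x \<in> E" "y \<in> E" for x y
    using ring_hom_memE(3)[OF bh, of x y] that unfolding LE_def by simp
  have b_mult: "\<beta> (x \<otimes> y) = \<beta> x \<otimes>\<^bsub>L'\<^esub> \<beta> y" if "x \<in> E" "y \<in> E" for x y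
    using ring_hom_memE(2)[OF bh, of x y] that unfolding LE_def by simp
  have b_one: "\<beta> \<one> = \<one>\<^bsub>L'\<^esub>" using ring_hom_memE(4)[OF bh] unfolding LE_def by simp
  have b_zero: "\<beta> \<zero> = \<zero>\<^bsub>L'\<^esub>" using b.hom_zero unfolding LE_def by simp
  have b_c: "\<beta> x \<in> carrier L'" if "x \<in> E" for x using that unfolding L'c by blast
  have b_uminus: "\<beta> (\<ominus> x) = \<ominus>\<^bsub>L'\<^esub> \<beta> x" if x: "x \<in> E" for x
  proof -
    have mx: "\<ominus> x \<in> E" using subringE(5)[OF Er x] .
    have "\<beta> (\<ominus> x) \<oplus>\<^bsub>L'\<^esub> \<beta> x = \<zero>\<^bsub>L'\<^esub>"
      using b_add[OF mx x] b_zero x Ec by (simp add: l_neg subset_iff)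
    then show ?thesis using L'.minus_equality[OF _ b_c[OF x] b_c[OF mx]] by simp
  qed
  have b_inv: "\<beta> (inv x) = inv\<^bsub>L'\<^esub> \<beta> x" if x: "x \<in> E" "x \<noteq> \<zero>" for x
  proof -
    have ix: "inv x \<in> E" using subfield_m_inv(1)[OF E(1)] x by blast
    have "x \<in> Units L" using x Ec field_Units by auto
    then have "\<beta> x \<otimes>\<^bsub>L'\<^esub> \<beta> (inv x) = \<one>\<^bsub>L'\<^esub>" using b_mult[OF x(1) ix] b_one by simp
    then show ?thesis using L'.comm_inv_char[OF b_c[OF x(1)] b_c[OF ix]] by simp
  qed
  have b_eq0: "\<beta> x = \<zero>\<^bsub>L'\<^esub> \<longleftrightarrow> x = \<zero>" if "x \<in> E" for x
    using b_zero inj_onD[OF bi, of x \<zero>] that subringE(2)[OF Er] by auto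

  let ?R' = "R Quot {\<zero>\<^bsub>R\<^esub>}"
  define \<phi>' where "\<phi>' C = \<beta> (\<phi> (the_elem C))" for C
  note q = ring.quotient_zero[OF cring.axioms(1)[OF R_cring]]
  note qh = ring_hom_memE[OF q(2)]
  have \<phi>'s: "\<phi>' {a} = \<beta> (\<phi> a)" for a unfolding \<phi>'_def by simp
  have \<phi>E: "\<phi> a \<in> E" if "a \<in> carrier R" for a using that E(2) by blast
  have \<phi>'h: "\<phi>' \<in> ring_hom ?R' L'"
  proof (rule ring_hom_memI)
    fix x assume "x \<in> carrier ?R'"
    then obtain a where a: "a \<in> carrier R" "x = {a}" unfolding q(1) by blast
    show "\<phi>' x \<in> carrier L'" unfolding a(2) \<phi>'s by (rule b_c[OF \<phi>E[OF a(1)]])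
    fix y assume "y \<in> carrier ?R'"
    then obtain c where c: "c \<in> carrier R" "y = {c}" unfolding q(1) by blast
    show "\<phi>' (x \<otimes>\<^bsub>?R'\<^esub> y) = \<phi>' x \<otimes>\<^bsub>L'\<^esub> \<phi>' y"
      unfolding a(2) c(2) qh(2)[OF a(1) c(1), symmetric] \<phi>'s using a c b_mult[OF \<phi>E \<phi>E] by simp
    show "\<phi>' (x \<oplus>\<^bsub>?R'\<^esub> y) = \<phi>' x \<oplus>\<^bsub>L'\<^esub> \<phi>' y"
      unfolding a(2) c(2) qh(3)[OF a(1) c(1), symmetric] \<phi>'s using a c b_add[OF \<phi>E \<phi>E] by simp
  next
    show "\<phi>' \<one>\<^bsub>?R'\<^esub> = \<one>\<^bsub>L'\<^esub>" unfolding qh(4)[symmetric] \<phi>'s using b_one by simp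
  qed
  have \<phi>'inj: "inj_on \<phi>' (carrier ?R')"
  proof (rule inj_onI)
    fix x y assume "x \<in> carrier ?R'" "y \<in> carrier ?R'" and e: "\<phi>' x = \<phi>' y"
    then obtain a c where a: "a \<in> carrier R" "x = {a}" and c: "c \<in> carrier R" "y = {c}" unfolding q(1) by blast
    have "\<phi> a = \<phi> c" using e inj_onD[OF bi _ \<phi>E[OF a(1)] \<phi>E[OF c(1)]] unfolding a c \<phi>'s by blast
    then show "x = y" using inj_onD[OF inj] a c by simp
  qed
  have \<phi>'A: "\<phi>' ` carrier ?R' = \<beta> ` A" unfolding q(1) image_image \<phi>'s ..
  have bA: "\<beta> ` A \<subseteq> carrier L'" using E(2) unfolding L'c by blast
  have gen1: "x \<in> ?K \<Longrightarrow> \<beta> x \<in> generate_field L' (\<beta> ` A)" for x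
  proof (induction rule: generate_field.induct)
    case one
    show ?case unfolding b_one by (rule generate_field.one)
  next
    case (incl h)
    then show ?case by (intro generate_field.incl) blast
  next
    case (a_inv h)
    then show ?case using b_uminus[of h] subsetD[OF KE] generate_field.a_inv[OF a_inv.IH] by simp
  next
    case (m_inv h)
    then have "h \<in> E" using KE by blast
    then show ?case using b_inv[of h] b_eq0[of h] m_inv.hyps generate_field.m_inv[OF m_inv.IH] by simp
  next
    case (eng_add h k)
    then show ?case using b_add[of h k] subsetD[OF KE] generate_field.eng_add[OF eng_add.IH] by simp
  next
    case (eng_mult h k)
    then show ?case using b_mult[of h k] subsetD[OF KE] generate_field.eng_mult[OF eng_mult.IH] by simp
  qed
  have gen2: "y \<in> generate_field L' (\<beta> ` A) \<Longrightarrow> y \<in> \<beta> ` ?K" for y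
  proof (induction rule: generate_field.induct)
    case one
    show ?case unfolding b_one[symmetric] by (rule imageI) (rule generate_field.one)
  next
    case (incl h)
    then show ?case using generate_field.incl[of _ A L] by blast
  next
    case (a_inv h)
    then obtain x where x: "x \<in> ?K" "h = \<beta> x" by blast
    then have "\<ominus>\<^bsub>L'\<^esub> h = \<beta> (\<ominus> x)" using b_uminus[of x] subsetD[OF KE] by simp
    then show ?case using generate_field.a_inv[OF x(1)] by blast
  next
    case (m_inv h)
    then obtain x where x: "x \<in> ?K" "h = \<beta> x" by blast
    then have xE: "x \<in> E" using KE by blast
    then have x0: "x \<noteq> \<zero>" using m_inv.hyps x b_eq0 by blast
    then have "inv\<^bsub>L'\<^esub> h = \<beta> (inv x)" using b_inv[OF xE] x by simp
    then show ?case using generate_field.m_inv[OF x(1) x0] by blast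
  next
    case (eng_add h k)
    then obtain x z where x: "x \<in> ?K" "h = \<beta> x" and z: "z \<in> ?K" "k = \<beta> z" by blast
    then have "h \<oplus>\<^bsub>L'\<^esub> k = \<beta> (x \<oplus> z)" using b_add[of x z] subsetD[OF KE] by simp
    then show ?case using generate_field.eng_add[OF x(1) z(1)] by blast
  next
    case (eng_mult h k)
    then obtain x z where x: "x \<in> ?K" "h = \<beta> x" and z: "z \<in> ?K" "k = \<beta> z" by blast
    then have "h \<otimes>\<^bsub>L'\<^esub> k = \<beta> (x \<otimes> z)" using b_mult[of x z] subsetD[OF KE] by simp
    then show ?case using generate_field.eng_mult[OF x(1) z(1)] by blast
  qed
  have genK: "fraction_subfield ?R' L' \<phi>' = \<beta> ` ?K"
    unfolding fraction_subfield_def \<phi>'A using gen1 gen2 by blast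
  have K': "subfield (\<beta> ` ?K) L'"
    using L'.generate_field_is_subfield[OF bA] genK unfolding fraction_subfield_def \<phi>'A by simp
  obtain Us where Us: "set Us \<subseteq> carrier L" "Span ?K Us = E" using exists_base[OF K n] by blast
  have UE: "set Us \<subseteq> E" using Span_base_incl[OF K Us(1)] Us(2) by simp
  have "LE.Span ?K Us = E" using Us(2) Span_consistent[OF Er] unfolding LE_def by simp
  then have "L'.Span (\<beta> ` ?K) (map \<beta> Us) = carrier L'"
    using b.Span_hom[of ?K Us] KE UE unfolding LEc L'c by simp
  then have fd: "L'.finite_dimension (\<beta> ` ?K) (carrier L')"
    using L'.Span_finite_dimension[OF K', of "map \<beta> Us"] UE unfolding L'c by auto
  have fin: "finite_module ?R' (integral_closure_module ?R' L' \<phi>')"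
  proof -
    have L'f: "field L'" by (rule L'.field_axioms)
    show ?thesis using N2 fd L'f \<phi>'h \<phi>'inj unfolding N2_domain_def genK[symmetric] by blast
  qed

  have ev: "L'.eval (map \<beta> p) (\<beta> x) = \<beta> (eval p x)" if "set p \<subseteq> E" "x \<in> E" for p x
    using b.eval_hom'[of x p] that eval_consistent[OF Er] unfolding LEc unfolding LE_def by simp
  have evE: "eval p x \<in> E" if "set p \<subseteq> E" "x \<in> E" for p x
    using LE.eval_in_carrier[of p x] that eval_consistent[OF Er] unfolding LEc unfolding LE_def by simp
  let ?T' = "integral_closure L' (\<phi>' ` carrier ?R')"
  have T': "?T' = \<beta> ` (T \<inter> E)"
  proof (intro equalityI subsetI)
    fix y assume "y \<in> ?T'"
    then obtain p where y: "y \<in> carrier L'" and p: "p \<in> carrier ((\<beta> ` A)[X]\<^bsub>L'\<^esub>)" "p \<noteq> []"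
      "hd p = \<one>\<^bsub>L'\<^esub>" "L'.eval p y = \<zero>\<^bsub>L'\<^esub>" unfolding integral_closure_def \<phi>'A by blast
    from y obtain x where x: "x \<in> E" "y = \<beta> x" unfolding L'c by blast
    have pA: "set p \<subseteq> \<beta> ` A" using p(1) unfolding univ_poly_carrier[symmetric] polynomial_def by auto
    have "p \<in> lists (\<beta> ` A)" using pA by auto
    then have "p \<in> map \<beta> ` lists A" by (simp only: lists_image)
    then obtain r where r': "r \<in> lists A" "p = map \<beta> r" by (rule imageE)
    then have r: "set r \<subseteq> A" "p = map \<beta> r" by auto
    have rE: "set r \<subseteq> E" using r(1) E(2) by blast
    have r0: "r \<noteq> []" using p(2) r(2) by simp
    have hr: "hd r \<in> E" using rE r0 by (cases r) auto
    have "\<beta> (hd r) = \<beta> \<one>" using p(3) r(2) r0 b_one by (simp add: hd_map)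
    then have h1: "hd r = \<one>" using inj_onD[OF bi _ hr subringE(3)[OF Er]] by blast
    have "\<beta> (eval r x) = \<zero>\<^bsub>L'\<^esub>" using p(4) ev[OF rE x(1)] unfolding r(2) x(2) by simp
    then have e0: "eval r x = \<zero>" using b_eq0[OF evE[OF rE x(1)]] by simp
    have "r \<in> carrier (A[X])" unfolding univ_poly_carrier[symmetric] polynomial_def
      using r(1) h1 by simp
    then have "x \<in> T" unfolding integral_closure_def using x(1) Ec r0 h1 e0 by blast
    then show "y \<in> \<beta> ` (T \<inter> E)" using x by blast
  next
    fix y assume "y \<in> \<beta> ` (T \<inter> E)"
    then obtain x where x: "x \<in> T" "x \<in> E" "y = \<beta> x" by blast
    from x(1) obtain p where p: "p \<in> carrier (A[X])" "p \<noteq> []"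
      "hd p = \<one>" "eval p x = \<zero>" unfolding integral_closure_def by blast
    have pA: "set p \<subseteq> A" using p(1) unfolding univ_poly_carrier[symmetric] polynomial_def by auto
    have pE: "set p \<subseteq> E" using pA E(2) by blast
    have h1: "hd (map \<beta> p) = \<one>\<^bsub>L'\<^esub>" using p(2,3) b_one by (simp add: hd_map)
    have "map \<beta> p \<in> carrier ((\<beta> ` A)[X]\<^bsub>L'\<^esub>)"
      unfolding univ_poly_carrier[symmetric] polynomial_def using pA h1 by auto
    moreover have "L'.eval (map \<beta> p) y = \<zero>\<^bsub>L'\<^esub>" unfolding x(3) ev[OF pE x(2)] p(4) by (rule b_zero)
    moreover have "y \<in> carrier L'" unfolding x(3) by (rule b_c[OF x(2)])
    moreover have "map \<beta> p \<noteq> []" using p(2) by simp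
    ultimately show "y \<in> ?T'" unfolding integral_closure_def \<phi>'A using h1 by blast
  qed

  let ?M = "RS\<lparr>carrier := T \<inter> E\<rparr>"
  let ?M' = "integral_closure_module ?R' L' \<phi>'"
  have TE: "subring (T \<inter> E) L" by (rule subring_inter[OF T_subring Er])
  have "submodule (T \<inter> E) R RS" by (rule submodule_of_subset[OF TE]) (use E(2) A_integral in blast)
  then interpret M: module R ?M using submodule.submodule_is_module[OF _ RS_module] by blast
  interpret Z: ideal "{\<zero>\<^bsub>R\<^esub>}" R by (rule ring.zeroideal[OF cring.axioms(1)[OF R_cring]])
  have R'c: "cring ?R'" by (rule Z.quotient_is_cring[OF R_cring])
  interpret RS': module ?R' "restrict_scalars L' \<phi>'"
    by (rule restrict_scalars_module[OF R'c L'.is_cring \<phi>'h])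
  have img: "submodule (\<beta> ` N) ?R' (restrict_scalars L' \<phi>')" if N: "submodule N R ?M" for N
  proof (rule RS'.submodule_criterion)
    note N' = M.submoduleE[OF N]
    have NE: "N \<subseteq> E" using N'(1) by auto
    show "\<beta> ` N \<subseteq> carrier (restrict_scalars L' \<phi>')" using NE unfolding restrict_scalars_simps L'c by blast
    show "\<zero>\<^bsub>restrict_scalars L' \<phi>'\<^esub> \<in> \<beta> ` N" using M.submodule_zero[OF N] b_zero by force
    show "a \<oplus>\<^bsub>restrict_scalars L' \<phi>'\<^esub> b \<in> \<beta> ` N" if ab: "a \<in> \<beta> ` N" "b \<in> \<beta> ` N" for a b
    proof -
      from ab obtain x y where xy: "x \<in> N" "y \<in> N" "a = \<beta> x" "b = \<beta> y" by blast
      then have "a \<oplus>\<^bsub>L'\<^esub> b = \<beta> (x \<oplus> y)" using b_add[of x y] subsetD[OF NE] by simp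
      then show ?thesis using N'(5)[OF xy(1,2)] by simp
    qed
    show "a \<odot>\<^bsub>restrict_scalars L' \<phi>'\<^esub> z \<in> \<beta> ` N" if a: "a \<in> carrier ?R'" and z: "z \<in> \<beta> ` N" for a z
    proof -
      from a obtain r where r: "r \<in> carrier R" "a = {r}" unfolding q(1) by blast
      from z obtain x where x: "x \<in> N" "z = \<beta> x" by blast
      then have "\<phi>' a \<otimes>\<^bsub>L'\<^esub> z = \<beta> (\<phi> r \<otimes> x)" using b_mult[of "\<phi> r" x] subsetD[OF NE] \<phi>E[OF r(1)] unfolding r(2) \<phi>'s by simp
      then show ?thesis using N'(4)[OF r(1) x(1)] by simp
    qed
  qed
  have M'eq: "?M' = (restrict_scalars L' \<phi>')\<lparr>carrier := \<beta> ` (T \<inter> E)\<rparr>"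
    unfolding integral_closure_module_eq T' ..
  have sT: "submodule (\<beta> ` (T \<inter> E)) ?R' (restrict_scalars L' \<phi>')"
    using img[OF M.carrier_is_submodule] by simp
  interpret M': module ?R' ?M' unfolding M'eq
    by (rule submodule.submodule_is_module[OF sT RS'.module_axioms])
  from fin obtain S' where S': "finite S'" "S' \<subseteq> carrier ?M'" "module_span ?R' ?M' S' = carrier ?M'"
    unfolding finite_module_def by blast
  have "S' \<subseteq> \<beta> ` (T \<inter> E)" using S'(2) unfolding M'eq by simp
  then obtain S where S: "finite S" "S \<subseteq> T \<inter> E" "S' = \<beta> ` S"
    using finite_subset_image[OF S'(1)] by metis
  have "T \<inter> E \<subseteq> N" if N: "submodule N R ?M" "S \<subseteq> N" for N
  proof -
    have NTE: "N \<subseteq> T \<inter> E" using M.submoduleE(1)[OF N(1)] by simp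
    note i = RS'.submoduleE[OF img[OF N(1)]]
    have "submodule (\<beta> ` N) ?R' ?M'"
      by (rule M'.submodule_criterion)
         (use NTE i RS'.submodule_zero[OF img[OF N(1)]] in \<open>auto simp: M'eq\<close>)
    then have "carrier ?M' \<subseteq> \<beta> ` N" unfolding S'(3)[symmetric]
      by (rule M'.span_least) (use S(3) N(2) in blast)
    then have sub: "\<beta> ` (T \<inter> E) \<subseteq> \<beta> ` N" unfolding M'eq by simp
    show ?thesis
    proof
      fix x assume x: "x \<in> T \<inter> E"
      then obtain y where y: "y \<in> N" "\<beta> x = \<beta> y" using sub by blast
      then have "x = y" using inj_onD[OF bi y(2)] x NTE by blast
      then show "x \<in> N" using y(1) by simp
    qed
  qed
  then have "T \<inter> E \<subseteq> module_span R ?M S" unfolding module_span_def by blast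
  moreover have "module_span R ?M S \<subseteq> T \<inter> E" using M.span_in_carrier[of S] S(2) by simp
  ultimately show ?thesis unfolding finite_module_def using S(1,2) by (intro exI[of _ S]) auto
qed

end

section \<open>Ideal separation of the absolute integral closure\<close>

text \<open>
  Submodules of \<open>I\<close> are ideals, so generators of the ideal generate the module.
\<close>

lemma (in noetherian_ring) finite_ideal_module:
  assumes cr: "cring R" and I: "ideal I R"
  shows "finite_module R (ideal_module R I)"
proof -
  interpret cring R by fact
  interpret I: ideal I R by fact
  interpret N: module R "ideal_module R I" by (rule ideal_module_is_module[OF cr I])
  obtain Y where Y: "Y \<subseteq> carrier R" "finite Y" "I = Idl Y" using finetely_gen[OF I] by blast
  have YI: "Y \<subseteq> I" using genideal_self[OF Y(1)] Y(3) by simp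
  have c: "carrier (ideal_module R I) = I" by (simp add: ideal_module_def)
  have "I \<subseteq> Q" if Q: "submodule Q R (ideal_module R I)" "Y \<subseteq> Q" for Q
  proof -
    note Q' = N.submoduleE[OF Q(1)]
    have QR: "Q \<subseteq> carrier R" using Q'(1) I.a_subset unfolding c by blast
    have sm: "a \<otimes> x \<in> Q" if "a \<in> carrier R" "x \<in> Q" for a x
      using Q'(4)[OF that] by (simp add: ideal_module_def)
    have "ideal Q R"
    proof (rule idealI[OF ring_axioms])
      show "subgroup Q (add_monoid R)"
      proof (rule add.subgroupI[OF QR Q'(2)])
        show "\<ominus> a \<in> Q" if "a \<in> Q" for a
        proof -
          have "\<ominus> \<one> \<otimes> a = \<ominus> a" using that QR by (auto simp: l_minus)
          then show ?thesis using sm[of "\<ominus> \<one>" a] that by simp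
        qed
        show "a \<oplus> b \<in> Q" if "a \<in> Q" "b \<in> Q" for a b
          using Q'(5)[OF that] by (simp add: ideal_module_def)
      qed
      show "x \<otimes> a \<in> Q" if "a \<in> Q" "x \<in> carrier R" for a x using sm that by blast
      then show "a \<otimes> x \<in> Q" if "a \<in> Q" "x \<in> carrier R" for a x
        using that QR m_comm[of a x] by auto
    qed
    then show ?thesis unfolding Y(3) using Q(2) by (rule genideal_minimal)
  qed
  then have "I \<subseteq> module_span R (ideal_module R I) Y" unfolding module_span_def by blast
  moreover have "module_span R (ideal_module R I) Y \<subseteq> I" using N.span_in_carrier[of Y] YI c by simp
  ultimately show ?thesis unfolding finite_module_def c using Y(2) YI by (intro exI[of _ Y]) auto
qed

lemma rationals_nat_inverse:
  fixes R (structure) and d :: nat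
  assumes R: "cring R" and Q: "contains_rationals R"
  shows "d > 0 \<Longrightarrow> \<exists>q\<in>carrier R. [d] \<cdot> \<one> \<otimes> q = \<one>" and "infinite (carrier R)"
proof -
  interpret cring R by fact
  obtain h where h: "h \<in> ring_hom (ring_of_type_algebra :: rat ring) R" "inj h"
    using Q unfolding contains_rationals_def by blast
  note hm = ring_hom_memE[OF h(1), unfolded ring_of_type_algebra_def, simplified]
  have h0: "h 0 = \<zero>"
  proof -
    have "h 0 \<oplus> h 0 = h 0" using hm(3)[of 0 0] by simp
    then show ?thesis using hm(1)[of 0] by (metis add.r_cancel_one')
  qed
  have n: "h (of_nat k) = [k] \<cdot> \<one>" for k
    by (induction k) (use h0 hm in \<open>auto simp: add.m_comm\<close>)
  show "\<exists>q\<in>carrier R. [d] \<cdot> \<one> \<otimes> q = \<one>" if "d > 0"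
  proof (rule bexI[of _ "h (1 / of_nat d)"])
    have "[d] \<cdot> \<one> \<otimes> h (1 / of_nat d) = h (of_nat d * (1 / of_nat d))"
      unfolding hm(2) n ..
    then show "[d] \<cdot> \<one> \<otimes> h (1 / of_nat d) = \<one>" using that hm(4) by simp
  qed (rule hm(1))
  have "infinite (range h)" using h(2) by (simp add: finite_image_iff infinite_UNIV_char_0)
  then show "infinite (carrier R)" using hm(1) by (meson finite_subset image_subsetI)
qed

text \<open>
  The minimal polynomial over the larger field divides the one over \<open>K\<close>, which splits.
\<close>

lemma (in algebraic_closure) Irr_splitted:
  assumes F: "subfield F L" "K \<subseteq> F" and \<alpha>: "\<alpha> \<in> carrier L"
  shows "(algebraic over F) \<alpha>" and "splitted (Irr F \<alpha>)"
proof -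
  have aK: "(algebraic over K) \<alpha>" using algebraic_extension[OF \<alpha>] .
  show aF: "(algebraic over F) \<alpha>" by (rule algebraic_mono[OF F(2) aK])
  have K: "subfield K L" by (rule subfield_axioms)
  note IK = IrrE[OF K \<alpha> aK] and IF = IrrE[OF F(1) \<alpha> aF]
  have "Irr K \<alpha> \<in> carrier (F[X])"
    using IK(1) F(2) unfolding univ_poly_carrier[symmetric] polynomial_def by auto
  then have "Irr F \<alpha> pdivides Irr K \<alpha>" using Irr_minimal[OF F(1) \<alpha> aF _ IK(4)] by blast
  then show "splitted (Irr F \<alpha>)"
    using pdivides_imp_splitted[OF carrier_polynomial_shell[OF subfieldE(1)[OF F(1)] IF(1)]
        carrier_polynomial_shell[OF subfieldE(1)[OF K] IK(1)]
        pirreducibleE(1)[OF subfieldE(1)[OF K] IK(1,2)] roots_over_subfield[OF IK(1)]]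
    by blast
qed

theorem theorem3p1:
  fixes R :: "'a ring" and m :: "'a set" and L :: "'b ring" and \<phi> :: "'a \<Rightarrow> 'b"
  assumes "noetherian_domain R"
    and "local_ring R m"
    and "contains_rationals R"
    and "nagata_ring R"
    and "algebraic_closure_of_fractions R L \<phi>"
  shows "adically_ideal_separated R m (integral_closure_module R L \<phi>)"
  unfolding adically_ideal_separated_def
proof (intro allI impI)
  fix I assume I: "ideal I R"
  have noeth: "noetherian_ring R" and dom: "domain R"
    using assms(1) unfolding noetherian_domain_def by auto
  have cr: "cring R" using dom unfolding domain_def by auto
  have hom: "\<phi> \<in> ring_hom R L" and inj: "inj_on \<phi> (carrier R)"
    and ac: "algebraic_closure L (fraction_subfield R L \<phi>)"
    using assms(5) unfolding algebraic_closure_of_fractions_def by auto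
  have fL: "field L" using ac unfolding algebraic_closure_def by blast
  interpret noetherian_extension L R \<phi>
    by (intro noetherian_extension.intro noetherian_extension_axioms.intro fL cr noeth hom)
  define K where "K = generate_field L A"
  have Kf: "fraction_subfield R L \<phi> = K" unfolding fraction_subfield_def K_def ..
  have K: "subfield K L" unfolding K_def by (rule generate_field_is_subfield[OF A_carrier])
  have AK: "A \<subseteq> K" unfolding K_def by (auto intro: generate_field.incl)
  have N2: "N2_domain (R Quot {\<zero>\<^bsub>R\<^esub>})"
    using assms(4) domain.zeroprimeideal[OF dom] unfolding nagata_ring_def by blast
  have inf: "infinite (carrier R)" by (rule rationals_nat_inverse(2)[OF cr assms(3)])
  have Q: "\<exists>q\<in>A. [d] \<cdot>\<^bsub>L\<^esub> \<one>\<^bsub>L\<^esub> \<otimes>\<^bsub>L\<^esub> q = \<one>\<^bsub>L\<^esub>" if d: "d > 0" for d :: nat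
  proof -
    obtain q where q: "q \<in> carrier R" "[d] \<cdot>\<^bsub>R\<^esub> \<one>\<^bsub>R\<^esub> \<otimes>\<^bsub>R\<^esub> q = \<one>\<^bsub>R\<^esub>"
      using rationals_nat_inverse(1)[OF cr assms(3) d] by blast
    have c: "[k] \<cdot>\<^bsub>R\<^esub> \<one>\<^bsub>R\<^esub> \<in> carrier R" for k :: nat
      using cr by (simp add: cring_def ring_def abelian_group_def abelian_monoid.a_monoid RS.R.add.nat_pow_closed)
    interpret h: ring_hom_ring R L \<phi> by (rule phi_hom_ring)
    have n: "\<phi> ([k] \<cdot>\<^bsub>R\<^esub> \<one>\<^bsub>R\<^esub>) = [k] \<cdot>\<^bsub>L\<^esub> \<one>\<^bsub>L\<^esub>" for k :: nat
      by (induction k) (use c in auto)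
    have "\<phi> ([d] \<cdot>\<^bsub>R\<^esub> \<one>\<^bsub>R\<^esub> \<otimes>\<^bsub>R\<^esub> q) = \<phi> ([d] \<cdot>\<^bsub>R\<^esub> \<one>\<^bsub>R\<^esub>) \<otimes>\<^bsub>L\<^esub> \<phi> q"
      by (rule phi_simps(3)[OF c q(1)])
    then have "[d] \<cdot>\<^bsub>L\<^esub> \<one>\<^bsub>L\<^esub> \<otimes>\<^bsub>L\<^esub> \<phi> q = \<one>\<^bsub>L\<^esub>" unfolding q(2) n phi_simps(4) by (rule sym)
    then show ?thesis using q(1) by blast
  qed
  let ?M = "integral_closure_module R L \<phi>" and ?N = "ideal_module R I"
  have Meq: "?M = RS\<lparr>carrier := T\<rparr>" by (rule integral_closure_module_eq)
  have TS: "submodule T R RS" by (rule submodule_of_subset[OF T_subring]) (use A_integral in blast)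
  have Mm: "module R ?M" unfolding Meq by (rule submodule.submodule_is_module[OF TS RS_module])
  interpret M: module R ?M by (rule Mm)
  have Nm: "module R ?N" by (rule ideal_module_is_module[OF cr I])
  have Nfin: "finite_module R ?N" by (rule noetherian_ring.finite_ideal_module[OF noeth cr I])
  interpret TT: tensor R ?M ?N unfolding tensor_def using Mm Nm by blast
  have m: "ideal m R" using assms(2) unfolding local_ring_def maximalideal_def by blast
  show "adically_separated R m (tensor_product R ?M ?N)"
  proof (rule TT.adically_separated_of_retracts)
    show "m [^]\<^bsub>ideals_set R\<^esub> (n::nat) \<subseteq> carrier R" for n
      using cring.ideal_pow_ideal[OF cr m, of n] by (auto dest: ideal.Icarr)
    fix B assume B: "finite B" "B \<subseteq> carrier ?M"
    have BT: "B \<subseteq> T" using B(2) unfolding Meq by simp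
    obtain xs where xs: "set xs = B" using finite_list[OF B(1)] by blast
    have xc: "set xs \<subseteq> carrier L" using xs BT T_carrier by blast
    have xa: "(algebraic over K) x" if "x \<in> set xs" for x
      using algebraic_closure.algebraic_extension[OF ac, of x] that xc unfolding Kf by blast
    define E where "E = finite_extension K xs"
    have E: "subfield E L" unfolding E_def by (rule finite_extension_is_subfield[OF K xc xa])
    have Efd: "finite_dimension K E"
      unfolding E_def by (rule finite_extension_finite_dimension(1)[OF K xc xa])
    note Kr = subfieldE(1)[OF K]
    have KE: "K \<subseteq> E" unfolding E_def by (rule finite_extension_incl[OF subringE(1)[OF Kr] xc])
    have xE: "B \<subseteq> E" unfolding E_def using finite_extension_mem[OF Kr xc] xs by blast
    have AE: "A \<subseteq> E" using AK KE by blast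
    note Er = subfieldE(1)[OF E]
    have "(algebraic over F) \<alpha> \<and> splitted (Irr F \<alpha>)"
      if "subfield F L" "E \<subseteq> F" "\<alpha> \<in> carrier L" for F \<alpha>
      using algebraic_closure.Irr_splitted[OF ac that(1) _ that(3)] that(2) KE unfolding Kf by blast
    from exists_retraction[OF E AE this Q]
    obtain \<rho> where \<rho>: "\<forall>x\<in>carrier L. \<rho> x \<in> E"
      "\<forall>x\<in>carrier L. \<forall>y\<in>carrier L. \<rho> (x \<oplus>\<^bsub>L\<^esub> y) = \<rho> x \<oplus>\<^bsub>L\<^esub> \<rho> y"
      "\<forall>c\<in>E. \<forall>x\<in>carrier L. \<rho> (c \<otimes>\<^bsub>L\<^esub> x) = c \<otimes>\<^bsub>L\<^esub> \<rho> x"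
      "\<forall>c\<in>E. \<rho> c = c" "\<forall>x\<in>T. \<rho> x \<in> T" by blast
    define S where "S = T \<inter> E"
    have MS: "?M\<lparr>carrier := S\<rparr> = RS\<lparr>carrier := T \<inter> E\<rparr>" unfolding Meq S_def by simp
    have Sr: "subring S L" unfolding S_def by (rule subring_inter[OF T_subring Er])
    have AS: "A \<subseteq> S" unfolding S_def using AE A_integral by blast
    have Ssub: "submodule S R ?M"
    proof (rule M.submodule_criterion)
      show "S \<subseteq> carrier ?M" unfolding Meq S_def by simp
      show "\<zero>\<^bsub>?M\<^esub> \<in> S" using subringE(2)[OF Sr] by (simp add: Meq)
      show "a \<oplus>\<^bsub>?M\<^esub> b \<in> S" if "a \<in> S" "b \<in> S" for a b
        using subringE(7)[OF Sr that] by (simp add: Meq)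
      show "a \<odot>\<^bsub>?M\<^esub> x \<in> S" if "a \<in> carrier R" "x \<in> S" for a x
        using subringE(6)[OF Sr subsetD[OF AS imageI[OF that(1)]] that(2)] by (simp add: Meq)
    qed
    have retr: "tensor_retraction R ?M ?N S \<rho>"
    proof (intro tensor_retraction.intro tensor_retraction_axioms.intro)
      show "tensor R ?M ?N" by (rule TT.tensor_axioms)
      show "submodule S R ?M" by (rule Ssub)
      show "\<rho> x \<in> S" if "x \<in> carrier ?M" for x
        using that \<rho>(1,5) T_carrier unfolding Meq S_def by auto
      show "\<rho> (x \<oplus>\<^bsub>?M\<^esub> y) = \<rho> x \<oplus>\<^bsub>?M\<^esub> \<rho> y" if "x \<in> carrier ?M" "y \<in> carrier ?M" for x y
        using that \<rho>(2) T_carrier unfolding Meq by auto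
      show "\<rho> (a \<odot>\<^bsub>?M\<^esub> x) = a \<odot>\<^bsub>?M\<^esub> \<rho> x" if "a \<in> carrier R" "x \<in> carrier ?M" for a x
        using that \<rho>(3) AE T_carrier unfolding Meq by auto
    qed
    have Sm: "module R (?M\<lparr>carrier := S\<rparr>)" by (rule submodule.submodule_is_module[OF Ssub Mm])
    interpret TS: tensor R "?M\<lparr>carrier := S\<rparr>" ?N unfolding tensor_def using Sm Nm by blast
    have "finite_module R (?M\<lparr>carrier := S\<rparr>)"
      unfolding MS by (rule N2_integral_closure_finite[OF dom inj N2 inf E AE Efd[unfolded K_def]])
    then have "finite_module R (tensor_product R (?M\<lparr>carrier := S\<rparr>) ?N)"
      using TS.finite_tensor_product Nfin by blast
    then have "adically_separated R m (tensor_product R (?M\<lparr>carrier := S\<rparr>) ?N)"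
      unfolding adically_separated_def
      by (rule module.krull_intersection[OF TS.tensor_product_is_module noeth assms(2)])
    moreover have "B \<subseteq> S" unfolding S_def using BT xE by blast
    moreover have "\<forall>x\<in>S. \<rho> x = x" unfolding S_def using \<rho>(4) by blast
    ultimately show "\<exists>S f. tensor_retraction R ?M ?N S f \<and> B \<subseteq> S \<and> (\<forall>x\<in>S. f x = x)
        \<and> adically_separated R m (tensor_product R (?M\<lparr>carrier := S\<rparr>) ?N)"
      using retr by blast
  qed
qed

end
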